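(* Let $\Lambda$ be a finite $k$-graph, and $(G,\Lambda)$ a self-similar groupoid action. Let $\mathcal T(G,\Lambda)=\mathcal{NT}(M)$ be the Nica–Toeplitz algebra of the product system $M=M(G,\Lambda)$, with universal Nica covariant representation $\psi$, and put $u_g=\psi_0(i_g)$ ($g\in G$), $t_v=\psi_0(i_v)$ ($v\in\Lambda^0$), $t_\lambda=\psi_p(\delta_\lambda\otimes i_{s(\lambda)})$ ($\lambda\in\Lambda^p$, $p\neq0$). Then $(\mathcal T(G,\Lambda),(u,t))$ is universal for families $\{U_g:g\in G\}\cup\{T_\lambda:\lambda\in\Lambda\}$ in a $C^*$-algebra $B$ satisfying (1) $U$ is a unitary representation of $G$ with $U_v=T_v$ for $v\in\Lambda^0$; (2) $\{T_\lambda:\lambda\in\Lambda\}$ is a Toeplitz–Cuntz–Krieger $\Lambda$-family, with $\sum_{v\in\Lambda^0}T_v$ the identity of $B$; (3) for $g\in G$ and $\lambda\in\Lambda$, $U_gT_\lambda=T_{g\cdot\lambda}U_{g|_\lambda}$ if $\operatorname{dom}(g)=r(\lambda)$, and $U_gT_\lambda=0$ otherwise. That is, for every such family in $B$ there is a homomorphism $\rho_*:\mathcal T(G,\Lambda)\to B$ with $\rho_*(u_g)=U_g$ and $\rho_*(t_\lambda)=T_\lambda$ for all $g\in G$, $\lambda\in\Lambda$.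
   Context: Conventions: $\mathbb N=\{0,1,2,\dots\}$ and $e_1,\dots,e_k$ are the standard generators of $\mathbb N^k$ ($k\ge1$). A $k$-graph is a countable small category $\Lambda$ with a degree functor $d:\Lambda\to\mathbb N^k$ such that whenever $d(\lambda)=p+q$ there are unique $\mu,\nu$ with $\lambda=\mu\nu$, $d(\mu)=p$, $d(\nu)=q$. Write $\Lambda^p=d^{-1}(p)$; $\Lambda^0$ is identified with the set of objects (vertices); $r,s:\Lambda\to\Lambda^0$ are the codomain and domain maps, so $\lambda\mu$ is defined iff $s(\lambda)=r(\mu)$. An edge is an element of some $\Lambda^{e_i}$. $v\Lambda=r^{-1}(v)$, $v\Lambda^p=v\Lambda\cap\Lambda^p$. $\Lambda$ is finite if every $\Lambda^p$ is finite. Self-similar actions: For a groupoid $G$, $\operatorname{dom},\operatorname{cod}$ are the source and range maps, and $gh$ is defined iff $\operatorname{dom}(g)=\operatorname{cod}(h)$. A partial isomorphism of $\Lambda$ consists of $v,w\in\Lambda^0$ and a bijection $g:v\Lambda\to w\Lambda$ with $g(v\Lambda^p)=w\Lambda^p$ for all $p$, and $g(\lambda e)\in g(\lambda)\Lambda$ for all $\lambda\in v\Lambda$ and edges $e\in s(\lambda)\Lambda$; put $\operatorname{dom}(g)=v$, $\operatorname{cod}(g)=w$. These form a groupoid $\operatorname{PIso}(\Lambda)$ under composition, with unit space $\Lambda^0$ ($v$ identified with $\mathrm{id}_{v\Lambda}$). An action of a groupoid $G$ with unit space $\Lambda^0$ on $\Lambda$ is a (unit-preserving) groupoid homomorphism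 $G\to\operatorname{PIso}(\Lambda)$, written $g\cdot\mu$; it is faithful if injective. A self-similar groupoid action $(G,\Lambda)$ is a faithful action such that for every $g\in G$ and edge $e\in\operatorname{dom}(g)\Lambda$ there is $h\in G$ with $g\cdot(e\lambda)=(g\cdot e)(h\cdot\lambda)$ for all $\lambda\in s(e)\Lambda$; this $h$ is unique and written $g|_e$. For $\lambda\in\operatorname{dom}(g)\Lambda$, factored into edges as $\lambda_1\cdots\lambda_l$, put $g|_\lambda=(\cdots(g|_{\lambda_1})|_{\lambda_2}\cdots)|_{\lambda_l}$ (independent of the factorisation; $g|_{\operatorname{dom}(g)}=g$). Representations: a unitary representation of $G$ in a $C^*$-algebra is a family of partial isometries $\{U_g:g\in G\}$ such that $\{U_v:v\in G^{(0)}\}$ are mutually orthogonal projections, $U_g^*=U_{g^{-1}}$, $U_gU_h=U_{gh}$ if $\operatorname{dom}(g)=\operatorname{cod}(h)$ and $0$ otherwise; $C^*(G)$ is generated by a universal one, $\{i_g\}$. With $\Lambda^{\min}(\lambda,\mu)=\{(\eta,\zeta):\lambda\eta=\mu\zeta,\ d(\lambda\eta)=d(\lambda)\vee d(\mu)\}$ ($\vee$ coordinatewise maximum), a Toeplitz–Cuntz–Krieger $\Lambda$-family is a set of partial isometries $\{T_\lambda\}$ such that $\{T_v:v\in\Lambda^0\}$ are mutually orthogonal projections, $T_\lambda T_\mu=T_{\lambda\mu}$ if $s(\lambda)=r(\mu)$, and $T_\lambda^*T_\mu=\sum_{(\eta,\zeta)\in\Lambda^{\min}(\lambda,\mu)}T_\eta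 T_\zeta^*$ for all $\lambda,\mu$ (empty sums are $0$). The product system $M(G,\Lambda)$: $A=C^*(G)$, $M_0={}_AA_A$ (with $\langle a,b\rangle=a^*b$). For $p\neq0$, $M_p=X(\Lambda^p)\otimes_{C(\Lambda^0)}C^*(G)$, where $X(\Lambda^p)=C(\Lambda^p)$ has $(x\cdot a)(\lambda)=x(\lambda)a(s(\lambda))$, $(a\cdot x)(\lambda)=a(r(\lambda))x(\lambda)$, $\langle x,y\rangle(v)=\sum_{s(\lambda)=v}\overline{x(\lambda)}y(\lambda)$, and $C(\Lambda^0)$ acts on $C^*(G)$ through $\delta_v\mapsto i_v$; $\delta_\lambda$ is the point mass. $M_p$ has right action $(x\otimes a)\cdot b=x\otimes ab$, inner product $\langle x\otimes a,y\otimes b\rangle=a^*\langle x,y\rangle b$, and left action $\varphi_p:A\to\mathcal L(M_p)$ (adjointable operators) determined by $i_g\cdot(\delta_\lambda\otimes a)=\delta_{g\cdot\lambda}\otimes i_{g|_\lambda}a$ if $r(\lambda)=\operatorname{dom}(g)$, $0$ otherwise. Multiplication $M_p\times M_q\to M_{p+q}$ ($p,q\ne0$) is determined by $(\delta_\lambda\otimes i_g)(\delta_\mu\otimes i_h)=\delta_{\lambda(g\cdot\mu)}\otimes i_{(g|_\mu)h}$ if $r(\mu)=\operatorname{dom}(g)$, $0$ otherwise (for $s(\lambda)=\operatorname{cod}(g)$, $s(\mu)=\operatorname{cod}(h)$); multiplication by $M_0$ is by the left and right actions. This is a compactly aligned product system with $M_p\otimes_AM_q\cong M_{p+q}$. Nica–Toeplitz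 algebra: $\mathcal K(M_p)$ is the closed span of the operators $\Theta_{x,y}(z)=x\cdot\langle y,z\rangle$; for $S\in\mathcal L(M_p)$, $S_p^{p\vee q}\in\mathcal L(M_{p\vee q})$ corresponds to $S\otimes1$ on $M_p\otimes_AM_{(p\vee q)-p}\cong M_{p\vee q}$. A Toeplitz representation of $M$ in a $C^*$-algebra $B$ is a map $\psi:M\to B$, $\psi_p=\psi|_{M_p}$, with $\psi_0$ a homomorphism, each $\psi_p$ linear, $\psi_p(x)^*\psi_p(y)=\psi_0(\langle x,y\rangle)$, and $\psi_{p+q}(xy)=\psi_p(x)\psi_q(y)$; $\psi^{(p)}:\mathcal K(M_p)\to B$ is the homomorphism with $\psi^{(p)}(\Theta_{x,y})=\psi_p(x)\psi_p(y)^*$. It is Nica covariant if $\psi^{(p)}(S)\psi^{(q)}(T)=\psi^{(p\vee q)}(S_p^{p\vee q}T_q^{p\vee q})$ for all $p,q$, $S\in\mathcal K(M_p)$, $T\in\mathcal K(M_q)$. $\mathcal{NT}(M)$ is the $C^*$-algebra generated by a universal Nica covariant representation. *)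

theory Defs
  imports "HOL-Analysis.Analysis" "HOL-Library.Function_Algebras" "HOL-Library.FuncSet"
begin

section \<open>Complex vector spaces and $C^*$-algebras\<close>

class complex_vector = ab_group_add +
  fixes scaleC :: "complex \<Rightarrow> 'a \<Rightarrow> 'a"  (infixr "*\<^sub>C" 75)
  assumes scaleC_add_right: "c *\<^sub>C (x + y) = c *\<^sub>C x + c *\<^sub>C y"
    and scaleC_add_left: "(c + c') *\<^sub>C x = c *\<^sub>C x + c' *\<^sub>C x"
    and scaleC_scaleC: "c *\<^sub>C (c' *\<^sub>C x) = (c * c') *\<^sub>C x"
    and scaleC_one: "1 *\<^sub>C x = x"

interpretation complex_vector:
  vector_space "scaleC :: complex \<Rightarrow> 'v \<Rightarrow> 'v::complex_vector"
  by unfold_locales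
    (simp_all add: scaleC_add_right scaleC_add_left scaleC_scaleC scaleC_one)

instantiation "fun" :: (type, complex_vector) complex_vector
begin
definition "c *\<^sub>C f = (\<lambda>x. c *\<^sub>C f x)"
instance
  by standard
    (simp_all add: scaleC_fun_def fun_eq_iff scaleC_add_right scaleC_add_left
      scaleC_scaleC scaleC_one)
end

instantiation prod :: (complex_vector, complex_vector) complex_vector
begin
definition "c *\<^sub>C z = (c *\<^sub>C fst z, c *\<^sub>C snd z)"
instance
  by standard
    (simp_all add: scaleC_prod_def prod_eq_iff scaleC_add_right scaleC_add_left
      scaleC_scaleC scaleC_one)
end

definition clinear_on :: "'v::complex_vector set \<Rightarrow> ('v \<Rightarrow> 'w::complex_vector) \<Rightarrow> bool"
  where "clinear_on V f \<longleftrightarrow>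
    (\<forall>x\<in>V. \<forall>y\<in>V. f (x + y) = f x + f y) \<and> (\<forall>c. \<forall>x\<in>V. f (c *\<^sub>C x) = c *\<^sub>C f x)"

text \<open>$C^*$-algebras are not assumed to be unital, and the zero algebra is allowed.\<close>

class cstar_algebra = complex_vector + real_normed_algebra + banach +
  fixes star :: "'a \<Rightarrow> 'a"
  assumes scaleR_scaleC: "scaleR r x = complex_of_real r *\<^sub>C x"
    and norm_scaleC: "norm (c *\<^sub>C x) = cmod c * norm x"
    and mult_scaleC_left: "(c *\<^sub>C x) * y = c *\<^sub>C (x * y)"
    and mult_scaleC_right: "x * (c *\<^sub>C y) = c *\<^sub>C (x * y)"
    and star_add: "star (x + y) = star x + star y"
    and star_scaleC: "star (c *\<^sub>C x) = cnj c *\<^sub>C star x"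
    and star_mult: "star (x * y) = star y * star x"
    and star_star: "star (star x) = x"
    and cstar_identity: "norm (star x * x) = (norm x)\<^sup>2"

instantiation complex :: cstar_algebra
begin
definition "c *\<^sub>C (z::complex) = c * z"
definition "star (z::complex) = cnj z"
instance
  by standard
    (auto simp: scaleC_complex_def star_complex_def algebra_simps norm_mult
      scaleR_conv_of_real power2_eq_square)
end

definition star_hom :: "('a::cstar_algebra \<Rightarrow> 'b::cstar_algebra) \<Rightarrow> bool"
  where "star_hom \<pi> \<longleftrightarrow> clinear_on UNIV \<pi> \<and>
    (\<forall>a b. \<pi> (a * b) = \<pi> a * \<pi> b) \<and> (\<forall>a. \<pi> (star a) = star (\<pi> a))"

definition cstar_subalgebra :: "'a::cstar_algebra set \<Rightarrow> bool"
  where "cstar_subalgebra C \<longleftrightarrow> complex_vector.subspace C \<and> closed C \<and>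
    (\<forall>a\<in>C. \<forall>b\<in>C. a * b \<in> C) \<and> (\<forall>a\<in>C. star a \<in> C)"

definition cstar_generated :: "'a::cstar_algebra set \<Rightarrow> 'a set"
  where "cstar_generated S = \<Inter>{C. cstar_subalgebra C \<and> S \<subseteq> C}"

definition is_projection :: "'a::cstar_algebra \<Rightarrow> bool"
  where "is_projection e \<longleftrightarrow> e * e = e \<and> star e = e"

definition partial_isometry :: "'a::cstar_algebra \<Rightarrow> bool"
  where "partial_isometry x \<longleftrightarrow> x * star x * x = x"

definition orthogonal_projections :: "'i set \<Rightarrow> ('i \<Rightarrow> 'a::cstar_algebra) \<Rightarrow> bool"
  where "orthogonal_projections I e \<longleftrightarrow>
    (\<forall>i\<in>I. is_projection (e i)) \<and> (\<forall>i\<in>I. \<forall>j\<in>I. i \<noteq> j \<longrightarrow> e i * e j = 0)"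


section \<open>Higher-rank graphs\<close>

text \<open>
  The monoid of $k$-tuples of natural numbers is the type of functions from a finite type
  \<open>'k\<close> (which is nonempty, so $k \ge 1$) to \<^typ>\<open>nat\<close>, with pointwise \<open>+\<close> and \<open>-\<close>;
  the coordinatewise maximum is \<^const>\<open>sup\<close>.

  A small category is given by its morphisms alone: an object is identified with its
  identity morphism, so \<open>rng\<close> (codomain) and \<open>src\<close> (domain) take values in the
  morphisms.  By \<open>vertices_eq\<close> below the objects are then exactly the morphisms of
  degree \<open>0\<close>.  The product \<open>cmp \<Lambda> \<alpha> \<mu>\<close> is meaningful only if \<open>src \<Lambda> \<alpha> = rng \<Lambda> \<mu>\<close>.
\<close>

record ('l, 'k) graph =
  mor :: "'l set"
  rng :: "'l \<Rightarrow> 'l"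
  src :: "'l \<Rightarrow> 'l"
  cmp :: "'l \<Rightarrow> 'l \<Rightarrow> 'l"
  deg :: "'l \<Rightarrow> ('k \<Rightarrow> nat)"

definition level :: "('l, 'k) graph \<Rightarrow> ('k \<Rightarrow> nat) \<Rightarrow> 'l set"
  where "level \<Lambda> p = {\<alpha> \<in> mor \<Lambda>. deg \<Lambda> \<alpha> = p}"

definition vertices :: "('l, 'k) graph \<Rightarrow> 'l set"
  where "vertices \<Lambda> = level \<Lambda> 0"

definition paths_at :: "('l, 'k) graph \<Rightarrow> 'l \<Rightarrow> 'l set"
  where "paths_at \<Lambda> v = {\<alpha> \<in> mor \<Lambda>. rng \<Lambda> \<alpha> = v}"

definition edges :: "('l, 'k) graph \<Rightarrow> 'l set"
  where "edges \<Lambda> = (\<Union>i. level \<Lambda> (\<lambda>j. if j = i then 1 else 0))"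

locale kgraph =
  fixes \<Lambda> :: "('l, 'k::finite) graph"
  assumes countable_mor: "countable (mor \<Lambda>)"
    and rng_mor: "\<alpha> \<in> mor \<Lambda> \<Longrightarrow> rng \<Lambda> \<alpha> \<in> mor \<Lambda>"
    and src_mor: "\<alpha> \<in> mor \<Lambda> \<Longrightarrow> src \<Lambda> \<alpha> \<in> mor \<Lambda>"
    and rng_rng: "\<alpha> \<in> mor \<Lambda> \<Longrightarrow> rng \<Lambda> (rng \<Lambda> \<alpha>) = rng \<Lambda> \<alpha>"
    and src_rng: "\<alpha> \<in> mor \<Lambda> \<Longrightarrow> src \<Lambda> (rng \<Lambda> \<alpha>) = rng \<Lambda> \<alpha>"
    and rng_src: "\<alpha> \<in> mor \<Lambda> \<Longrightarrow> rng \<Lambda> (src \<Lambda> \<alpha>) = src \<Lambda> \<alpha>"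
    and src_src: "\<alpha> \<in> mor \<Lambda> \<Longrightarrow> src \<Lambda> (src \<Lambda> \<alpha>) = src \<Lambda> \<alpha>"
    and cmp_mor: "\<lbrakk>\<alpha> \<in> mor \<Lambda>; \<mu> \<in> mor \<Lambda>; src \<Lambda> \<alpha> = rng \<Lambda> \<mu>\<rbrakk> \<Longrightarrow> cmp \<Lambda> \<alpha> \<mu> \<in> mor \<Lambda>"
    and rng_cmp: "\<lbrakk>\<alpha> \<in> mor \<Lambda>; \<mu> \<in> mor \<Lambda>; src \<Lambda> \<alpha> = rng \<Lambda> \<mu>\<rbrakk>
      \<Longrightarrow> rng \<Lambda> (cmp \<Lambda> \<alpha> \<mu>) = rng \<Lambda> \<alpha>"
    and src_cmp: "\<lbrakk>\<alpha> \<in> mor \<Lambda>; \<mu> \<in> mor \<Lambda>; src \<Lambda> \<alpha> = rng \<Lambda> \<mu>\<rbrakk>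
      \<Longrightarrow> src \<Lambda> (cmp \<Lambda> \<alpha> \<mu>) = src \<Lambda> \<mu>"
    and cmp_assoc: "\<lbrakk>\<alpha> \<in> mor \<Lambda>; \<mu> \<in> mor \<Lambda>; \<nu> \<in> mor \<Lambda>; src \<Lambda> \<alpha> = rng \<Lambda> \<mu>; src \<Lambda> \<mu> = rng \<Lambda> \<nu>\<rbrakk>
      \<Longrightarrow> cmp \<Lambda> (cmp \<Lambda> \<alpha> \<mu>) \<nu> = cmp \<Lambda> \<alpha> (cmp \<Lambda> \<mu> \<nu>)"
    and cmp_rng: "\<alpha> \<in> mor \<Lambda> \<Longrightarrow> cmp \<Lambda> (rng \<Lambda> \<alpha>) \<alpha> = \<alpha>"
    and cmp_src: "\<alpha> \<in> mor \<Lambda> \<Longrightarrow> cmp \<Lambda> \<alpha> (src \<Lambda> \<alpha>) = \<alpha>"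
    and deg_rng: "\<alpha> \<in> mor \<Lambda> \<Longrightarrow> deg \<Lambda> (rng \<Lambda> \<alpha>) = 0"
    and deg_src: "\<alpha> \<in> mor \<Lambda> \<Longrightarrow> deg \<Lambda> (src \<Lambda> \<alpha>) = 0"
    and deg_cmp: "\<lbrakk>\<alpha> \<in> mor \<Lambda>; \<mu> \<in> mor \<Lambda>; src \<Lambda> \<alpha> = rng \<Lambda> \<mu>\<rbrakk>
      \<Longrightarrow> deg \<Lambda> (cmp \<Lambda> \<alpha> \<mu>) = deg \<Lambda> \<alpha> + deg \<Lambda> \<mu>"
    and factorisation: "\<lbrakk>\<alpha> \<in> mor \<Lambda>; deg \<Lambda> \<alpha> = p + q\<rbrakk>
      \<Longrightarrow> \<exists>!(\<mu>, \<nu>). \<mu> \<in> level \<Lambda> p \<and> \<nu> \<in> level \<Lambda> q \<and> src \<Lambda> \<mu> = rng \<Lambda> \<nu> \<and> \<alpha> = cmp \<Lambda> \<mu> \<nu>"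
begin

lemma vertices_eq: "vertices \<Lambda> = {v \<in> mor \<Lambda>. rng \<Lambda> v = v \<and> src \<Lambda> v = v}"
proof (intro set_eqI iffI)
  fix v assume v: "v \<in> vertices \<Lambda>"
  hence m: "v \<in> mor \<Lambda>" and d: "deg \<Lambda> v = 0 + 0" by (auto simp: vertices_def level_def)
  let ?P = "\<lambda>(\<mu>, \<nu>). \<mu> \<in> level \<Lambda> 0 \<and> \<nu> \<in> level \<Lambda> 0 \<and> src \<Lambda> \<mu> = rng \<Lambda> \<nu> \<and> v = cmp \<Lambda> \<mu> \<nu>"
  have 1: "?P (v, src \<Lambda> v)" and 2: "?P (rng \<Lambda> v, v)"
    using m d by (auto simp: level_def rng_mor src_mor rng_src src_rng cmp_src cmp_rng
        deg_src deg_rng)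
  have "\<exists>!z. ?P z" by (rule factorisation[OF m d])
  then obtain z where "\<And>z'. ?P z' \<Longrightarrow> z' = z" by (rule ex1E) blast
  from this[OF 1] this[OF 2] have "(v, src \<Lambda> v) = (rng \<Lambda> v, v)" by simp
  thus "v \<in> {v \<in> mor \<Lambda>. rng \<Lambda> v = v \<and> src \<Lambda> v = v}" using m by simp
next
  fix v assume "v \<in> {v \<in> mor \<Lambda>. rng \<Lambda> v = v \<and> src \<Lambda> v = v}"
  thus "v \<in> vertices \<Lambda>" using deg_rng by (force simp: vertices_def level_def)
qed

end

definition finite_kgraph :: "('l, 'k::finite) graph \<Rightarrow> bool"
  where "finite_kgraph \<Lambda> \<longleftrightarrow> kgraph \<Lambda> \<and> (\<forall>p. finite (level \<Lambda> p))"

definition min_ext :: "('l, 'k) graph \<Rightarrow> 'l \<Rightarrow> 'l \<Rightarrow> ('l \<times> 'l) set"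
  where "min_ext \<Lambda> \<alpha> \<mu> = {(\<eta>, \<zeta>). \<eta> \<in> mor \<Lambda> \<and> \<zeta> \<in> mor \<Lambda> \<and>
    src \<Lambda> \<alpha> = rng \<Lambda> \<eta> \<and> src \<Lambda> \<mu> = rng \<Lambda> \<zeta> \<and> cmp \<Lambda> \<alpha> \<eta> = cmp \<Lambda> \<mu> \<zeta> \<and>
    deg \<Lambda> (cmp \<Lambda> \<alpha> \<eta>) = sup (deg \<Lambda> \<alpha>) (deg \<Lambda> \<mu>)}"


section \<open>Groupoids and self-similar actions\<close>

text \<open>
  The unit at an object \<open>v\<close> is \<open>ident G v\<close>; this is the identification of the unit space
  with the set \<open>objs G\<close>.  The product \<open>gmul G g h\<close> is meaningful only if
  \<open>dom G g = cod G h\<close>.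
\<close>

record ('v, 'g) gpd =
  objs :: "'v set"
  arrs :: "'g set"
  dom :: "'g \<Rightarrow> 'v"
  cod :: "'g \<Rightarrow> 'v"
  ident :: "'v \<Rightarrow> 'g"
  gmul :: "'g \<Rightarrow> 'g \<Rightarrow> 'g"
  ginv :: "'g \<Rightarrow> 'g"

locale groupoid =
  fixes G :: "('v, 'g) gpd"
  assumes dom_objs: "g \<in> arrs G \<Longrightarrow> dom G g \<in> objs G"
    and cod_objs: "g \<in> arrs G \<Longrightarrow> cod G g \<in> objs G"
    and ident_arrs: "v \<in> objs G \<Longrightarrow> ident G v \<in> arrs G"
    and dom_ident: "v \<in> objs G \<Longrightarrow> dom G (ident G v) = v"
    and cod_ident: "v \<in> objs G \<Longrightarrow> cod G (ident G v) = v"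
    and gmul_arrs: "\<lbrakk>g \<in> arrs G; h \<in> arrs G; dom G g = cod G h\<rbrakk> \<Longrightarrow> gmul G g h \<in> arrs G"
    and dom_gmul: "\<lbrakk>g \<in> arrs G; h \<in> arrs G; dom G g = cod G h\<rbrakk> \<Longrightarrow> dom G (gmul G g h) = dom G h"
    and cod_gmul: "\<lbrakk>g \<in> arrs G; h \<in> arrs G; dom G g = cod G h\<rbrakk> \<Longrightarrow> cod G (gmul G g h) = cod G g"
    and gmul_assoc: "\<lbrakk>f \<in> arrs G; g \<in> arrs G; h \<in> arrs G; dom G f = cod G g; dom G g = cod G h\<rbrakk>
      \<Longrightarrow> gmul G (gmul G f g) h = gmul G f (gmul G g h)"
    and ident_gmul: "g \<in> arrs G \<Longrightarrow> gmul G (ident G (cod G g)) g = g"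
    and gmul_ident: "g \<in> arrs G \<Longrightarrow> gmul G g (ident G (dom G g)) = g"
    and ginv_arrs: "g \<in> arrs G \<Longrightarrow> ginv G g \<in> arrs G"
    and dom_ginv: "g \<in> arrs G \<Longrightarrow> dom G (ginv G g) = cod G g"
    and cod_ginv: "g \<in> arrs G \<Longrightarrow> cod G (ginv G g) = dom G g"
    and ginv_gmul: "g \<in> arrs G \<Longrightarrow> gmul G (ginv G g) g = ident G (dom G g)"
    and gmul_ginv: "g \<in> arrs G \<Longrightarrow> gmul G g (ginv G g) = ident G (cod G g)"

text \<open>A homomorphism between groupoids with the same objects that fixes all units.\<close>

definition unit_preserving_hom :: "('v, 'g) gpd \<Rightarrow> ('v, 'h) gpd \<Rightarrow> ('g \<Rightarrow> 'h) \<Rightarrow> bool"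
  where "unit_preserving_hom G H \<Phi> \<longleftrightarrow> objs G = objs H \<and>
    (\<forall>g\<in>arrs G. \<Phi> g \<in> arrs H \<and> dom H (\<Phi> g) = dom G g \<and> cod H (\<Phi> g) = cod G g) \<and>
    (\<forall>v\<in>objs G. \<Phi> (ident G v) = ident H v) \<and>
    (\<forall>g\<in>arrs G. \<forall>h\<in>arrs G. dom G g = cod G h \<longrightarrow> \<Phi> (gmul G g h) = gmul H (\<Phi> g) (\<Phi> h))"

text \<open>
  A partial isomorphism is a triple \<open>(v, w, f)\<close> with domain \<open>v\<close> and codomain \<open>w\<close>.  The
  function \<open>f\<close> is \<^const>\<open>undefined\<close> off the paths with range \<open>v\<close>, so that equal partial
  isomorphisms are equal triples.
\<close>

type_synonym 'l pisom = "'l \<times> 'l \<times> ('l \<Rightarrow> 'l)"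

definition is_pisom :: "('l, 'k) graph \<Rightarrow> 'l pisom \<Rightarrow> bool"
  where "is_pisom \<Lambda> = (\<lambda>(v, w, f). v \<in> vertices \<Lambda> \<and> w \<in> vertices \<Lambda> \<and>
    f \<in> extensional (paths_at \<Lambda> v) \<and> bij_betw f (paths_at \<Lambda> v) (paths_at \<Lambda> w) \<and>
    (\<forall>p. f ` (paths_at \<Lambda> v \<inter> level \<Lambda> p) = paths_at \<Lambda> w \<inter> level \<Lambda> p) \<and>
    (\<forall>\<alpha>\<in>paths_at \<Lambda> v. \<forall>e\<in>edges \<Lambda> \<inter> paths_at \<Lambda> (src \<Lambda> \<alpha>).
      \<exists>\<nu>\<in>paths_at \<Lambda> (src \<Lambda> (f \<alpha>)). f (cmp \<Lambda> \<alpha> e) = cmp \<Lambda> (f \<alpha>) \<nu>))"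

definition PIso :: "('l, 'k) graph \<Rightarrow> ('l, 'l pisom) gpd"
  where "PIso \<Lambda> = \<lparr>
    objs = vertices \<Lambda>,
    arrs = Collect (is_pisom \<Lambda>),
    dom = (\<lambda>(v, w, f). v),
    cod = (\<lambda>(v, w, f). w),
    ident = (\<lambda>v. (v, v, restrict id (paths_at \<Lambda> v))),
    gmul = (\<lambda>(v, w, f) (v', w', f'). (v', w, compose (paths_at \<Lambda> v') f f')),
    ginv = (\<lambda>(v, w, f). (w, v, restrict (inv_into (paths_at \<Lambda> v) f) (paths_at \<Lambda> w))) \<rparr>"

definition act :: "('g \<Rightarrow> 'l pisom) \<Rightarrow> 'g \<Rightarrow> 'l \<Rightarrow> 'l"
  where "act \<Phi> g = snd (snd (\<Phi> g))"

definition faithful_action :: "('l, 'k) graph \<Rightarrow> ('l, 'g) gpd \<Rightarrow> ('g \<Rightarrow> 'l pisom) \<Rightarrow> bool"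
  where "faithful_action \<Lambda> G \<Phi> \<longleftrightarrow>
    groupoid G \<and> objs G = vertices \<Lambda> \<and> unit_preserving_hom G (PIso \<Lambda>) \<Phi> \<and> inj_on \<Phi> (arrs G)"

text \<open>
  The conditions on \<open>dom\<close> and \<open>cod\<close> say that \<open>h \<cdot> \<alpha>\<close> and the product
  \<open>(g \<cdot> e)(h \<cdot> \<alpha>)\<close> are defined.
\<close>

definition is_edge_restriction ::
    "('l, 'k) graph \<Rightarrow> ('l, 'g) gpd \<Rightarrow> ('g \<Rightarrow> 'l pisom) \<Rightarrow> 'g \<Rightarrow> 'l \<Rightarrow> 'g \<Rightarrow> bool"
  where "is_edge_restriction \<Lambda> G \<Phi> g e h \<longleftrightarrow> h \<in> arrs G \<and>
    dom G h = src \<Lambda> e \<and> cod G h = src \<Lambda> (act \<Phi> g e) \<and>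
    (\<forall>\<alpha>\<in>paths_at \<Lambda> (src \<Lambda> e). act \<Phi> g (cmp \<Lambda> e \<alpha>) = cmp \<Lambda> (act \<Phi> g e) (act \<Phi> h \<alpha>))"

definition self_similar_action :: "('l, 'k) graph \<Rightarrow> ('l, 'g) gpd \<Rightarrow> ('g \<Rightarrow> 'l pisom) \<Rightarrow> bool"
  where "self_similar_action \<Lambda> G \<Phi> \<longleftrightarrow> faithful_action \<Lambda> G \<Phi> \<and>
    (\<forall>g\<in>arrs G. \<forall>e\<in>edges \<Lambda> \<inter> paths_at \<Lambda> (dom G g). \<exists>h. is_edge_restriction \<Lambda> G \<Phi> g e h)"

definition edge_restriction ::
    "('l, 'k) graph \<Rightarrow> ('l, 'g) gpd \<Rightarrow> ('g \<Rightarrow> 'l pisom) \<Rightarrow> 'g \<Rightarrow> 'l \<Rightarrow> 'g"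
  where "edge_restriction \<Lambda> G \<Phi> g e = (THE h. is_edge_restriction \<Lambda> G \<Phi> g e h)"

inductive edge_factorisation :: "('l, 'k) graph \<Rightarrow> 'l list \<Rightarrow> 'l \<Rightarrow> bool" for \<Lambda>
  where
    vertex: "v \<in> vertices \<Lambda> \<Longrightarrow> edge_factorisation \<Lambda> [] v"
  | edge: "\<lbrakk>e \<in> edges \<Lambda>; edge_factorisation \<Lambda> es \<mu>; src \<Lambda> e = rng \<Lambda> \<mu>\<rbrakk>
      \<Longrightarrow> edge_factorisation \<Lambda> (e # es) (cmp \<Lambda> e \<mu>)"

text \<open>The choice of the factorisation does not matter.\<close>

definition restriction ::
    "('l, 'k) graph \<Rightarrow> ('l, 'g) gpd \<Rightarrow> ('g \<Rightarrow> 'l pisom) \<Rightarrow> 'g \<Rightarrow> 'l \<Rightarrow> 'g"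
  where "restriction \<Lambda> G \<Phi> g \<alpha> =
    foldl (edge_restriction \<Lambda> G \<Phi>) g (SOME es. edge_factorisation \<Lambda> es \<alpha>)"


section \<open>Representations of groupoids and graphs\<close>

definition unitary_rep :: "('v, 'g) gpd \<Rightarrow> ('g \<Rightarrow> 'b::cstar_algebra) \<Rightarrow> bool"
  where "unitary_rep G U \<longleftrightarrow>
    (\<forall>g\<in>arrs G. partial_isometry (U g)) \<and>
    orthogonal_projections (objs G) (\<lambda>v. U (ident G v)) \<and>
    (\<forall>g\<in>arrs G. star (U g) = U (ginv G g)) \<and>
    (\<forall>g\<in>arrs G. \<forall>h\<in>arrs G. U g * U h = (if dom G g = cod G h then U (gmul G g h) else 0))"

text \<open>
  Universal properties refer to all $C^*$-algebras \<open>B\<close>, that is, to all types of class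
  \<open>cstar_algebra\<close>, over which a formula cannot quantify.  The predicates below
  therefore express universality with respect to a single target \<open>B\<close>, given by the
  argument \<open>TYPE('b)\<close>.  A universal object satisfies them for every type \<open>'b\<close>.
\<close>

definition groupoid_cstar ::
    "'b::cstar_algebra itself \<Rightarrow> ('v, 'g) gpd \<Rightarrow> ('g \<Rightarrow> 'a::cstar_algebra) \<Rightarrow> bool"
  where "groupoid_cstar B G i \<longleftrightarrow> unitary_rep G i \<and> cstar_generated (i ` arrs G) = UNIV \<and>
    (\<forall>U :: 'g \<Rightarrow> 'b. unitary_rep G U \<longrightarrow> (\<exists>\<pi>. star_hom \<pi> \<and> (\<forall>g\<in>arrs G. \<pi> (i g) = U g)))"

definition tck_family :: "('l, 'k) graph \<Rightarrow> ('l \<Rightarrow> 'b::cstar_algebra) \<Rightarrow> bool"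
  where "tck_family \<Lambda> T \<longleftrightarrow>
    (\<forall>\<alpha>\<in>mor \<Lambda>. partial_isometry (T \<alpha>)) \<and>
    orthogonal_projections (vertices \<Lambda>) T \<and>
    (\<forall>\<alpha>\<in>mor \<Lambda>. \<forall>\<mu>\<in>mor \<Lambda>. src \<Lambda> \<alpha> = rng \<Lambda> \<mu> \<longrightarrow> T \<alpha> * T \<mu> = T (cmp \<Lambda> \<alpha> \<mu>)) \<and>
    (\<forall>\<alpha>\<in>mor \<Lambda>. \<forall>\<mu>\<in>mor \<Lambda>. star (T \<alpha>) * T \<mu> = (\<Sum>(\<eta>, \<zeta>)\<in>min_ext \<Lambda> \<alpha> \<mu>. T \<eta> * star (T \<zeta>)))"

definition toeplitz_family ::
    "('l, 'k) graph \<Rightarrow> ('l, 'g) gpd \<Rightarrow> ('g \<Rightarrow> 'l pisom) \<Rightarrow>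
      ('g \<Rightarrow> 'b::cstar_algebra) \<Rightarrow> ('l \<Rightarrow> 'b) \<Rightarrow> bool"
  where "toeplitz_family \<Lambda> G \<Phi> U T \<longleftrightarrow>
    (unitary_rep G U \<and> (\<forall>v\<in>vertices \<Lambda>. U (ident G v) = T v)) \<and>
    (tck_family \<Lambda> T \<and> (\<forall>b. (\<Sum>v\<in>vertices \<Lambda>. T v) * b = b \<and> b * (\<Sum>v\<in>vertices \<Lambda>. T v) = b)) \<and>
    (\<forall>g\<in>arrs G. \<forall>\<alpha>\<in>mor \<Lambda>. U g * T \<alpha> =
      (if dom G g = rng \<Lambda> \<alpha> then T (act \<Phi> g \<alpha>) * U (restriction \<Lambda> G \<Phi> g \<alpha>) else 0))"


section \<open>Hilbert modules\<close>

text \<open>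
  A right module over a $C^*$-algebra \<open>'a\<close> whose elements form a subset of a complex vector
  space \<open>'m\<close>, with addition and scalar multiplication inherited from \<open>'m\<close>.
\<close>

record ('a, 'm) hmod =
  hcar :: "'m set"
  ract :: "'m \<Rightarrow> 'a \<Rightarrow> 'm"
  inn :: "'m \<Rightarrow> 'm \<Rightarrow> 'a"

definition mnorm :: "('a::cstar_algebra, 'm) hmod \<Rightarrow> 'm \<Rightarrow> real"
  where "mnorm X x = sqrt (norm (inn X x x))"

locale hilbert_module =
  fixes X :: "('a::cstar_algebra, 'm::complex_vector) hmod"
  assumes subspace: "complex_vector.subspace (hcar X)"
    and ract_closed: "x \<in> hcar X \<Longrightarrow> ract X x a \<in> hcar X"
    and ract_linear_left: "clinear_on (hcar X) (\<lambda>x. ract X x a)"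
    and ract_linear_right: "x \<in> hcar X \<Longrightarrow> clinear_on UNIV (ract X x)"
    and ract_ract: "x \<in> hcar X \<Longrightarrow> ract X (ract X x a) b = ract X x (a * b)"
    and inn_linear: "x \<in> hcar X \<Longrightarrow> clinear_on (hcar X) (inn X x)"
    and inn_ract: "\<lbrakk>x \<in> hcar X; y \<in> hcar X\<rbrakk> \<Longrightarrow> inn X x (ract X y a) = inn X x y * a"
    and star_inn: "\<lbrakk>x \<in> hcar X; y \<in> hcar X\<rbrakk> \<Longrightarrow> star (inn X x y) = inn X y x"
    and inn_pos: "x \<in> hcar X \<Longrightarrow> \<exists>a. inn X x x = star a * a"
    and inn_definite: "\<lbrakk>x \<in> hcar X; inn X x x = 0\<rbrakk> \<Longrightarrow> x = 0"
    and complete: "\<lbrakk>\<forall>n. s n \<in> hcar X; \<forall>\<epsilon>>0. \<exists>N. \<forall>m\<ge>N. \<forall>n\<ge>N. mnorm X (s m - s n) < \<epsilon>\<rbrakk>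
      \<Longrightarrow> \<exists>y\<in>hcar X. (\<lambda>n. mnorm X (s n - y)) \<longlonglongrightarrow> 0"

definition is_adjoint :: "('a, 'm) hmod \<Rightarrow> ('m \<Rightarrow> 'm) \<Rightarrow> ('m \<Rightarrow> 'm) \<Rightarrow> bool"
  where "is_adjoint X S S' \<longleftrightarrow> (\<forall>x\<in>hcar X. \<forall>y\<in>hcar X. inn X (S x) y = inn X x (S' y))"

text \<open>Operators on \<open>X\<close> are functions on \<open>'m\<close> that vanish off the module.\<close>

definition operators :: "('a, 'm::zero) hmod \<Rightarrow> ('m \<Rightarrow> 'm) set"
  where "operators X = {S. S ` hcar X \<subseteq> hcar X \<and> (\<forall>x. x \<notin> hcar X \<longrightarrow> S x = 0)}"

definition adjointable :: "('a, 'm::zero) hmod \<Rightarrow> ('m \<Rightarrow> 'm) set"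
  where "adjointable X = {S \<in> operators X. \<exists>S'\<in>operators X. is_adjoint X S S'}"

definition Theta :: "('a, 'm::zero) hmod \<Rightarrow> 'm \<Rightarrow> 'm \<Rightarrow> 'm \<Rightarrow> 'm"
  where "Theta X x y z = (if z \<in> hcar X then ract X x (inn X y z) else 0)"

definition finite_rank :: "('a, 'm::complex_vector) hmod \<Rightarrow> ('m \<Rightarrow> 'm) set"
  where "finite_rank X = complex_vector.span {Theta X x y |x y. x \<in> hcar X \<and> y \<in> hcar X}"

text \<open>The closure of the finite-rank operators with respect to the operator norm.\<close>

definition compact_ops :: "('a::cstar_algebra, 'm::complex_vector) hmod \<Rightarrow> ('m \<Rightarrow> 'm) set"
  where "compact_ops X = {S \<in> adjointable X. \<forall>\<epsilon>>0. \<exists>F\<in>finite_rank X.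
    \<forall>z\<in>hcar X. mnorm X (S z - F z) \<le> \<epsilon> * mnorm X z}"


section \<open>Product systems over $k$-tuples of natural numbers\<close>

text \<open>
  The fibres are sets of elements of one type \<open>'m\<close>; an element of the product system is a
  pair of an index \<open>p\<close> and an element of the fibre at \<open>p\<close>, so the fibres are disjoint by
  convention.  The map \<open>emb\<close> identifies the coefficient algebra with the fibre at \<open>0\<close>.
\<close>

record ('k, 'a, 'm) prodsys =
  fib :: "('k \<Rightarrow> nat) \<Rightarrow> ('a, 'm) hmod"
  lact :: "('k \<Rightarrow> nat) \<Rightarrow> 'a \<Rightarrow> 'm \<Rightarrow> 'm"
  mul :: "('k \<Rightarrow> nat) \<Rightarrow> ('k \<Rightarrow> nat) \<Rightarrow> 'm \<Rightarrow> 'm \<Rightarrow> 'm"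
  emb :: "'a \<Rightarrow> 'm"

abbreviation fibre :: "('k, 'a, 'm) prodsys \<Rightarrow> ('k \<Rightarrow> nat) \<Rightarrow> 'm set"
  where "fibre M p \<equiv> hcar (fib M p)"

text \<open>
  The axioms \<open>inn_mul\<close> and \<open>mul_dense\<close> say that the multiplication induces an isomorphism
  from the balanced tensor product of the fibres at \<open>p\<close> and \<open>q\<close> onto the fibre at \<open>p + q\<close>.
\<close>

locale product_system =
  fixes M :: "('k::finite, 'a::cstar_algebra, 'm::complex_vector) prodsys"
  assumes hilbert_module_fib: "hilbert_module (fib M p)"
    and lact_adjointable: "lact M p a \<in> adjointable (fib M p)"
    and lact_linear: "clinear_on UNIV (lact M p)"
    and lact_mult: "x \<in> fibre M p \<Longrightarrow> lact M p (a * b) x = lact M p a (lact M p b x)"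
    and lact_star: "is_adjoint (fib M p) (lact M p a) (lact M p (star a))"
    and emb_linear: "clinear_on UNIV (emb M)"
    and emb_bij: "bij_betw (emb M) UNIV (fibre M 0)"
    and emb_ract: "ract (fib M 0) (emb M a) b = emb M (a * b)"
    and emb_lact: "lact M 0 a (emb M b) = emb M (a * b)"
    and emb_inn: "inn (fib M 0) (emb M a) (emb M b) = star a * b"
    and mul_fibre: "\<lbrakk>x \<in> fibre M p; y \<in> fibre M q\<rbrakk> \<Longrightarrow> mul M p q x y \<in> fibre M (p + q)"
    and mul_linear_left: "y \<in> fibre M q \<Longrightarrow> clinear_on (fibre M p) (\<lambda>x. mul M p q x y)"
    and mul_linear_right: "x \<in> fibre M p \<Longrightarrow> clinear_on (fibre M q) (mul M p q x)"
    and mul_assoc: "\<lbrakk>x \<in> fibre M p; y \<in> fibre M q; z \<in> fibre M r\<rbrakk>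
      \<Longrightarrow> mul M (p + q) r (mul M p q x y) z = mul M p (q + r) x (mul M q r y z)"
    and mul_emb_left: "x \<in> fibre M p \<Longrightarrow> mul M 0 p (emb M a) x = lact M p a x"
    and mul_emb_right: "x \<in> fibre M p \<Longrightarrow> mul M p 0 x (emb M a) = ract (fib M p) x a"
    and inn_mul: "\<lbrakk>x \<in> fibre M p; x' \<in> fibre M p; y \<in> fibre M q; y' \<in> fibre M q\<rbrakk>
      \<Longrightarrow> inn (fib M (p + q)) (mul M p q x y) (mul M p q x' y') =
          inn (fib M q) y (lact M q (inn (fib M p) x x') y')"
    and mul_dense: "\<lbrakk>z \<in> fibre M (p + q); \<epsilon> > 0\<rbrakk>
      \<Longrightarrow> \<exists>w \<in> complex_vector.span {mul M p q x y |x y. x \<in> fibre M p \<and> y \<in> fibre M q}.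
            mnorm (fib M (p + q)) (z - w) < \<epsilon>"

text \<open>For \<open>p \<le> r\<close> and an adjointable \<open>S\<close> on the fibre at \<open>p\<close>, the operator \<open>S \<otimes> 1\<close>
  on the fibre at \<open>r\<close>.\<close>

definition ext_op :: "('k, 'a, 'm::complex_vector) prodsys \<Rightarrow> ('k \<Rightarrow> nat) \<Rightarrow> ('k \<Rightarrow> nat) \<Rightarrow>
    ('m \<Rightarrow> 'm) \<Rightarrow> 'm \<Rightarrow> 'm"
  where "ext_op M p r S = (THE S'. S' \<in> adjointable (fib M r) \<and>
    (\<forall>x\<in>fibre M p. \<forall>y\<in>fibre M (r - p). S' (mul M p (r - p) x y) = mul M p (r - p) (S x) y))"

definition toeplitz_rep :: "('k, 'a::cstar_algebra, 'm::complex_vector) prodsys \<Rightarrow>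
    (('k \<Rightarrow> nat) \<Rightarrow> 'm \<Rightarrow> 'b::cstar_algebra) \<Rightarrow> bool"
  where "toeplitz_rep M \<psi> \<longleftrightarrow>
    star_hom (\<lambda>a. \<psi> 0 (emb M a)) \<and>
    (\<forall>p. clinear_on (fibre M p) (\<psi> p)) \<and>
    (\<forall>p. \<forall>x\<in>fibre M p. \<forall>y\<in>fibre M p.
      star (\<psi> p x) * \<psi> p y = \<psi> 0 (emb M (inn (fib M p) x y))) \<and>
    (\<forall>p q. \<forall>x\<in>fibre M p. \<forall>y\<in>fibre M q. \<psi> (p + q) (mul M p q x y) = \<psi> p x * \<psi> q y)"

definition compacts_hom ::
    "('a::cstar_algebra, 'm::complex_vector) hmod \<Rightarrow> (('m \<Rightarrow> 'm) \<Rightarrow> 'b::cstar_algebra) \<Rightarrow> bool"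
  where "compacts_hom X \<pi> \<longleftrightarrow> clinear_on (compact_ops X) \<pi> \<and>
    (\<forall>S\<in>compact_ops X. \<forall>T\<in>compact_ops X. \<pi> (S \<circ> T) = \<pi> S * \<pi> T) \<and>
    (\<forall>S\<in>compact_ops X. \<forall>S'\<in>compact_ops X. is_adjoint X S S' \<longrightarrow> \<pi> S' = star (\<pi> S))"

definition rep_compacts :: "('k, 'a::cstar_algebra, 'm::complex_vector) prodsys \<Rightarrow>
    (('k \<Rightarrow> nat) \<Rightarrow> 'm \<Rightarrow> 'b::cstar_algebra) \<Rightarrow> ('k \<Rightarrow> nat) \<Rightarrow> ('m \<Rightarrow> 'm) \<Rightarrow> 'b"
  where "rep_compacts M \<psi> p = (THE \<pi>. \<pi> \<in> extensional (compact_ops (fib M p)) \<and>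
    compacts_hom (fib M p) \<pi> \<and>
    (\<forall>x\<in>fibre M p. \<forall>y\<in>fibre M p. \<pi> (Theta (fib M p) x y) = \<psi> p x * star (\<psi> p y)))"

definition nica_covariant :: "('k, 'a::cstar_algebra, 'm::complex_vector) prodsys \<Rightarrow>
    (('k \<Rightarrow> nat) \<Rightarrow> 'm \<Rightarrow> 'b::cstar_algebra) \<Rightarrow> bool"
  where "nica_covariant M \<psi> \<longleftrightarrow> toeplitz_rep M \<psi> \<and>
    (\<forall>p q. \<forall>S\<in>compact_ops (fib M p). \<forall>T\<in>compact_ops (fib M q).
      rep_compacts M \<psi> p S * rep_compacts M \<psi> q T =
      rep_compacts M \<psi> (sup p q) (ext_op M p (sup p q) S \<circ> ext_op M q (sup p q) T))"

definition nica_toeplitz_algebra :: "'b::cstar_algebra itself \<Rightarrow>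
    ('k, 'a::cstar_algebra, 'm::complex_vector) prodsys \<Rightarrow>
    (('k \<Rightarrow> nat) \<Rightarrow> 'm \<Rightarrow> 'n::cstar_algebra) \<Rightarrow> bool"
  where "nica_toeplitz_algebra B M \<psi> \<longleftrightarrow> nica_covariant M \<psi> \<and>
    cstar_generated (\<Union>p. \<psi> p ` fibre M p) = UNIV \<and>
    (\<forall>\<rho> :: ('k \<Rightarrow> nat) \<Rightarrow> 'm \<Rightarrow> 'b. nica_covariant M \<rho> \<longrightarrow>
      (\<exists>\<rho>'. star_hom \<rho>' \<and> (\<forall>p. \<forall>x\<in>fibre M p. \<rho>' (\<psi> p x) = \<rho> p x)))"


section \<open>The product system of a self-similar action\<close>

text \<open>
  $X(\Lambda^p)$ consists of the complex functions that vanish off \<open>level \<Lambda> p\<close>.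
\<close>

definition X_car :: "('l, 'k) graph \<Rightarrow> ('k \<Rightarrow> nat) \<Rightarrow> ('l \<Rightarrow> complex) set"
  where "X_car \<Lambda> p = {x. \<forall>\<alpha>. \<alpha> \<notin> level \<Lambda> p \<longrightarrow> x \<alpha> = 0}"

definition X_ract :: "('l, 'k) graph \<Rightarrow> ('l \<Rightarrow> complex) \<Rightarrow> ('l \<Rightarrow> complex) \<Rightarrow> 'l \<Rightarrow> complex"
  where "X_ract \<Lambda> x f \<alpha> = x \<alpha> * f (src \<Lambda> \<alpha>)"

definition X_inn :: "('l, 'k) graph \<Rightarrow> ('k \<Rightarrow> nat) \<Rightarrow> ('l \<Rightarrow> complex) \<Rightarrow> ('l \<Rightarrow> complex) \<Rightarrow> 'l \<Rightarrow> complex"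
  where "X_inn \<Lambda> p x y v = (\<Sum>\<alpha>\<in>{\<alpha> \<in> level \<Lambda> p. src \<Lambda> \<alpha> = v}. cnj (x \<alpha>) * y \<alpha>)"

definition delta :: "'l \<Rightarrow> 'l \<Rightarrow> complex"
  where "delta \<alpha> \<mu> = (if \<mu> = \<alpha> then 1 else 0)"

text \<open>The homomorphism from the functions on the vertices to the algebra \<open>'a\<close> that maps
  the point mass at \<open>v\<close> to the image of the unit at \<open>v\<close>.\<close>

definition vertex_hom :: "('l, 'g) gpd \<Rightarrow> ('g \<Rightarrow> 'a::cstar_algebra) \<Rightarrow> ('l \<Rightarrow> complex) \<Rightarrow> 'a"
  where "vertex_hom G i f = (\<Sum>v\<in>objs G. f v *\<^sub>C i (ident G v))"

text \<open>
  $X(\Lambda^p)$ is spanned by finitely many point masses with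
  \<open>delta \<alpha> \<otimes> a = delta \<alpha> \<otimes> i (src \<alpha>) a\<close>.  So the balanced tensor product with \<open>'a\<close> is
  realised as a space of functions from the paths to \<open>'a\<close>, in which \<open>x \<otimes> a\<close> is the function
  \<open>\<alpha> \<mapsto> x(\<alpha>) i(src \<alpha>) a\<close>.  The lemmas \<open>tens_balanced\<close>, \<open>tens_ract\<close> and \<open>tens_inn\<close> show
  that the elementary tensors, by which the space is spanned, satisfy the relations that
  determine this tensor product, and \<open>tens_space_eq\<close> describes the space coordinatewise.
\<close>

definition tens :: "('l, 'k) graph \<Rightarrow> ('l, 'g) gpd \<Rightarrow> ('g \<Rightarrow> 'a::cstar_algebra) \<Rightarrow>
    ('l \<Rightarrow> complex) \<Rightarrow> 'a \<Rightarrow> 'l \<Rightarrow> 'a"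
  where "tens \<Lambda> G i x a \<alpha> = x \<alpha> *\<^sub>C (i (ident G (src \<Lambda> \<alpha>)) * a)"

definition tens_space :: "('l, 'k) graph \<Rightarrow> ('l, 'g) gpd \<Rightarrow> ('g \<Rightarrow> 'a::cstar_algebra) \<Rightarrow>
    ('k \<Rightarrow> nat) \<Rightarrow> ('l \<Rightarrow> 'a) set"
  where "tens_space \<Lambda> G i p = complex_vector.span {tens \<Lambda> G i x a |x a. x \<in> X_car \<Lambda> p}"

definition tens_mod :: "('l, 'k) graph \<Rightarrow> ('l, 'g) gpd \<Rightarrow> ('g \<Rightarrow> 'a::cstar_algebra) \<Rightarrow>
    ('k \<Rightarrow> nat) \<Rightarrow> ('a, 'l \<Rightarrow> 'a) hmod"
  where "tens_mod \<Lambda> G i p = \<lparr>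
    hcar = tens_space \<Lambda> G i p,
    ract = (\<lambda>\<xi> b \<alpha>. \<xi> \<alpha> * b),
    inn = (\<lambda>\<xi> \<eta>. \<Sum>\<alpha>\<in>level \<Lambda> p. star (\<xi> \<alpha>) * \<eta> \<alpha>) \<rparr>"

lemma sum_apply: "sum f I x = (\<Sum>j\<in>I. f j x)" for f :: "'i \<Rightarrow> 'x \<Rightarrow> 'v::complex_vector"
  by (induction I rule: infinite_finite_induct) simp_all

lemma star_zero: "star (0::'a::cstar_algebra) = 0"
  using star_scaleC[of 0 "0::'a"] by simp

lemma star_sum: "star (sum f I) = (\<Sum>j\<in>I. star (f j :: 'a::cstar_algebra))"
  by (induction I rule: infinite_finite_induct) (simp_all add: star_zero star_add)

context
  fixes \<Lambda> :: "('l, 'k::finite) graph" and G :: "('l, 'g) gpd" and i :: "'g \<Rightarrow> 'a::cstar_algebra"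
  assumes fin: "finite_kgraph \<Lambda>" and objs: "objs G = vertices \<Lambda>" and rep: "unitary_rep G i"
begin

lemma fin_level: "finite (level \<Lambda> p)"
  using fin by (simp add: finite_kgraph_def)

lemma src_objs: "\<alpha> \<in> level \<Lambda> p \<Longrightarrow> src \<Lambda> \<alpha> \<in> objs G"
  using fin objs kgraph.src_mor kgraph.deg_src
  by (fastforce simp: finite_kgraph_def vertices_def level_def)

lemma fin_objs: "finite (objs G)"
  using fin_level objs by (simp add: vertices_def)

lemma i_mult:
  "\<lbrakk>v \<in> objs G; w \<in> objs G\<rbrakk> \<Longrightarrow>
    i (ident G v) * i (ident G w) = (if v = w then i (ident G v) else 0)"
  using rep by (auto simp: unitary_rep_def orthogonal_projections_def is_projection_def)

lemma i_star: "v \<in> objs G \<Longrightarrow> star (i (ident G v)) = i (ident G v)"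
  using rep by (auto simp: unitary_rep_def orthogonal_projections_def is_projection_def)

lemma i_vertex_hom:
  assumes "v \<in> objs G"
  shows "i (ident G v) * vertex_hom G i f = f v *\<^sub>C i (ident G v)"
proof -
  have "i (ident G v) * vertex_hom G i f
      = (\<Sum>w\<in>objs G. if w = v then f v *\<^sub>C i (ident G v) else 0)"
    unfolding vertex_hom_def sum_distrib_left
    by (intro sum.cong refl) (use assms in \<open>auto simp: mult_scaleC_right i_mult\<close>)
  thus ?thesis using assms fin_objs by simp
qed

lemma tens_balanced:
  assumes "x \<in> X_car \<Lambda> p"
  shows "tens \<Lambda> G i (X_ract \<Lambda> x f) a = tens \<Lambda> G i x (vertex_hom G i f * a)"
proof
  fix \<alpha>
  show "tens \<Lambda> G i (X_ract \<Lambda> x f) a \<alpha> = tens \<Lambda> G i x (vertex_hom G i f * a) \<alpha>"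
  proof (cases "\<alpha> \<in> level \<Lambda> p")
    case True
    thus ?thesis
      using src_objs[OF True]
      by (simp add: tens_def X_ract_def i_vertex_hom mult.assoc[symmetric] mult_scaleC_left
          scaleC_scaleC)
  next
    case False
    thus ?thesis using assms by (simp add: tens_def X_ract_def X_car_def)
  qed
qed

lemma tens_ract: "ract (tens_mod \<Lambda> G i p) (tens \<Lambda> G i x a) b = tens \<Lambda> G i x (a * b)"
  by (simp add: tens_mod_def tens_def fun_eq_iff mult.assoc mult_scaleC_left)

lemma tens_inn:
  "inn (tens_mod \<Lambda> G i p) (tens \<Lambda> G i x a) (tens \<Lambda> G i y b)
    = star a * vertex_hom G i (X_inn \<Lambda> p x y) * b"
proof -
  let ?e = "\<lambda>v. i (ident G v)"
  let ?c = "\<lambda>\<alpha>. cnj (x \<alpha>) * y \<alpha>"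
  have 1: "star (tens \<Lambda> G i x a \<alpha>) * tens \<Lambda> G i y b \<alpha>
      = star a * (?c \<alpha> *\<^sub>C ?e (src \<Lambda> \<alpha>)) * b"
    if "\<alpha> \<in> level \<Lambda> p" for \<alpha>
  proof -
    have s: "src \<Lambda> \<alpha> \<in> objs G" using src_objs that .
    have "star a * ?e (src \<Lambda> \<alpha>) * (?e (src \<Lambda> \<alpha>) * b)
        = star a * (?e (src \<Lambda> \<alpha>) * ?e (src \<Lambda> \<alpha>)) * b" by (simp only: mult.assoc)
    also have "\<dots> = star a * ?e (src \<Lambda> \<alpha>) * b" by (simp add: i_mult s)
    finally show ?thesis
      by (simp add: tens_def star_scaleC star_mult i_star s mult_scaleC_left mult_scaleC_right
          scaleC_scaleC mult.commute[of "y \<alpha>"])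
  qed
  have "vertex_hom G i (X_inn \<Lambda> p x y)
      = (\<Sum>v\<in>objs G. \<Sum>\<alpha>\<in>{\<alpha> \<in> level \<Lambda> p. src \<Lambda> \<alpha> = v}. ?c \<alpha> *\<^sub>C ?e (src \<Lambda> \<alpha>))"
    unfolding vertex_hom_def X_inn_def by (simp add: complex_vector.scale_sum_left)
  also have "\<dots> = (\<Sum>\<alpha>\<in>level \<Lambda> p. ?c \<alpha> *\<^sub>C ?e (src \<Lambda> \<alpha>))"
    by (rule sum.group) (use fin_level fin_objs src_objs in auto)
  finally show ?thesis
    by (simp add: tens_mod_def sum_distrib_left sum_distrib_right 1)
qed

lemma tens_space_eq: "tens_space \<Lambda> G i p =
  {\<xi>. \<forall>\<alpha>. if \<alpha> \<in> level \<Lambda> p then i (ident G (src \<Lambda> \<alpha>)) * \<xi> \<alpha> = \<xi> \<alpha> else \<xi> \<alpha> = 0}"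
  (is "_ = ?S")
proof
  have sub: "complex_vector.subspace ?S"
    unfolding complex_vector.subspace_def
    by (auto simp: scaleC_fun_def mult_scaleC_right distrib_left)
  have "{tens \<Lambda> G i x a |x a. x \<in> X_car \<Lambda> p} \<subseteq> ?S"
    by (auto simp: X_car_def tens_def mult_scaleC_right mult.assoc[symmetric] i_mult src_objs)
  thus "tens_space \<Lambda> G i p \<subseteq> ?S"
    unfolding tens_space_def using sub by (rule complex_vector.span_minimal)
next
  show "?S \<subseteq> tens_space \<Lambda> G i p"
  proof
    fix \<xi> assume \<xi>: "\<xi> \<in> ?S"
    have "\<xi> = (\<Sum>\<beta>\<in>level \<Lambda> p. tens \<Lambda> G i (delta \<beta>) (\<xi> \<beta>))"
    proof
      fix \<alpha>
      have "(\<Sum>\<beta>\<in>level \<Lambda> p. tens \<Lambda> G i (delta \<beta>) (\<xi> \<beta>)) \<alpha>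
          = (\<Sum>\<beta>\<in>level \<Lambda> p. tens \<Lambda> G i (delta \<beta>) (\<xi> \<beta>) \<alpha>)"
        by (rule sum_apply)
      also have "\<dots> = (\<Sum>\<beta>\<in>level \<Lambda> p. if \<beta> = \<alpha> then i (ident G (src \<Lambda> \<alpha>)) * \<xi> \<alpha> else 0)"
        by (intro sum.cong refl) (auto simp: tens_def delta_def scaleC_one)
      also have "\<dots> = \<xi> \<alpha>" using \<xi> fin_level by (auto split: if_splits)
      finally show "\<xi> \<alpha> = (\<Sum>\<beta>\<in>level \<Lambda> p. tens \<Lambda> G i (delta \<beta>) (\<xi> \<beta>)) \<alpha>" by simp
    qed
    moreover have "tens \<Lambda> G i (delta \<beta>) (\<xi> \<beta>) \<in> tens_space \<Lambda> G i p" if "\<beta> \<in> level \<Lambda> p" for \<beta>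
      unfolding tens_space_def
      by (rule complex_vector.span_base) (use that in \<open>auto simp: X_car_def delta_def\<close>)
    ultimately show "\<xi> \<in> tens_space \<Lambda> G i p"
      unfolding tens_space_def by (metis (no_types, lifting) complex_vector.span_sum)
  qed
qed

end

text \<open>
  To have all fibres in one type, the fibre \<open>A\<close> at \<open>0\<close> is placed in the first factor of
  \<open>'a \<times> ('l \<Rightarrow> 'a)\<close> and the fibres at \<open>p \<noteq> 0\<close> in the second one.
\<close>

definition ss_fib :: "('l, 'k) graph \<Rightarrow> ('l, 'g) gpd \<Rightarrow> ('g \<Rightarrow> 'a::cstar_algebra) \<Rightarrow>
    ('k \<Rightarrow> nat) \<Rightarrow> ('a, 'a \<times> ('l \<Rightarrow> 'a)) hmod"
  where "ss_fib \<Lambda> G i p =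
    (if p = 0 then \<lparr>
      hcar = UNIV \<times> {0},
      ract = (\<lambda>(a, _) b. (a * b, 0)),
      inn = (\<lambda>(a, _) (b, _). star a * b) \<rparr>
    else \<lparr>
      hcar = {0} \<times> hcar (tens_mod \<Lambda> G i p),
      ract = (\<lambda>(_, \<xi>) b. (0, ract (tens_mod \<Lambda> G i p) \<xi> b)),
      inn = (\<lambda>(_, \<xi>) (_, \<eta>). inn (tens_mod \<Lambda> G i p) \<xi> \<eta>) \<rparr>)"

definition dtens :: "('l, 'k) graph \<Rightarrow> ('l, 'g) gpd \<Rightarrow> ('g \<Rightarrow> 'a::cstar_algebra) \<Rightarrow>
    'l \<Rightarrow> 'a \<Rightarrow> 'a \<times> ('l \<Rightarrow> 'a)"
  where "dtens \<Lambda> G i \<alpha> a = (0, tens \<Lambda> G i (delta \<alpha>) a)"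

text \<open>\<open>M\<close> is the product system of the self-similar action \<open>\<Phi>\<close>, where \<open>i\<close> is the universal
  unitary representation of \<open>G\<close>.\<close>

definition ss_product_system ::
    "('l, 'k::finite) graph \<Rightarrow> ('l, 'g) gpd \<Rightarrow> ('g \<Rightarrow> 'l pisom) \<Rightarrow> ('g \<Rightarrow> 'a::cstar_algebra) \<Rightarrow>
      ('k, 'a, 'a \<times> ('l \<Rightarrow> 'a)) prodsys \<Rightarrow> bool"
  where "ss_product_system \<Lambda> G \<Phi> i M \<longleftrightarrow> product_system M \<and>
    fib M = ss_fib \<Lambda> G i \<and> emb M = (\<lambda>a. (a, 0)) \<and>
    (\<forall>p. p \<noteq> 0 \<longrightarrow> (\<forall>g\<in>arrs G. \<forall>\<alpha>\<in>level \<Lambda> p. \<forall>a.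
      lact M p (i g) (dtens \<Lambda> G i \<alpha> a) =
        (if rng \<Lambda> \<alpha> = dom G g
         then dtens \<Lambda> G i (act \<Phi> g \<alpha>) (i (restriction \<Lambda> G \<Phi> g \<alpha>) * a) else 0))) \<and>
    (\<forall>p q. p \<noteq> 0 \<longrightarrow> q \<noteq> 0 \<longrightarrow>
      (\<forall>\<alpha>\<in>level \<Lambda> p. \<forall>\<mu>\<in>level \<Lambda> q. \<forall>g\<in>arrs G. \<forall>h\<in>arrs G.
        src \<Lambda> \<alpha> = cod G g \<longrightarrow> src \<Lambda> \<mu> = cod G h \<longrightarrow>
        mul M p q (dtens \<Lambda> G i \<alpha> (i g)) (dtens \<Lambda> G i \<mu> (i h)) =
          (if rng \<Lambda> \<mu> = dom G g
           then dtens \<Lambda> G i (cmp \<Lambda> \<alpha> (act \<Phi> g \<mu>)) (i (gmul G (restriction \<Lambda> G \<Phi> g \<mu>) h))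
           else 0)))"

definition ss_u :: "('k, 'a, 'm) prodsys \<Rightarrow> ('g \<Rightarrow> 'a) \<Rightarrow> (('k \<Rightarrow> nat) \<Rightarrow> 'm \<Rightarrow> 'n) \<Rightarrow> 'g \<Rightarrow> 'n"
  where "ss_u M i \<psi> g = \<psi> 0 (emb M (i g))"

definition ss_t :: "('l, 'k) graph \<Rightarrow> ('l, 'g) gpd \<Rightarrow> ('k, 'a, 'a \<times> ('l \<Rightarrow> 'a)) prodsys \<Rightarrow>
    ('g \<Rightarrow> 'a::cstar_algebra) \<Rightarrow> (('k \<Rightarrow> nat) \<Rightarrow> 'a \<times> ('l \<Rightarrow> 'a) \<Rightarrow> 'n) \<Rightarrow> 'l \<Rightarrow> 'n"
  where "ss_t \<Lambda> G M i \<psi> \<alpha> =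
    (if deg \<Lambda> \<alpha> = 0 then \<psi> 0 (emb M (i (ident G \<alpha>)))
     else \<psi> (deg \<Lambda> \<alpha>) (dtens \<Lambda> G i \<alpha> (i (ident G (src \<Lambda> \<alpha>)))))"

definition universal_toeplitz_family :: "'b::cstar_algebra itself \<Rightarrow>
    ('l, 'k) graph \<Rightarrow> ('l, 'g) gpd \<Rightarrow> ('g \<Rightarrow> 'l pisom) \<Rightarrow>
    ('g \<Rightarrow> 'n::cstar_algebra) \<Rightarrow> ('l \<Rightarrow> 'n) \<Rightarrow> bool"
  where "universal_toeplitz_family B \<Lambda> G \<Phi> u t \<longleftrightarrow> toeplitz_family \<Lambda> G \<Phi> u t \<and>
    cstar_generated (u ` arrs G \<union> t ` mor \<Lambda>) = UNIV \<and>
    (\<forall>(U :: 'g \<Rightarrow> 'b) T. toeplitz_family \<Lambda> G \<Phi> U T \<longrightarrow>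
      (\<exists>\<rho>. star_hom \<rho> \<and> (\<forall>g\<in>arrs G. \<rho> (u g) = U g) \<and> (\<forall>\<alpha>\<in>mor \<Lambda>. \<rho> (t \<alpha>) = T \<alpha>)))"

end

theory Submission
  imports Defs
begin

text \<open>
  The fibre at \<open>p\<close> has the finite orthonormal basis $e_\lambda = \delta_\lambda \otimes
  i_{s(\lambda)}$, $\lambda \in \Lambda^p$, with $e_\lambda e_\mu = e_{\lambda\mu}$ or $0$ and
  $i_g e_\lambda = e_{g \cdot \lambda} i_{g|_\lambda}$ or $0$.  So all adjointable operators are of
  finite rank, $\psi^{(p)}(S) = \sum_\lambda \psi_p(S e_\lambda) \psi_p(e_\lambda)^*$, and with
  $r = p \vee q$ both sides of Nica covariance become sums over $\lambda \in \Lambda^p$, $\mu \in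
  \Lambda^q$:
  \[ \psi^{(p)}(S) \psi^{(q)}(T) = \sum \psi_p(S e_\lambda) \, t_\lambda^* t_\mu \,
      \psi_q(T^* e_\mu)^*, \qquad
     \psi^{(r)}(S_p^r T_q^r) = \sum \psi_p(S e_\lambda)
      \Bigl(\sum_{(\eta, \zeta)} t_\eta t_\zeta^*\Bigr) \psi_q(T^* e_\mu)^*, \]
  where $(\eta, \zeta)$ runs over $\Lambda^{\min}(\lambda, \mu)$.  Hence Nica covariance is equivalent to
  the Toeplitz--Cuntz--Krieger relation.  Conversely, a family $(U, T)$ with $\pi(i_g) = U_g$ gives
  the representation $\rho_p(x) = \sum_\lambda T_\lambda \pi(\langle e_\lambda, x\rangle)$; the
  relation $\pi(a) \rho_p(x) = \rho_p(a x)$ holds for $a = i_g$ and extends to all \<open>a\<close> by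
  continuity.
\<close>

section \<open>$C^*$-algebras\<close>

text \<open>The product system is specified on generators only: the left action on the
  \<open>i g\<close>, the multiplication on products of basis vectors with \<open>i g\<close>.
  Passing to all of C^*(G) is a density argument, and the continuity behind it has to be proved. It
  concerns homomorphisms such as \<open>\<psi> 0\<close> and \<open>\<pi>\<close>, but also the map
  sending \<open>a\<close> to \<open>\<rho> q (lact M q a z)\<close>, which is not multiplicative.
  The criterion therefore asks only that \<open>star (V a) * V a\<close> be a function of
  \<open>star a * a\<close>. It relies on a unit of C^*(G), which exists because there are finitely
  many vertices. A second obstacle is that \<open>ext_op\<close> and \<open>rep_compacts\<close> are
  definite descriptions: existence and uniqueness must be settled before anything can be computed.
  Products of basis vectors again form a frame, and this turns both questions into finite
  sums.\<close>

lemma norm_star: "norm (star x) = norm (x::'a::cstar_algebra)"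
proof -
  have le: "norm y \<le> norm (star y)" for y :: 'a
  proof (cases "y = 0")
    case False
    have "norm y * norm y \<le> norm (star y) * norm y"
      using cstar_identity[of y] norm_mult_ineq[of "star y" y] by (simp add: power2_eq_square)
    thus ?thesis using False by simp
  qed simp
  from le[of x] le[of "star x"] show ?thesis by (simp add: star_star)
qed

lemma star_minus: "star (- x) = - star (x::'a::cstar_algebra)"
  using star_add[of x "- x"] by (simp add: star_zero eq_neg_iff_add_eq_0 add.commute)

lemma star_diff: "star (x - y) = star x - star (y::'a::cstar_algebra)"
  using star_add[of x "- y"] by (simp add: star_minus)

lemma star_scaleR: "star (r *\<^sub>R x) = r *\<^sub>R star (x::'a::cstar_algebra)"
  by (simp add: scaleR_scaleC star_scaleC)

lemma continuous_on_star: "continuous_on A (star :: 'a::cstar_algebra \<Rightarrow> 'a)"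
proof -
  have "bounded_linear (star :: 'a \<Rightarrow> 'a)"
    by (rule bounded_linear_intro[where K = 1]) (simp_all add: star_add star_scaleR norm_star)
  thus ?thesis by (rule linear_continuous_on)
qed

lemma clinear_onD:
  assumes "clinear_on V f"
  shows "x \<in> V \<Longrightarrow> y \<in> V \<Longrightarrow> f (x + y) = f x + f y"
    and "x \<in> V \<Longrightarrow> f (c *\<^sub>C x) = c *\<^sub>C f x"
  using assms by (auto simp: clinear_on_def)

lemma clinear_on_zero: "clinear_on V f \<Longrightarrow> 0 \<in> V \<Longrightarrow> f 0 = 0"
  using clinear_onD(2)[of V f 0 0] by simp

lemma clinear_on_sum:
  assumes "clinear_on V f" "complex_vector.subspace V" "\<And>j. j \<in> J \<Longrightarrow> x j \<in> V"
  shows "f (\<Sum>j\<in>J. x j) = (\<Sum>j\<in>J. f (x j))"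
  using assms(3)
proof (induction J rule: infinite_finite_induct)
  case (insert j J)
  thus ?case
    using clinear_onD(1)[OF assms(1), of "x j" "sum x J"]
      complex_vector.subspace_sum[OF assms(2), of J x] by simp
qed (use clinear_on_zero[OF assms(1)] complex_vector.subspace_0[OF assms(2)] in auto)

lemma clinear_on_UNIV_sum: "clinear_on UNIV f \<Longrightarrow> f (\<Sum>j\<in>J. x j) = (\<Sum>j\<in>J. f (x j))"
  by (rule clinear_on_sum) (auto simp: complex_vector.subspace_UNIV)

lemma cstar_subalgebra_scaleC: "cstar_subalgebra C \<Longrightarrow> a \<in> C \<Longrightarrow> c *\<^sub>C a \<in> C"
  by (auto simp: cstar_subalgebra_def complex_vector.subspace_def)

lemma cstar_subalgebra_sum:
  "cstar_subalgebra C \<Longrightarrow> (\<And>j. j \<in> J \<Longrightarrow> a j \<in> C) \<Longrightarrow> (\<Sum>j\<in>J. a j) \<in> C"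
  by (auto simp: cstar_subalgebra_def intro: complex_vector.subspace_sum)

lemma cstar_subset_eq_UNIV:
  assumes "cstar_generated S = UNIV" "cstar_subalgebra C" "S \<subseteq> C"
  shows "C = UNIV"
  using assms by (auto simp: cstar_generated_def)

text \<open>Requiring \<open>P\<close> also of \<open>star a\<close> makes the set of good elements closed under \<open>star\<close>
  for free, so that \<open>P\<close> itself need not be.\<close>

lemma cstar_generated_induct [consumes 1, case_names gen closed zero add scale mult]:
  assumes gen: "cstar_generated S = UNIV"
    and "\<And>a. a \<in> S \<Longrightarrow> P a \<and> P (star a)"
    and cl: "closed {a. P a}"
    and zero: "P 0"
    and add: "\<And>a b. P a \<Longrightarrow> P b \<Longrightarrow> P (a + b)"
    and scale: "\<And>c a. P a \<Longrightarrow> P (c *\<^sub>C a)"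
    and mult: "\<And>a b. P a \<Longrightarrow> P b \<Longrightarrow> P (a * b)"
  shows "P a"
proof -
  let ?C = "{a. P a} \<inter> star -` {a. P a}"
  have "cstar_subalgebra ?C"
    unfolding cstar_subalgebra_def complex_vector.subspace_def
    using zero add scale mult closed_Int[OF cl closed_vimage[OF cl continuous_on_star]]
    by (auto simp: star_zero star_add star_scaleC star_mult star_star)
  from cstar_subset_eq_UNIV[OF gen this] assms(2) show ?thesis by auto
qed

section \<open>Square roots and automatic continuity\<close>

text \<open>\<open>d\<close> stands for $1 - \sqrt{1 - h^2}$; it is the fixed point of the contraction
  $d \mapsto (h^2 + d^2)/2$.\<close>

lemma selfadjoint_sqrt:
  fixes h :: "'a::cstar_algebra"
  assumes h: "star h = h" "norm h < 1"
  obtains d where "star d = d" "d * h = h * d" "h * h + d * d = d + d"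
proof -
  define S where "S = {d. norm d \<le> norm h \<and> star d = d \<and> d * h = h * d}"
  \<comment> \<open>The side conditions are built into the complete set \<open>S\<close>, so the
    fixed point inherits them. As \<open>norm h < 1\<close>, the same number serves as radius of
    \<open>S\<close> and as Lipschitz constant.\<close>
  define F where "F d = (1/2) *\<^sub>R (h * h + d * d)" for d
  have "closed S"
    unfolding S_def
    by (intro closed_Collect_conj closed_Collect_le closed_Collect_eq continuous_intros
        continuous_on_star)
  hence "complete S" by (simp add: complete_eq_closed)
  moreover have "S \<noteq> {}" by (auto simp: S_def star_zero intro!: exI[of _ 0])
  moreover have "F ` S \<subseteq> S"
  proof
    fix y assume "y \<in> F ` S"
    then obtain d where d: "d \<in> S" and y: "y = F d" by auto
    have sq: "norm (x * x) \<le> norm h" if "norm x \<le> norm h" for x :: 'a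
    proof -
      have "norm (x * x) \<le> norm x * norm x" by (rule norm_mult_ineq)
      also have "\<dots> \<le> norm h * 1" using that h(2) by (intro mult_mono) auto
      finally show ?thesis by simp
    qed
    have "norm (h * h + d * d) \<le> norm h + norm h"
      by (rule norm_triangle_le) (use sq[of h] sq[of d] d in \<open>auto simp: S_def intro: add_mono\<close>)
    hence "norm (F d) \<le> norm h" by (simp add: F_def)
    moreover have "star (F d) = F d"
      using d h by (simp add: F_def S_def star_scaleR star_add star_mult)
    moreover have "F d * h = h * F d"
    proof -
      have "d * h = h * d" using d by (simp add: S_def)
      hence "d * (d * h) = h * (d * d)" by (simp add: mult.assoc[symmetric])
      thus ?thesis by (simp add: F_def distrib_left distrib_right mult.assoc)
    qed
    ultimately show "y \<in> S" by (simp add: S_def y)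
  qed
  moreover have "dist (F x) (F y) \<le> norm h * dist x y" if "x \<in> S" "y \<in> S" for x y
  proof -
    \<comment> \<open>This form of the difference of squares holds without commutativity of
      \<open>x\<close> and \<open>y\<close>.\<close>
    have "F x - F y = (1/2) *\<^sub>R (x * (x - y) + (x - y) * y)"
      by (simp add: F_def algebra_simps)
    moreover have "norm (x * (x - y) + (x - y) * y) \<le> norm h * norm (x - y) + norm h * norm (x - y)"
    proof (rule norm_triangle_le, rule add_mono)
      show "norm (x * (x - y)) \<le> norm h * norm (x - y)"
        by (rule order.trans[OF norm_mult_ineq]) (use that in \<open>auto simp: S_def intro: mult_right_mono\<close>)
      show "norm ((x - y) * y) \<le> norm h * norm (x - y)"
        using norm_mult_ineq[of "x - y" y] mult_left_mono[of "norm y" "norm h" "norm (x - y)"] that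
        by (simp add: S_def mult.commute)
    qed
    ultimately show ?thesis by (simp add: dist_norm)
  qed
  ultimately obtain d where d: "d \<in> S" "F d = d"
    using Banach_fix[of S "norm h" F] h(2) by (metis norm_ge_zero)
  have "h * h + d * d = d + d" using d(2) by (metis F_def scaleR_half_double scaleR_right_distrib)
  with d(1) show ?thesis by (intro that[of d]) (auto simp: S_def)
qed

text \<open>A self-adjoint contraction \<open>h\<close> is the real part of the unitary $w = h + i\sqrt{1 - h^2}$, and
  \<open>norm (V w)\<close> depends only on \<open>star w * w = 1\<close>.  This replaces the spectral theory usually
  needed for the continuity of homomorphisms between $C^*$-algebras.\<close>

lemma clinear_bounded_of_pairing:
  fixes V :: "'a::cstar_algebra \<Rightarrow> 'b::cstar_algebra"
  assumes V: "clinear_on UNIV V" and pairing: "\<And>a. star (V a) * V a = \<omega> (star a * a)"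
    and unit: "\<And>a::'a. e * a = a" "\<And>a. a * e = a"
  shows "bounded_linear V"
proof -
  have V_scaleR: "V (r *\<^sub>R a) = r *\<^sub>R V a" for r a
    using clinear_onD(2)[OF V] by (simp add: scaleR_scaleC)
  have V_add: "V (a + b) = V a + V b" for a b using clinear_onD(1)[OF V] by simp
  have "star (star e) * star e = star e" using unit(1) star_star by metis
  hence e: "star e = e" by (metis star_mult star_star unit(1))
  \<comment> \<open>At every \<open>w\<close> with \<open>star w * w = e\<close> the pairing takes
    the value \<open>\<omega> e\<close>, so \<open>K\<close> is the norm of \<open>V w\<close> for
    all these \<open>w\<close>.\<close>
  define K where "K = sqrt (norm (\<omega> e))"
  have unitary: "norm (V w) = K" if "star w * w = e" for w
  proof -
    have "(norm (V w))\<^sup>2 = norm (\<omega> e)" using cstar_identity[of "V w"] pairing[of w] that by simp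
    thus ?thesis by (metis K_def norm_ge_zero real_sqrt_unique)
  qed
  have small: "norm (V h) \<le> K" if h: "star h = h" "norm h < 1" for h
  proof -
    obtain d where d: "star d = d" "d * h = h * d" "h * h + d * d = d + d"
      using selfadjoint_sqrt[OF h] .
    \<comment> \<open>\<open>c\<close> plays the role of sqrt(1 - h^2), with \<open>e\<close> as
      1.\<close>
    define c where "c = e - d"
    have c: "star c = c" "c * h = h * c"
      using d by (auto simp: c_def star_diff e algebra_simps unit)
    have "h * h + c * c = h * h + d * d - (d + d) + e"
      by (simp add: c_def algebra_simps unit)
    hence c': "h * h + c * c = e" by (simp add: d)
    define w where "w = h + \<i> *\<^sub>C c"
    have sw: "star w = h - \<i> *\<^sub>C c"
      by (simp add: w_def star_add star_scaleC h c)
    have "star w * w = h * h + c * c" "w * star w = h * h + c * c"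
      unfolding sw unfolding w_def
      by (simp_all add: distrib_left distrib_right left_diff_distrib right_diff_distrib
          mult_scaleC_left mult_scaleC_right scaleC_scaleC c scaleC_one scaleC_add_right
          complex_vector.scale_right_diff_distrib)
    \<comment> \<open>The bound for \<open>V w\<close> applies to \<open>star w\<close> as well, and
      \<open>h\<close> is the mean of the two.\<close>
    hence "star w * w = e" "star (star w) * star w = e" by (simp_all add: c' star_star)
    hence "norm (V w + V (star w)) \<le> K + K"
      using unitary by (metis norm_triangle_ineq)
    moreover have "V w + V (star w) = 2 *\<^sub>R V h"
    proof -
      have "w + star w = 2 *\<^sub>R h" unfolding sw by (simp add: w_def scaleR_2)
      thus ?thesis by (metis V_add V_scaleR)
    qed
    ultimately show ?thesis by simp
  qed
  have sa: "norm (V h) \<le> K * norm h" if h: "star h = h" for h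
  proof -
    \<comment> \<open>The square root is available only for norms below 1, so \<open>h\<close> is
      rescaled by each \<open>t\<close> strictly above its norm; afterwards \<open>t\<close> tends
      to \<open>norm h\<close>.\<close>
    have "norm (V h) \<le> K * t" if t: "t > norm h" for t
    proof -
      have t0: "t > 0" using t norm_ge_zero[of h] by linarith
      have "norm (V ((1/t) *\<^sub>R h)) \<le> K"
        by (rule small) (use t t0 in \<open>auto simp: star_scaleR h\<close>)
      thus ?thesis using t0 by (simp add: V_scaleR field_simps)
    qed
    note * = this
    have K0: "K \<ge> 0" by (simp add: K_def)
    show ?thesis
    proof (rule field_le_epsilon)
      fix \<epsilon> :: real assume "\<epsilon> > 0"
      \<comment> \<open>The summand 1 keeps the denominator positive when
        \<open>K = 0\<close>.\<close>
      have "norm (V h) \<le> K * (norm h + \<epsilon> / (K + 1))"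
        using * \<open>\<epsilon> > 0\<close> K0 by simp
      also have "\<dots> \<le> K * norm h + \<epsilon>"
        using \<open>\<epsilon> > 0\<close> K0 by (simp add: field_simps)
      finally show "norm (V h) \<le> K * norm h + \<epsilon>" .
    qed
  qed
  show ?thesis
  proof (rule bounded_linear_intro[where K = "K + K"])
    fix a :: 'a
    \<comment> \<open>Real and imaginary part: a = h + i k with both self-adjoint and of norm at
      most \<open>norm a\<close>, whence the bound \<open>K + K\<close>.\<close>
    define h where "h = (1/2) *\<^sub>R (a + star a)"
    define k where "k = (1/2) *\<^sub>R (- (\<i> *\<^sub>C (a - star a)))"
    have K0: "K \<ge> 0" by (simp add: K_def)
    have half: "norm ((1/2) *\<^sub>R x) \<le> norm a" if "norm x \<le> norm a + norm a" for x :: 'a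
      using that by simp
    have "norm h \<le> norm a"
      unfolding h_def using norm_triangle_ineq[of a "star a"] by (intro half) (simp add: norm_star)
    moreover have "norm k \<le> norm a"
      unfolding k_def using norm_triangle_ineq4[of a "star a"]
      by (intro half) (simp add: norm_star norm_scaleC)
    moreover have "star h = h" by (simp add: h_def star_scaleR star_add star_star add.commute)
    moreover have "star k = k"
      by (simp add: k_def star_scaleR star_minus star_scaleC star_diff star_star
          complex_vector.scale_right_diff_distrib)
    moreover have "norm (V a) \<le> norm (V h) + norm (V k)"
    proof -
      have "\<i> *\<^sub>C k = (1/2) *\<^sub>R (a - star a)"
        by (simp add: k_def scaleR_scaleC scaleC_scaleC)
      moreover have "(1/2) *\<^sub>R (a + star a) + (1/2) *\<^sub>R (a - star a) = a"
        by (simp flip: scaleR_right_distrib add: scaleR_2)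
      ultimately have "h + \<i> *\<^sub>C k = a" by (simp only: h_def)
      hence "V a = V h + \<i> *\<^sub>C V k" using clinear_onD(2)[OF V, of k \<i>] V_add[of h "\<i> *\<^sub>C k"] by simp
      thus ?thesis using norm_triangle_ineq[of "V h" "\<i> *\<^sub>C V k"] by (simp add: norm_scaleC)
    qed
    ultimately have "norm (V a) \<le> K * norm a + K * norm a"
      using sa[of h] sa[of k] mult_left_mono[of "norm h" "norm a" K]
        mult_left_mono[of "norm k" "norm a" K] K0 by linarith
    thus "norm (V a) \<le> norm a * (K + K)" by (simp add: algebra_simps)
  qed (simp_all add: V_add V_scaleR)
qed

lemma star_homD:
  assumes "star_hom \<pi>"
  shows "clinear_on UNIV \<pi>" "\<pi> (a * b) = \<pi> a * \<pi> b" "\<pi> (star a) = star (\<pi> a)"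
  using assms by (auto simp: star_hom_def)

text \<open>Multiplicativity makes \<open>\<pi>\<close> itself the function \<open>\<omega>\<close>
  of the pairing.\<close>

lemma star_hom_bounded:
  fixes \<pi> :: "'a::cstar_algebra \<Rightarrow> 'b::cstar_algebra"
  assumes "star_hom \<pi>" "\<And>a::'a. e * a = a" "\<And>a. a * e = a"
  shows "bounded_linear \<pi>"
  by (rule clinear_bounded_of_pairing[where \<omega> = \<pi> and e = e])
    (simp_all add: star_homD[OF assms(1)] assms(2,3))

section \<open>Self-similar actions\<close>

locale ss_action =
  fixes \<Lambda> :: "('l, 'k::finite) graph" and G :: "('l, 'g) gpd" and \<Phi> :: "'g \<Rightarrow> 'l pisom"
  assumes finite_kgraph: "finite_kgraph \<Lambda>"
    and self_similar: "self_similar_action \<Lambda> G \<Phi>"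
begin

sublocale kgraph \<Lambda>
  using finite_kgraph by (simp add: finite_kgraph_def)

sublocale groupoid G
  using self_similar by (simp add: self_similar_action_def faithful_action_def)

lemma finite_level: "finite (level \<Lambda> p)"
  using finite_kgraph by (simp add: finite_kgraph_def)

lemma levelI: "\<alpha> \<in> mor \<Lambda> \<Longrightarrow> deg \<Lambda> \<alpha> = p \<Longrightarrow> \<alpha> \<in> level \<Lambda> p"
  by (simp add: level_def)

lemma level_mor: "\<alpha> \<in> level \<Lambda> p \<Longrightarrow> \<alpha> \<in> mor \<Lambda>"
  by (simp add: level_def)

lemma level_deg: "\<alpha> \<in> level \<Lambda> p \<Longrightarrow> deg \<Lambda> \<alpha> = p"
  by (simp add: level_def)

section \<open>Unique factorisation and decomposition into edges\<close>

lemma factorisation_unique: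
  assumes "\<mu> \<in> level \<Lambda> p" "\<nu> \<in> level \<Lambda> q" "src \<Lambda> \<mu> = rng \<Lambda> \<nu>"
    and "\<mu>' \<in> level \<Lambda> p" "\<nu>' \<in> level \<Lambda> q" "src \<Lambda> \<mu>' = rng \<Lambda> \<nu>'"
    and "cmp \<Lambda> \<mu> \<nu> = cmp \<Lambda> \<mu>' \<nu>'"
  shows "\<mu> = \<mu>' \<and> \<nu> = \<nu>'"
proof -
  have "cmp \<Lambda> \<mu> \<nu> \<in> mor \<Lambda>" "deg \<Lambda> (cmp \<Lambda> \<mu> \<nu>) = p + q"
    using assms by (auto simp: level_def cmp_mor deg_cmp)
  from factorisation[OF this] obtain z where
    "\<And>z'. (case z' of (x, y) \<Rightarrow> x \<in> level \<Lambda> p \<and> y \<in> level \<Lambda> q \<and> src \<Lambda> x = rng \<Lambda> y \<and>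
      cmp \<Lambda> \<mu> \<nu> = cmp \<Lambda> x y) \<Longrightarrow> z' = z" by (elim ex1E) blast
  from this[of "(\<mu>, \<nu>)"] this[of "(\<mu>', \<nu>')"] assms show ?thesis by auto
qed

lemma factorisation_obtain:
  assumes "\<alpha> \<in> level \<Lambda> (p + q)"
  obtains \<mu> \<nu> where "\<mu> \<in> level \<Lambda> p" "\<nu> \<in> level \<Lambda> q" "src \<Lambda> \<mu> = rng \<Lambda> \<nu>" "\<alpha> = cmp \<Lambda> \<mu> \<nu>"
proof -
  have "\<exists>!(\<mu>, \<nu>). \<mu> \<in> level \<Lambda> p \<and> \<nu> \<in> level \<Lambda> q \<and> src \<Lambda> \<mu> = rng \<Lambda> \<nu> \<and> \<alpha> = cmp \<Lambda> \<mu> \<nu>"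
    by (rule factorisation) (use assms in \<open>auto simp: level_def\<close>)
  thus ?thesis using that by (elim ex1E) (auto split: prod.splits)
qed

lemma cmp_level:
  "\<alpha> \<in> level \<Lambda> p \<Longrightarrow> \<mu> \<in> level \<Lambda> q \<Longrightarrow> src \<Lambda> \<alpha> = rng \<Lambda> \<mu> \<Longrightarrow> cmp \<Lambda> \<alpha> \<mu> \<in> level \<Lambda> (p + q)"
  by (simp add: level_def cmp_mor deg_cmp)

lemma vertexD:
  assumes "v \<in> vertices \<Lambda>"
  shows "v \<in> mor \<Lambda>" "rng \<Lambda> v = v" "src \<Lambda> v = v"
  using assms by (auto simp: vertices_eq)

lemma vertices_level: "vertices \<Lambda> = level \<Lambda> 0"
  by (simp add: vertices_def)

lemma src_vertex: "\<alpha> \<in> mor \<Lambda> \<Longrightarrow> src \<Lambda> \<alpha> \<in> vertices \<Lambda>"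
  by (simp add: vertices_def level_def src_mor deg_src)

lemma rng_vertex: "\<alpha> \<in> mor \<Lambda> \<Longrightarrow> rng \<Lambda> \<alpha> \<in> vertices \<Lambda>"
  by (simp add: vertices_def level_def rng_mor deg_rng)

lemma edge_deg: "e \<in> edges \<Lambda> \<Longrightarrow> deg \<Lambda> e \<noteq> 0"
  by (auto simp: edges_def level_def fun_eq_iff)

lemma edge_mor: "e \<in> edges \<Lambda> \<Longrightarrow> e \<in> mor \<Lambda>"
  by (auto simp: edges_def level_def)

lemma edge_factorisation_mor: "edge_factorisation \<Lambda> es \<alpha> \<Longrightarrow> \<alpha> \<in> mor \<Lambda>"
  by (induction rule: edge_factorisation.induct) (auto simp: vertexD edge_mor cmp_mor)

text \<open>Induction on the total degree: a positive coordinate of the degree allows one edge to be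
  split off. This gives meaning to the \<open>SOME\<close> in \<open>restriction\<close>.\<close>

lemma edge_factorisation_exists: "\<alpha> \<in> mor \<Lambda> \<Longrightarrow> \<exists>es. edge_factorisation \<Lambda> es \<alpha>"
proof (induction "\<Sum>j\<in>UNIV. deg \<Lambda> \<alpha> j" arbitrary: \<alpha> rule: less_induct)
  case less
  show ?case
  proof (cases "deg \<Lambda> \<alpha> = 0")
    case True
    hence "\<alpha> \<in> vertices \<Lambda>" using less.prems by (simp add: vertices_def level_def)
    thus ?thesis by (intro exI[of _ "[]"] edge_factorisation.vertex)
  next
    case False
    then obtain j where j: "deg \<Lambda> \<alpha> j > 0" by (auto simp: fun_eq_iff)
    define p :: "'k \<Rightarrow> nat" where "p = (\<lambda>j'. if j' = j then 1 else 0)"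
    have split: "deg \<Lambda> \<alpha> = p + (deg \<Lambda> \<alpha> - p)" using j by (auto simp: p_def fun_eq_iff)
    hence "\<alpha> \<in> level \<Lambda> (p + (deg \<Lambda> \<alpha> - p))" using less.prems by (simp add: level_def)
    then obtain e \<mu> where f: "e \<in> level \<Lambda> p" "\<mu> \<in> level \<Lambda> (deg \<Lambda> \<alpha> - p)" "src \<Lambda> e = rng \<Lambda> \<mu>"
      "\<alpha> = cmp \<Lambda> e \<mu>" by (rule factorisation_obtain)
    have "(\<Sum>j\<in>UNIV. deg \<Lambda> \<mu> j) < (\<Sum>j\<in>UNIV. deg \<Lambda> \<alpha> j)"
      by (rule sum_strict_mono_ex1) (use f(2) j in \<open>auto simp: level_def p_def\<close>)
    then obtain es where "edge_factorisation \<Lambda> es \<mu>" using less.hyps f(2) level_mor by blast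
    moreover have "e \<in> edges \<Lambda>" using f(1) by (auto simp: edges_def p_def)
    ultimately have "edge_factorisation \<Lambda> (e # es) \<alpha>"
      unfolding f(4) using f(3) by (intro edge_factorisation.edge)
    thus ?thesis by (rule exI)
  qed
qed

section \<open>The action on paths and its restrictions\<close>

lemma action:
  "objs G = vertices \<Lambda>" "unit_preserving_hom G (PIso \<Lambda>) \<Phi>" "inj_on \<Phi> (arrs G)"
  using self_similar by (auto simp: self_similar_action_def faithful_action_def)

lemma action_pisom:
  assumes "g \<in> arrs G"
  shows "\<Phi> g = (dom G g, cod G g, act \<Phi> g)" "is_pisom \<Lambda> (dom G g, cod G g, act \<Phi> g)"
  using assms action(2) unfolding unit_preserving_hom_def PIso_def act_def
  by (auto simp: prod_eq_iff split: prod.splits) (metis prod.collapse)+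

lemma act_level:
  assumes "g \<in> arrs G" "\<alpha> \<in> level \<Lambda> p" "rng \<Lambda> \<alpha> = dom G g"
  shows "act \<Phi> g \<alpha> \<in> level \<Lambda> p" "rng \<Lambda> (act \<Phi> g \<alpha>) = cod G g"
proof -
  have "act \<Phi> g ` (paths_at \<Lambda> (dom G g) \<inter> level \<Lambda> p) = paths_at \<Lambda> (cod G g) \<inter> level \<Lambda> p"
    using action_pisom(2)[OF assms(1)] by (auto simp: is_pisom_def)
  moreover have "\<alpha> \<in> paths_at \<Lambda> (dom G g) \<inter> level \<Lambda> p"
    using assms by (auto simp: paths_at_def level_def)
  ultimately have "act \<Phi> g \<alpha> \<in> paths_at \<Lambda> (cod G g) \<inter> level \<Lambda> p" by blast
  thus "act \<Phi> g \<alpha> \<in> level \<Lambda> p" "rng \<Lambda> (act \<Phi> g \<alpha>) = cod G g" by (auto simp: paths_at_def)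
qed

lemma act_ident:
  assumes "v \<in> vertices \<Lambda>" "\<alpha> \<in> mor \<Lambda>" "rng \<Lambda> \<alpha> = v"
  shows "act \<Phi> (ident G v) \<alpha> = \<alpha>"
proof -
  have "\<Phi> (ident G v) = (v, v, restrict id (paths_at \<Lambda> v))"
    using action(1,2) assms by (auto simp: unit_preserving_hom_def PIso_def)
  thus ?thesis using assms by (simp add: act_def paths_at_def)
qed

text \<open>The action preserves degrees, so the image is a vertex, and a vertex equals its own
  range.\<close>

lemma act_vertex:
  assumes "g \<in> arrs G"
  shows "act \<Phi> g (dom G g) = cod G g"
proof -
  have "dom G g \<in> vertices \<Lambda>" using dom_objs[OF assms] action(1) by simp
  hence "act \<Phi> g (dom G g) \<in> vertices \<Lambda>" "rng \<Lambda> (act \<Phi> g (dom G g)) = cod G g"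
    using act_level[OF assms, of "dom G g" 0] by (auto simp: vertices_level[symmetric] vertexD)
  thus ?thesis by (simp add: vertexD)
qed

text \<open>Unique factorisation cancels the common prefix \<open>act \<Phi> g e\<close>, so
  \<open>h\<close> and \<open>h'\<close> act alike; faithfulness then identifies them.\<close>

lemma edge_restriction_unique:
  assumes g: "g \<in> arrs G" and e: "e \<in> edges \<Lambda>" "rng \<Lambda> e = dom G g"
    and h: "is_edge_restriction \<Lambda> G \<Phi> g e h" and h': "is_edge_restriction \<Lambda> G \<Phi> g e h'"
  shows "h = h'"
proof -
  note H = h[unfolded is_edge_restriction_def] and H' = h'[unfolded is_edge_restriction_def]
  have ge: "act \<Phi> g e \<in> level \<Lambda> (deg \<Lambda> e)"
    using act_level(1)[OF g levelI[OF edge_mor[OF e(1)] refl] e(2)] .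
  have "act \<Phi> h \<alpha> = act \<Phi> h' \<alpha>" if \<alpha>: "\<alpha> \<in> paths_at \<Lambda> (src \<Lambda> e)" for \<alpha>
  proof -
    have m: "\<alpha> \<in> level \<Lambda> (deg \<Lambda> \<alpha>)" "rng \<Lambda> \<alpha> = src \<Lambda> e"
      using \<alpha> by (auto simp: paths_at_def level_def)
    have "cmp \<Lambda> (act \<Phi> g e) (act \<Phi> h \<alpha>) = cmp \<Lambda> (act \<Phi> g e) (act \<Phi> h' \<alpha>)"
      using H H' \<alpha> by metis
    moreover have "act \<Phi> h \<alpha> \<in> level \<Lambda> (deg \<Lambda> \<alpha>)" "act \<Phi> h' \<alpha> \<in> level \<Lambda> (deg \<Lambda> \<alpha>)"
      "rng \<Lambda> (act \<Phi> h \<alpha>) = src \<Lambda> (act \<Phi> g e)" "rng \<Lambda> (act \<Phi> h' \<alpha>) = src \<Lambda> (act \<Phi> g e)"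
      using act_level[of h, OF _ m(1)] act_level[of h', OF _ m(1)] m(2) H H' by auto
    ultimately show ?thesis using factorisation_unique[OF ge _ _ ge] by metis
  qed
  \<comment> \<open>Off these paths both functions take the default value, so agreement on the paths
    is agreement everywhere.\<close>
  moreover have "act \<Phi> h \<in> extensional (paths_at \<Lambda> (src \<Lambda> e))"
    "act \<Phi> h' \<in> extensional (paths_at \<Lambda> (src \<Lambda> e))"
    using action_pisom(2)[of h] action_pisom(2)[of h'] H H' by (auto simp: is_pisom_def)
  ultimately have "act \<Phi> h = act \<Phi> h'" by (blast intro: extensionalityI)
  hence "\<Phi> h = \<Phi> h'" using H H' action_pisom(1) by simp
  thus ?thesis using H H' action(3) by (auto dest: inj_onD)
qed

lemma edge_restriction_eqI:
  assumes "g \<in> arrs G" "e \<in> edges \<Lambda>" "rng \<Lambda> e = dom G g" "is_edge_restriction \<Lambda> G \<Phi> g e h"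
  shows "edge_restriction \<Lambda> G \<Phi> g e = h"
  unfolding edge_restriction_def
  using assms edge_restriction_unique by (intro the_equality) blast+

lemma is_edge_restriction_edge_restriction:
  assumes "g \<in> arrs G" "e \<in> edges \<Lambda>" "rng \<Lambda> e = dom G g"
  shows "is_edge_restriction \<Lambda> G \<Phi> g e (edge_restriction \<Lambda> G \<Phi> g e)"
proof -
  have "e \<in> edges \<Lambda> \<inter> paths_at \<Lambda> (dom G g)" using assms by (simp add: paths_at_def edge_mor)
  then obtain h where "is_edge_restriction \<Lambda> G \<Phi> g e h"
    using self_similar assms(1) by (auto simp: self_similar_action_def)
  thus ?thesis using edge_restriction_eqI[OF assms] by simp
qed

text \<open>Proved for every factorisation, so that it covers whichever one \<open>SOME\<close>
  picks in \<open>restriction\<close>. The element \<open>g\<close> varies in the induction because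
  each edge replaces it by its restriction.\<close>

lemma foldl_edge_restriction:
  assumes "edge_factorisation \<Lambda> es \<alpha>" "g \<in> arrs G" "rng \<Lambda> \<alpha> = dom G g"
  shows "foldl (edge_restriction \<Lambda> G \<Phi>) g es \<in> arrs G \<and>
    dom G (foldl (edge_restriction \<Lambda> G \<Phi>) g es) = src \<Lambda> \<alpha> \<and>
    cod G (foldl (edge_restriction \<Lambda> G \<Phi>) g es) = src \<Lambda> (act \<Phi> g \<alpha>)"
  using assms
proof (induction arbitrary: g rule: edge_factorisation.induct)
  case (vertex v)
  hence "cod G g \<in> vertices \<Lambda>" using cod_objs action(1) by simp
  thus ?case using vertex by (simp add: vertexD act_vertex)
next
  case (edge e es \<mu>)
  have \<mu>: "\<mu> \<in> mor \<Lambda>" using edge edge_factorisation_mor by simp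
  hence e: "e \<in> edges \<Lambda>" "rng \<Lambda> e = dom G g" using edge by (auto simp: rng_cmp edge_mor)
  let ?h = "edge_restriction \<Lambda> G \<Phi> g e"
  have h: "?h \<in> arrs G" "dom G ?h = src \<Lambda> e" "cod G ?h = src \<Lambda> (act \<Phi> g e)"
    "act \<Phi> g (cmp \<Lambda> e \<mu>) = cmp \<Lambda> (act \<Phi> g e) (act \<Phi> ?h \<mu>)"
    using is_edge_restriction_edge_restriction[OF edge.prems(1) e] edge \<mu>
    by (auto simp: is_edge_restriction_def paths_at_def)
  have "act \<Phi> g e \<in> mor \<Lambda>"
    using act_level(1)[OF edge.prems(1) levelI[OF edge_mor[OF e(1)] refl] e(2)] level_mor by blast
  moreover have "act \<Phi> ?h \<mu> \<in> mor \<Lambda>" "rng \<Lambda> (act \<Phi> ?h \<mu>) = cod G ?h"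
    using act_level[OF h(1) levelI[OF \<mu> refl]] h(2) edge level_mor by auto
  ultimately have "src \<Lambda> (act \<Phi> g (cmp \<Lambda> e \<mu>)) = src \<Lambda> (act \<Phi> ?h \<mu>)"
    using h by (simp add: src_cmp)
  thus ?case using edge.IH[OF h(1)] h(2) edge \<mu> by (simp add: src_cmp edge_mor)
qed

text \<open>The identity at \<open>src \<Lambda> e\<close> satisfies the condition defining the
  restriction, so by uniqueness every stage of the fold is an identity.\<close>

lemma foldl_edge_restriction_ident:
  assumes "edge_factorisation \<Lambda> es \<alpha>"
  shows "foldl (edge_restriction \<Lambda> G \<Phi>) (ident G (rng \<Lambda> \<alpha>)) es = ident G (src \<Lambda> \<alpha>)"
  using assms
proof (induction rule: edge_factorisation.induct)
  case (vertex v)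
  thus ?case by (simp add: vertexD)
next
  case (edge e es \<mu>)
  have \<mu>: "\<mu> \<in> mor \<Lambda>" using edge edge_factorisation_mor by simp
  have e: "e \<in> mor \<Lambda>" using edge edge_mor by simp
  have v: "rng \<Lambda> e \<in> vertices \<Lambda>" "src \<Lambda> e \<in> vertices \<Lambda>" using e rng_vertex src_vertex by auto
  have "is_edge_restriction \<Lambda> G \<Phi> (ident G (rng \<Lambda> e)) e (ident G (src \<Lambda> e))"
    using v e action(1)
    by (auto simp: is_edge_restriction_def ident_arrs dom_ident cod_ident act_ident paths_at_def
        cmp_mor rng_cmp)
  hence "edge_restriction \<Lambda> G \<Phi> (ident G (rng \<Lambda> e)) e = ident G (src \<Lambda> e)"
    using v edge action(1) by (intro edge_restriction_eqI) (auto simp: ident_arrs dom_ident)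
  thus ?case using edge e \<mu> by (simp add: rng_cmp src_cmp)
qed

lemma restriction_fold:
  assumes "\<alpha> \<in> mor \<Lambda>"
  obtains es where "edge_factorisation \<Lambda> es \<alpha>"
    "\<And>g. restriction \<Lambda> G \<Phi> g \<alpha> = foldl (edge_restriction \<Lambda> G \<Phi>) g es"
  using someI_ex[OF edge_factorisation_exists[OF assms]] that unfolding restriction_def by blast

lemma restriction_arr:
  assumes "g \<in> arrs G" "\<alpha> \<in> mor \<Lambda>" "rng \<Lambda> \<alpha> = dom G g"
  shows "restriction \<Lambda> G \<Phi> g \<alpha> \<in> arrs G" "dom G (restriction \<Lambda> G \<Phi> g \<alpha>) = src \<Lambda> \<alpha>"
    "cod G (restriction \<Lambda> G \<Phi> g \<alpha>) = src \<Lambda> (act \<Phi> g \<alpha>)"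
proof -
  obtain es where es: "edge_factorisation \<Lambda> es \<alpha>"
    and "restriction \<Lambda> G \<Phi> g \<alpha> = foldl (edge_restriction \<Lambda> G \<Phi>) g es"
    using restriction_fold[OF assms(2)] by metis
  thus "restriction \<Lambda> G \<Phi> g \<alpha> \<in> arrs G" "dom G (restriction \<Lambda> G \<Phi> g \<alpha>) = src \<Lambda> \<alpha>"
    "cod G (restriction \<Lambda> G \<Phi> g \<alpha>) = src \<Lambda> (act \<Phi> g \<alpha>)"
    using foldl_edge_restriction[OF es assms(1,3)] by simp_all
qed

lemma restriction_ident:
  assumes "\<alpha> \<in> mor \<Lambda>" "rng \<Lambda> \<alpha> = v"
  shows "restriction \<Lambda> G \<Phi> (ident G v) \<alpha> = ident G (src \<Lambda> \<alpha>)"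
  using restriction_fold[OF assms(1)] foldl_edge_restriction_ident[of _ \<alpha>] assms(2) by metis

text \<open>A vertex has only the empty factorisation, since an edge would contribute a nonzero
  degree. This supplies the degree 0 case of \<open>lact_bas\<close>.\<close>

lemma restriction_vertex:
  assumes "v \<in> vertices \<Lambda>"
  shows "restriction \<Lambda> G \<Phi> g v = g"
proof -
  obtain es where es: "edge_factorisation \<Lambda> es v"
    and r: "restriction \<Lambda> G \<Phi> g v = foldl (edge_restriction \<Lambda> G \<Phi>) g es"
    using restriction_fold[OF vertexD(1)[OF assms]] by metis
  from es have "es = []"
  proof cases
    case (edge e es' \<mu>)
    hence "deg \<Lambda> v = deg \<Lambda> e + deg \<Lambda> \<mu>" using edge_factorisation_mor edge_mor deg_cmp by simp
    hence "deg \<Lambda> e = 0" using assms by (simp add: vertices_def level_def fun_eq_iff)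
    thus ?thesis using edge edge_deg by simp
  qed
  thus ?thesis using r by simp
qed

text \<open>When the degrees agree, their supremum is \<open>p\<close> again, so \<eta> and \<zeta>
  have degree 0 and unique factorisation applies. The Toeplitz--Cuntz--Krieger relation thereby
  contains the orthogonality of paths of equal degree.\<close>

lemma min_ext_same_level:
  assumes "\<alpha> \<in> level \<Lambda> p" "\<mu> \<in> level \<Lambda> p"
  shows "min_ext \<Lambda> \<alpha> \<mu> = (if \<alpha> = \<mu> then {(src \<Lambda> \<alpha>, src \<Lambda> \<alpha>)} else {})"
proof -
  have "\<alpha> = \<mu> \<and> \<eta> = src \<Lambda> \<alpha> \<and> \<zeta> = src \<Lambda> \<alpha>" if "(\<eta>, \<zeta>) \<in> min_ext \<Lambda> \<alpha> \<mu>" for \<eta> \<zeta>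
  proof -
    have m: "\<eta> \<in> mor \<Lambda>" "\<zeta> \<in> mor \<Lambda>" "src \<Lambda> \<alpha> = rng \<Lambda> \<eta>" "src \<Lambda> \<mu> = rng \<Lambda> \<zeta>"
      "cmp \<Lambda> \<alpha> \<eta> = cmp \<Lambda> \<mu> \<zeta>" "deg \<Lambda> (cmp \<Lambda> \<alpha> \<eta>) = p"
      using that assms by (auto simp: min_ext_def level_def)
    have "p + deg \<Lambda> \<eta> = p" "p + deg \<Lambda> \<zeta> = p" using m assms deg_cmp level_mor level_deg by metis+
    hence v: "\<eta> \<in> vertices \<Lambda>" "\<zeta> \<in> vertices \<Lambda>" using m by (auto simp: vertices_def level_def)
    thus ?thesis
      using factorisation_unique[OF assms(1) v(1)[unfolded vertices_level] m(3) assms(2)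
          v(2)[unfolded vertices_level] m(4,5)] m by (simp add: vertexD)
  qed
  moreover have "(src \<Lambda> \<alpha>, src \<Lambda> \<alpha>) \<in> min_ext \<Lambda> \<alpha> \<alpha>"
    using assms by (auto simp: min_ext_def level_def src_mor rng_src cmp_src)
  ultimately show ?thesis by auto
qed

text \<open>Every path of degree \<open>sup p q\<close> is a minimal common extension of exactly one pair of paths of
  degrees \<open>p\<close> and \<open>q\<close>.\<close>

lemma sum_level_sup:
  fixes f :: "'l \<Rightarrow> 'l \<Rightarrow> 'l \<Rightarrow> 'l \<Rightarrow> 'x::comm_monoid_add"
  assumes c: "\<And>\<alpha> \<eta> \<mu> \<zeta>. \<lbrakk>\<alpha> \<in> level \<Lambda> p; \<eta> \<in> level \<Lambda> (sup p q - p); src \<Lambda> \<alpha> = rng \<Lambda> \<eta>;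
      \<mu> \<in> level \<Lambda> q; \<zeta> \<in> level \<Lambda> (sup p q - q); src \<Lambda> \<mu> = rng \<Lambda> \<zeta>; cmp \<Lambda> \<alpha> \<eta> = cmp \<Lambda> \<mu> \<zeta>\<rbrakk>
    \<Longrightarrow> F (cmp \<Lambda> \<alpha> \<eta>) = f \<alpha> \<eta> \<mu> \<zeta>"
  shows "(\<Sum>\<nu>\<in>level \<Lambda> (sup p q). F \<nu>)
    = (\<Sum>\<alpha>\<in>level \<Lambda> p. \<Sum>\<mu>\<in>level \<Lambda> q. \<Sum>(\<eta>, \<zeta>)\<in>min_ext \<Lambda> \<alpha> \<mu>. f \<alpha> \<eta> \<mu> \<zeta>)"
proof -
  let ?r = "sup p q"
  let ?S = "SIGMA \<alpha>\<mu>:level \<Lambda> p \<times> level \<Lambda> q. min_ext \<Lambda> (fst \<alpha>\<mu>) (snd \<alpha>\<mu>)"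
  have pr: "p + (?r - p) = ?r" and qr: "q + (?r - q) = ?r" by (auto simp: fun_eq_iff sup_nat_def)
  \<comment> \<open>Cancelling \<open>p\<close> and \<open>q\<close> from the degree
    \<open>sup p q\<close> of the common extension fixes the degrees of \<eta> and \<zeta>.\<close>
  have min: "\<eta> \<in> level \<Lambda> (?r - p) \<and> src \<Lambda> \<alpha> = rng \<Lambda> \<eta> \<and> \<zeta> \<in> level \<Lambda> (?r - q) \<and>
      src \<Lambda> \<mu> = rng \<Lambda> \<zeta> \<and> cmp \<Lambda> \<alpha> \<eta> = cmp \<Lambda> \<mu> \<zeta> \<and> cmp \<Lambda> \<alpha> \<eta> \<in> level \<Lambda> ?r"
    if "\<alpha> \<in> level \<Lambda> p" "\<mu> \<in> level \<Lambda> q" "(\<eta>, \<zeta>) \<in> min_ext \<Lambda> \<alpha> \<mu>" for \<alpha> \<mu> \<eta> \<zeta>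
  proof -
    have m: "\<eta> \<in> mor \<Lambda>" "\<zeta> \<in> mor \<Lambda>" "src \<Lambda> \<alpha> = rng \<Lambda> \<eta>" "src \<Lambda> \<mu> = rng \<Lambda> \<zeta>"
      "cmp \<Lambda> \<alpha> \<eta> = cmp \<Lambda> \<mu> \<zeta>" "deg \<Lambda> (cmp \<Lambda> \<alpha> \<eta>) = ?r"
      using that by (auto simp: min_ext_def level_def)
    have "p + deg \<Lambda> \<eta> = ?r" "q + deg \<Lambda> \<zeta> = ?r" using m that deg_cmp level_mor level_deg by metis+
    hence "deg \<Lambda> \<eta> = ?r - p" "deg \<Lambda> \<zeta> = ?r - q" by (metis add_diff_cancel_left')+
    thus ?thesis using m that by (auto simp: level_def cmp_mor)
  qed
  have fin: "finite (min_ext \<Lambda> \<alpha> \<mu>)" if "\<alpha> \<in> level \<Lambda> p" "\<mu> \<in> level \<Lambda> q" for \<alpha> \<mu>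
    by (rule finite_subset[of _ "level \<Lambda> (?r - p) \<times> level \<Lambda> (?r - q)"])
      (use min that finite_level in auto)
  have "(\<Sum>\<alpha>\<in>level \<Lambda> p. \<Sum>\<mu>\<in>level \<Lambda> q. \<Sum>(\<eta>, \<zeta>)\<in>min_ext \<Lambda> \<alpha> \<mu>. f \<alpha> \<eta> \<mu> \<zeta>)
      = (\<Sum>\<alpha>\<mu>\<in>level \<Lambda> p \<times> level \<Lambda> q. \<Sum>\<eta>\<zeta>\<in>min_ext \<Lambda> (fst \<alpha>\<mu>) (snd \<alpha>\<mu>).
          f (fst \<alpha>\<mu>) (fst \<eta>\<zeta>) (snd \<alpha>\<mu>) (snd \<eta>\<zeta>))"
    by (simp add: sum.cartesian_product case_prod_unfold)
  also have "\<dots> = (\<Sum>(\<alpha>\<mu>, \<eta>\<zeta>)\<in>?S. f (fst \<alpha>\<mu>) (fst \<eta>\<zeta>) (snd \<alpha>\<mu>) (snd \<eta>\<zeta>))"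
    by (rule sum.Sigma) (use finite_level fin in auto)
  also have "\<dots> = (\<Sum>x\<in>?S. F (case x of (\<alpha>\<mu>, \<eta>\<zeta>) \<Rightarrow> cmp \<Lambda> (fst \<alpha>\<mu>) (fst \<eta>\<zeta>)))"
  proof (intro sum.cong refl, clarsimp)
    fix \<alpha> \<mu> \<eta> \<zeta>
    assume l: "\<alpha> \<in> level \<Lambda> p" "\<mu> \<in> level \<Lambda> q" "(\<eta>, \<zeta>) \<in> min_ext \<Lambda> \<alpha> \<mu>"
    show "f \<alpha> \<eta> \<mu> \<zeta> = F (cmp \<Lambda> \<alpha> \<eta>)" using c[of \<alpha> \<eta> \<mu> \<zeta>] min[OF l] l by simp
  qed
  also have "\<dots> = (\<Sum>\<nu>\<in>level \<Lambda> ?r. F \<nu>)"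
  proof (rule sum.reindex_bij_betw)
    show "bij_betw (\<lambda>(\<alpha>\<mu>, \<eta>\<zeta>). cmp \<Lambda> (fst \<alpha>\<mu>) (fst \<eta>\<zeta>)) ?S (level \<Lambda> ?r)"
      unfolding bij_betw_def
    proof
      show "inj_on (\<lambda>(\<alpha>\<mu>, \<eta>\<zeta>). cmp \<Lambda> (fst \<alpha>\<mu>) (fst \<eta>\<zeta>)) ?S"
      proof (rule inj_onI, clarsimp)
        fix \<alpha> \<mu> \<eta> \<zeta> \<alpha>' \<mu>' \<eta>' \<zeta>'
        assume l: "\<alpha> \<in> level \<Lambda> p" "\<mu> \<in> level \<Lambda> q" "\<alpha>' \<in> level \<Lambda> p" "\<mu>' \<in> level \<Lambda> q"
          and m: "(\<eta>, \<zeta>) \<in> min_ext \<Lambda> \<alpha> \<mu>" "(\<eta>', \<zeta>') \<in> min_ext \<Lambda> \<alpha>' \<mu>'"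
          and eq: "cmp \<Lambda> \<alpha> \<eta> = cmp \<Lambda> \<alpha>' \<eta>'"
        note M = min[OF l(1,2) m(1)] and M' = min[OF l(3,4) m(2)]
        \<comment> \<open>One and the same path is factored at degree \<open>p\<close> and at degree
          \<open>q\<close>; each factorisation is unique, so all four components are
          determined.\<close>
        show "\<alpha> = \<alpha>' \<and> \<mu> = \<mu>' \<and> \<eta> = \<eta>' \<and> \<zeta> = \<zeta>'"
          using factorisation_unique[of \<alpha> p \<eta> "?r - p" \<alpha>' \<eta>']
            factorisation_unique[of \<mu> q \<zeta> "?r - q" \<mu>' \<zeta>'] l M M' eq by metis
      qed
      show "(\<lambda>(\<alpha>\<mu>, \<eta>\<zeta>). cmp \<Lambda> (fst \<alpha>\<mu>) (fst \<eta>\<zeta>)) ` ?S = level \<Lambda> ?r"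
      proof (intro equalityI subsetI)
        fix \<nu> assume \<nu>: "\<nu> \<in> level \<Lambda> ?r"
        obtain \<alpha> \<eta> where a: "\<alpha> \<in> level \<Lambda> p" "\<eta> \<in> level \<Lambda> (?r - p)" "src \<Lambda> \<alpha> = rng \<Lambda> \<eta>"
          "\<nu> = cmp \<Lambda> \<alpha> \<eta>" using \<nu> factorisation_obtain[of \<nu> p "?r - p"] pr by metis
        obtain \<mu> \<zeta> where b: "\<mu> \<in> level \<Lambda> q" "\<zeta> \<in> level \<Lambda> (?r - q)" "src \<Lambda> \<mu> = rng \<Lambda> \<zeta>"
          "\<nu> = cmp \<Lambda> \<mu> \<zeta>" using \<nu> factorisation_obtain[of \<nu> q "?r - q"] qr by metis
        have "(\<eta>, \<zeta>) \<in> min_ext \<Lambda> \<alpha> \<mu>" using a b \<nu> by (simp add: min_ext_def level_def)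
        hence "((\<alpha>, \<mu>), (\<eta>, \<zeta>)) \<in> ?S" using a b by simp
        thus "\<nu> \<in> (\<lambda>(\<alpha>\<mu>, \<eta>\<zeta>). cmp \<Lambda> (fst \<alpha>\<mu>) (fst \<eta>\<zeta>)) ` ?S"
          by (rule rev_image_eqI) (simp add: a(4))
      qed (use min in fastforce)
    qed
  qed
  finally show ?thesis by simp
qed

end

section \<open>Product systems with finite frames\<close>

lemma scaleC_fun_apply: "(c *\<^sub>C f) x = c *\<^sub>C f x"
  by (simp add: scaleC_fun_def)

section \<open>Inner products and adjointable operators\<close>

context hilbert_module
begin

lemma hcar_closed:
  "0 \<in> hcar X" "x \<in> hcar X \<Longrightarrow> y \<in> hcar X \<Longrightarrow> x + y \<in> hcar X" "x \<in> hcar X \<Longrightarrow> c *\<^sub>C x \<in> hcar X"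
  "(\<And>j. j \<in> J \<Longrightarrow> f j \<in> hcar X) \<Longrightarrow> (\<Sum>j\<in>J. f j) \<in> hcar X"
  "x \<in> hcar X \<Longrightarrow> y \<in> hcar X \<Longrightarrow> x - y \<in> hcar X"
  using subspace
  by (auto simp: complex_vector.subspace_0 complex_vector.subspace_add complex_vector.subspace_scale
      complex_vector.subspace_diff intro: complex_vector.subspace_sum)

lemma inn_add_right: "\<lbrakk>x \<in> hcar X; y \<in> hcar X; z \<in> hcar X\<rbrakk> \<Longrightarrow> inn X x (y + z) = inn X x y + inn X x z"
  using inn_linear clinear_onD(1) by metis

lemma inn_scale_right: "\<lbrakk>x \<in> hcar X; y \<in> hcar X\<rbrakk> \<Longrightarrow> inn X x (c *\<^sub>C y) = c *\<^sub>C inn X x y"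
  using inn_linear clinear_onD(2) by metis

lemma inn_sum_right:
  "x \<in> hcar X \<Longrightarrow> (\<And>j. j \<in> J \<Longrightarrow> f j \<in> hcar X) \<Longrightarrow> inn X x (\<Sum>j\<in>J. f j) = (\<Sum>j\<in>J. inn X x (f j))"
  by (rule clinear_on_sum[OF inn_linear subspace])

lemma inn_add_left: "\<lbrakk>x \<in> hcar X; y \<in> hcar X; z \<in> hcar X\<rbrakk> \<Longrightarrow> inn X (x + y) z = inn X x z + inn X y z"
  using star_inn[of z "x + y"] star_inn[of z x] star_inn[of z y]
  by (simp add: hcar_closed inn_add_right star_add)

lemma inn_scale_left: "\<lbrakk>x \<in> hcar X; y \<in> hcar X\<rbrakk> \<Longrightarrow> inn X (c *\<^sub>C x) y = cnj c *\<^sub>C inn X x y"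
  using star_inn[of y "c *\<^sub>C x"] star_inn[of y x]
  by (simp add: hcar_closed inn_scale_right star_scaleC)

lemma inn_ract_left: "\<lbrakk>x \<in> hcar X; y \<in> hcar X\<rbrakk> \<Longrightarrow> inn X (ract X x a) y = star a * inn X x y"
  using star_inn[of y "ract X x a"] star_inn[of y x]
  by (simp add: ract_closed inn_ract star_mult)

lemma inn_eqI:
  assumes "x \<in> hcar X" "y \<in> hcar X" "\<And>z. z \<in> hcar X \<Longrightarrow> inn X z x = inn X z y"
  shows "x = y"
proof -
  have "inn X (x - y) (x - y) + inn X (x - y) y = inn X (x - y) x"
    using inn_add_right[of "x - y" "x - y" y] assms(1,2) by (simp add: hcar_closed)
  hence "inn X (x - y) (x - y) = 0" using assms by (simp add: hcar_closed)
  thus ?thesis using inn_definite[of "x - y"] assms(1,2) by (simp add: hcar_closed)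
qed

lemma is_adjoint_sym:
  assumes "S ` hcar X \<subseteq> hcar X" "S' ` hcar X \<subseteq> hcar X" "is_adjoint X S S'"
  shows "is_adjoint X S' S"
  unfolding is_adjoint_def
proof (intro ballI)
  fix x y assume x: "x \<in> hcar X" "y \<in> hcar X"
  have "inn X (S' x) y = star (inn X y (S' x))" using x assms(2) by (subst star_inn) auto
  also have "\<dots> = star (inn X (S y) x)" using x assms(3) by (simp add: is_adjoint_def)
  also have "\<dots> = inn X x (S y)" using x assms(1) by (subst star_inn) auto
  finally show "inn X (S' x) y = inn X x (S y)" .
qed

lemma operatorsD:
  assumes "S \<in> operators X"
  shows "x \<in> hcar X \<Longrightarrow> S x \<in> hcar X" "x \<notin> hcar X \<Longrightarrow> S x = 0"
  using assms by (auto simp: operators_def)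

lemma adjointable_closed: "S \<in> adjointable X \<Longrightarrow> x \<in> hcar X \<Longrightarrow> S x \<in> hcar X"
  by (simp add: adjointable_def operatorsD)

lemma adjointable_outside: "S \<in> adjointable X \<Longrightarrow> x \<notin> hcar X \<Longrightarrow> S x = 0"
  by (simp add: adjointable_def operatorsD)

lemma adjointableE:
  assumes "S \<in> adjointable X"
  obtains S' where "S' \<in> adjointable X" "is_adjoint X S S'" "is_adjoint X S' S"
proof -
  obtain S' where S': "S \<in> operators X" "S' \<in> operators X" "is_adjoint X S S'"
    using assms by (auto simp: adjointable_def)
  moreover from this have "is_adjoint X S' S" by (auto simp: operators_def intro!: is_adjoint_sym[of S S'])
  ultimately show ?thesis by (intro that) (auto simp: adjointable_def)
qed

lemma adjointableI:
  assumes "S \<in> operators X" "S' \<in> operators X" "is_adjoint X S S'"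
  shows "S \<in> adjointable X"
  using assms by (auto simp: adjointable_def)

lemma is_adjointD: "is_adjoint X S S' \<Longrightarrow> x \<in> hcar X \<Longrightarrow> y \<in> hcar X \<Longrightarrow> inn X (S x) y = inn X x (S' y)"
  by (simp add: is_adjoint_def)

text \<open>Neither \<open>operators\<close> nor \<open>adjointable\<close> demands any linearity.
  Here and in \<open>adjointable_linear\<close> it follows from the adjoint, which moves the
  operator into the first argument of \<open>inn\<close>.\<close>

lemma adjointable_ract:
  assumes "S \<in> adjointable X" "x \<in> hcar X"
  shows "S (ract X x a) = ract X (S x) a"
proof -
  obtain S' where S': "S' \<in> adjointable X" "is_adjoint X S' S" using assms(1) by (rule adjointableE)
  show ?thesis
    by (rule inn_eqI)
      (use assms adjointable_closed S'(1) in
        \<open>auto simp: ract_closed inn_ract simp flip: is_adjointD[OF S'(2)]\<close>)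
qed

lemma adjointable_linear:
  assumes "S \<in> adjointable X"
  shows "clinear_on (hcar X) S"
proof -
  obtain S' where S': "S' \<in> adjointable X" "is_adjoint X S' S" using assms(1) by (rule adjointableE)
  have adj: "inn X z (S x) = inn X (S' z) x" if "x \<in> hcar X" "z \<in> hcar X" for x z
    using is_adjointD[OF S'(2)] that by simp
  note closed = adjointable_closed[OF assms] adjointable_closed[OF S'(1)] hcar_closed(2,3)
  show ?thesis
    unfolding clinear_on_def
    by (intro conjI ballI allI; rule inn_eqI)
      (simp_all add: closed adj inn_add_right inn_scale_right)
qed

lemma adjointable_sum:
  "S \<in> adjointable X \<Longrightarrow> (\<And>j. j \<in> J \<Longrightarrow> f j \<in> hcar X) \<Longrightarrow> S (\<Sum>j\<in>J. f j) = (\<Sum>j\<in>J. S (f j))"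
  by (rule clinear_on_sum[OF adjointable_linear subspace])

lemma adjointable_zero: "S \<in> adjointable X \<Longrightarrow> S 0 = 0"
  using adjointable_sum[of S "{}"] by simp

lemma Theta_adjoint: "x \<in> hcar X \<Longrightarrow> y \<in> hcar X \<Longrightarrow> is_adjoint X (Theta X x y) (Theta X y x)"
  by (simp add: is_adjoint_def Theta_def inn_ract inn_ract_left star_inn)

lemma Theta_adjointable: "x \<in> hcar X \<Longrightarrow> y \<in> hcar X \<Longrightarrow> Theta X x y \<in> adjointable X"
  using Theta_adjoint[of x y]
  by (rule adjointableI[rotated 2]) (auto simp: operators_def Theta_def ract_closed)

lemma adjointable_add:
  assumes "S \<in> adjointable X" "T \<in> adjointable X"
  shows "S + T \<in> adjointable X"
proof -
  obtain S' T' where *: "S' \<in> adjointable X" "is_adjoint X S S'" "T' \<in> adjointable X" "is_adjoint X T T'"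
    using assms adjointableE by metis
  hence "is_adjoint X (S + T) (S' + T')"
    using assms by (auto simp: is_adjoint_def inn_add_left inn_add_right adjointable_closed)
  moreover have "S + T \<in> operators X" "S' + T' \<in> operators X"
    using assms * by (auto simp: adjointable_def operators_def intro!: hcar_closed)
  ultimately show ?thesis by (intro adjointableI)
qed

lemma adjointable_scale:
  assumes "S \<in> adjointable X"
  shows "c *\<^sub>C S \<in> adjointable X"
proof -
  obtain S' where *: "S' \<in> adjointable X" "is_adjoint X S S'"
    using assms adjointableE by metis
  hence "is_adjoint X (c *\<^sub>C S) (cnj c *\<^sub>C S')"
    using assms
    by (auto simp: is_adjoint_def scaleC_fun_def inn_scale_left inn_scale_right adjointable_closed)
  moreover have "c *\<^sub>C S \<in> operators X" "cnj c *\<^sub>C S' \<in> operators X"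
    using assms * by (auto simp: adjointable_def operators_def scaleC_fun_def intro!: hcar_closed)
  ultimately show ?thesis by (intro adjointableI)
qed

lemma zero_adjointable: "0 \<in> adjointable X"
  using adjointable_scale[OF Theta_adjointable[OF hcar_closed(1) hcar_closed(1)], of 0] by simp

lemma adjointable_comp:
  assumes "S \<in> adjointable X" "T \<in> adjointable X"
  shows "S \<circ> T \<in> adjointable X"
proof -
  obtain S' T' where *: "S' \<in> adjointable X" "is_adjoint X S S'" "T' \<in> adjointable X" "is_adjoint X T T'"
    using assms adjointableE by metis
  hence "is_adjoint X (S \<circ> T) (T' \<circ> S')"
    using assms by (auto simp: is_adjoint_def adjointable_closed)
  \<comment> \<open>Off the module \<open>T\<close> yields 0, so the composite vanishes there
    because \<open>S 0 = 0\<close>.\<close>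
  moreover have "S \<circ> T \<in> operators X" "T' \<circ> S' \<in> operators X"
    using assms *
    by (auto simp: operators_def adjointable_closed adjointable_outside adjointable_zero)
  ultimately show ?thesis by (intro adjointableI)
qed

lemma subspace_adjointable: "complex_vector.subspace (adjointable X)"
  by (rule complex_vector.subspaceI) (auto intro: zero_adjointable adjointable_add adjointable_scale)

end

text \<open>A finite family \<open>e\<close> with $x = \sum_j e_j \langle e_j, x\rangle$ makes every adjointable operator
  finite-rank, $S = \sum_j \Theta_{S e_j, e_j}$, and thus compact.\<close>

locale framed_module = hilbert_module X
  for X :: "('a::cstar_algebra, 'm::complex_vector) hmod" +
  fixes J :: "'i set" and e :: "'i \<Rightarrow> 'm"
  assumes frame_closed: "j \<in> J \<Longrightarrow> e j \<in> hcar X"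
    and frame: "x \<in> hcar X \<Longrightarrow> (\<Sum>j\<in>J. ract X (e j) (inn X (e j) x)) = x"
begin

lemma adjointable_frame:
  assumes "S \<in> adjointable X" "x \<in> hcar X"
  shows "(\<Sum>j\<in>J. ract X (S (e j)) (inn X (e j) x)) = S x"
proof -
  have "S x = S (\<Sum>j\<in>J. ract X (e j) (inn X (e j) x))" using assms by (simp add: frame)
  also have "\<dots> = (\<Sum>j\<in>J. ract X (S (e j)) (inn X (e j) x))"
    using assms by (simp add: adjointable_sum adjointable_ract ract_closed frame_closed)
  finally show ?thesis by simp
qed

lemma adjointable_eq_sum_Theta:
  assumes "S \<in> adjointable X"
  shows "S = (\<Sum>j\<in>J. Theta X (S (e j)) (e j))"
proof
  fix x
  show "S x = (\<Sum>j\<in>J. Theta X (S (e j)) (e j)) x"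
    using assms by (cases "x \<in> hcar X")
      (auto simp: sum_apply Theta_def adjointable_frame adjointable_def operators_def)
qed

text \<open>Being of finite rank, each adjointable operator approximates itself with error
  \<open>mnorm X 0 = 0\<close>.\<close>

lemma compact_ops_eq: "compact_ops X = adjointable X"
proof -
  have "S \<in> finite_rank X" if "S \<in> adjointable X" for S
  proof -
    have "(\<Sum>j\<in>J. Theta X (S (e j)) (e j)) \<in> finite_rank X"
      unfolding finite_rank_def
      by (intro complex_vector.span_sum complex_vector.span_base)
        (use that in \<open>auto intro: adjointable_closed frame_closed\<close>)
    thus ?thesis using adjointable_eq_sum_Theta[OF that] by simp
  qed
  moreover have "mnorm X 0 = 0" using inn_scale_right[of 0 0 0] by (simp add: hcar_closed mnorm_def)
  ultimately show ?thesis
    unfolding compact_ops_def by (force simp: mnorm_def intro!: bexI)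
qed

end

text \<open>\<open>e_mul_frame\<close> asks that products of two frames form a frame. It sharpens
  the approximation in \<open>mul_dense\<close> to a finite expansion, so vectors and adjointable
  operators at \<open>p + q\<close> are determined by products.\<close>

locale framed_product_system = product_system M
  for M :: "('k::finite, 'a::cstar_algebra, 'm::complex_vector) prodsys" +
  fixes J :: "('k \<Rightarrow> nat) \<Rightarrow> 'i set" and e :: "('k \<Rightarrow> nat) \<Rightarrow> 'i \<Rightarrow> 'm"
  assumes e_fibre: "j \<in> J p \<Longrightarrow> e p j \<in> fibre M p"
    and e_frame: "x \<in> fibre M p \<Longrightarrow> (\<Sum>j\<in>J p. ract (fib M p) (e p j) (inn (fib M p) (e p j) x)) = x"
    and e_mul_frame: "z \<in> fibre M (p + q) \<Longrightarrow>
      (\<Sum>j\<in>J p. \<Sum>l\<in>J q. ract (fib M (p + q)) (mul M p q (e p j) (e q l))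
        (inn (fib M (p + q)) (mul M p q (e p j) (e q l)) z)) = z"
begin

sublocale fr: framed_module "fib M p" "J p" "e p" for p
  by (intro framed_module.intro framed_module_axioms.intro hilbert_module_fib e_fibre e_frame)

lemma emb_fibre: "emb M a \<in> fibre M 0"
  using emb_bij by (auto simp: bij_betw_def)

text \<open>Associativity with \<open>emb M a\<close> in the middle: the multiplication is balanced
  over the coefficient algebra.\<close>

lemma mul_ract_left:
  assumes "x \<in> fibre M p" "y \<in> fibre M q"
  shows "mul M p q (ract (fib M p) x a) y = mul M p q x (lact M q a y)"
  using mul_assoc[OF assms(1) emb_fibre[of a] assms(2)] assms
  by (simp add: mul_emb_left mul_emb_right)

lemma mul_ract_right:
  assumes "x \<in> fibre M p" "y \<in> fibre M q"
  shows "mul M p q x (ract (fib M q) y a) = ract (fib M (p + q)) (mul M p q x y) a"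
  using mul_assoc[OF assms emb_fibre[of a]] assms by (simp add: mul_emb_right mul_fibre)

lemma mul_sum_left:
  assumes "\<And>j. j \<in> K \<Longrightarrow> f j \<in> fibre M p" "y \<in> fibre M q"
  shows "mul M p q (\<Sum>j\<in>K. f j) y = (\<Sum>j\<in>K. mul M p q (f j) y)"
  by (rule clinear_on_sum[OF mul_linear_left[OF assms(2)] fr.subspace]) (rule assms(1))

lemma mul_sum_right:
  assumes "x \<in> fibre M p" "\<And>j. j \<in> K \<Longrightarrow> f j \<in> fibre M q"
  shows "mul M p q x (\<Sum>j\<in>K. f j) = (\<Sum>j\<in>K. mul M p q x (f j))"
  by (rule clinear_on_sum[OF mul_linear_right[OF assms(1)] fr.subspace]) (rule assms(2))

lemma lact_fibre: "x \<in> fibre M p \<Longrightarrow> lact M p a x \<in> fibre M p"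
  using fr.adjointable_closed[OF lact_adjointable] .

lemma lact_ract: "x \<in> fibre M p \<Longrightarrow> lact M p a (ract (fib M p) x b) = ract (fib M p) (lact M p a x) b"
  using fr.adjointable_ract[OF lact_adjointable] .

lemma lact_sum: "(\<And>j. j \<in> K \<Longrightarrow> f j \<in> fibre M p) \<Longrightarrow> lact M p a (\<Sum>j\<in>K. f j) = (\<Sum>j\<in>K. lact M p a (f j))"
  using fr.adjointable_sum[OF lact_adjointable] by blast

lemma mul_eqI:
  assumes "z \<in> fibre M (p + q)" "z' \<in> fibre M (p + q)"
    and "\<And>x y. x \<in> fibre M p \<Longrightarrow> y \<in> fibre M q \<Longrightarrow>
      inn (fib M (p + q)) (mul M p q x y) z = inn (fib M (p + q)) (mul M p q x y) z'"
  shows "z = z'"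
proof -
  have "z = (\<Sum>j\<in>J p. \<Sum>l\<in>J q. ract (fib M (p + q)) (mul M p q (e p j) (e q l))
      (inn (fib M (p + q)) (mul M p q (e p j) (e q l)) z'))"
    using e_mul_frame[OF assms(1)] by (simp add: assms(3) e_fibre cong: sum.cong)
  thus ?thesis using e_mul_frame[OF assms(2)] by simp
qed

text \<open>Adjointable operators respect sums and the right action, so \<open>e_mul_frame\<close>
  reduces them to their values on products. This is the uniqueness half of
  \<open>ext_op\<close>.\<close>

lemma adjointable_mul_eqI:
  assumes S: "S \<in> adjointable (fib M (p + q))" and T: "T \<in> adjointable (fib M (p + q))"
    and eq: "\<And>x y. x \<in> fibre M p \<Longrightarrow> y \<in> fibre M q \<Longrightarrow> S (mul M p q x y) = T (mul M p q x y)"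
  shows "S = T"
proof
  fix z
  show "S z = T z"
  proof (cases "z \<in> fibre M (p + q)")
    case True
    have "U z = (\<Sum>j\<in>J p. \<Sum>l\<in>J q. ract (fib M (p + q)) (U (mul M p q (e p j) (e q l)))
        (inn (fib M (p + q)) (mul M p q (e p j) (e q l)) z))"
      if "U \<in> adjointable (fib M (p + q))" for U
    proof -
      have "U z = U (\<Sum>j\<in>J p. \<Sum>l\<in>J q. ract (fib M (p + q)) (mul M p q (e p j) (e q l))
        (inn (fib M (p + q)) (mul M p q (e p j) (e q l)) z))" by (simp add: e_mul_frame True)
      thus ?thesis
        using that by (simp add: fr.adjointable_sum fr.adjointable_ract fr.hcar_closed
            fr.ract_closed mul_fibre e_fibre)
    qed
    from this[OF S] this[OF T] show ?thesis by (simp add: eq e_fibre)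
  next
    case False
    thus ?thesis using S T by (auto simp: adjointable_def operators_def)
  qed
qed

text \<open>These facts unlock the definite description. The equation \<open>p + q = r\<close> gives
  the complementary degree a name in place of \<open>r - p\<close>.\<close>

lemma ext_op:
  assumes S: "S \<in> adjointable (fib M p)" and r: "p + q = r"
  shows ext_op_adjointable: "ext_op M p r S \<in> adjointable (fib M r)"
    and ext_op_mul: "\<lbrakk>x \<in> fibre M p; y \<in> fibre M q\<rbrakk> \<Longrightarrow> ext_op M p r S (mul M p q x y) = mul M p q (S x) y"
    and ext_op_eqI: "\<lbrakk>T \<in> adjointable (fib M r);
      \<And>x y. x \<in> fibre M p \<Longrightarrow> y \<in> fibre M q \<Longrightarrow> T (mul M p q x y) = mul M p q (S x) y\<rbrakk>
      \<Longrightarrow> ext_op M p r S = T"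
proof -
  have q: "r - p = q" using r by auto
  let ?P = "\<lambda>T. T \<in> adjointable (fib M r) \<and>
    (\<forall>x\<in>fibre M p. \<forall>y\<in>fibre M q. T (mul M p q x y) = mul M p q (S x) y)"
  \<comment> \<open>The expansion of an operator into Thetas, applied to S \<otimes> 1 and the
    product frame.\<close>
  define E where "E = (\<Sum>j\<in>J p. \<Sum>l\<in>J q.
    Theta (fib M r) (mul M p q (S (e p j)) (e q l)) (mul M p q (e p j) (e q l)))"
  have Se: "S (e p j) \<in> fibre M p" if "j \<in> J p" for j
    by (rule fr.adjointable_closed[OF S e_fibre[OF that]])
  have "E \<in> adjointable (fib M r)"
    unfolding E_def r[symmetric]
    by (intro complex_vector.subspace_sum[OF fr.subspace_adjointable] fr.Theta_adjointable mul_fibre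
        e_fibre Se)
  moreover have "E (mul M p q x y) = mul M p q (S x) y" if x: "x \<in> fibre M p" and y: "y \<in> fibre M q" for x y
  proof -
    let ?a = "\<lambda>j. inn (fib M p) (e p j) x"
    \<comment> \<open>By \<open>inn_mul\<close> the coefficient of the product of
      \<open>e p j\<close> and \<open>e q l\<close> is a coefficient of
      \<open>lact M q (?a j) y\<close>, so the sum over \<open>l\<close> is the frame expansion of
      that vector.\<close>
    have "E (mul M p q x y) = (\<Sum>j\<in>J p. \<Sum>l\<in>J q. ract (fib M r) (mul M p q (S (e p j)) (e q l))
        (inn (fib M q) (e q l) (lact M q (?a j) y)))"
      using x y by (simp add: E_def sum_apply Theta_def mul_fibre inn_mul e_fibre flip: r)
    also have "\<dots> = (\<Sum>j\<in>J p. mul M p q (S (e p j)) (lact M q (?a j) y))"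
    proof (intro sum.cong refl)
      fix j assume j: "j \<in> J p"
      have "(\<Sum>l\<in>J q. ract (fib M r) (mul M p q (S (e p j)) (e q l))
          (inn (fib M q) (e q l) (lact M q (?a j) y)))
        = (\<Sum>l\<in>J q. mul M p q (S (e p j)) (ract (fib M q) (e q l)
          (inn (fib M q) (e q l) (lact M q (?a j) y))))"
        unfolding r[symmetric] by (intro sum.cong refl mul_ract_right[symmetric] Se j e_fibre)
      also have "\<dots> = mul M p q (S (e p j)) (lact M q (?a j) y)"
        using y by (subst mul_sum_right[symmetric])
          (simp_all add: Se j e_fibre fr.ract_closed lact_fibre e_frame)
      finally show "(\<Sum>l\<in>J q. ract (fib M r) (mul M p q (S (e p j)) (e q l))
          (inn (fib M q) (e q l) (lact M q (?a j) y))) = mul M p q (S (e p j)) (lact M q (?a j) y)" .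
    qed
    \<comment> \<open>Balancing moves the coefficient back to \<open>S (e p j)\<close>, where the
      sum over \<open>j\<close> is the frame expansion of \<open>S x\<close>.\<close>
    also have "\<dots> = (\<Sum>j\<in>J p. mul M p q (ract (fib M p) (S (e p j)) (?a j)) y)"
      by (intro sum.cong refl mul_ract_left[symmetric] Se y)
    also have "\<dots> = mul M p q (\<Sum>j\<in>J p. ract (fib M p) (S (e p j)) (?a j)) y"
      by (rule mul_sum_left[symmetric]) (use Se y fr.ract_closed in auto)
    finally show ?thesis using S x by (simp add: fr.adjointable_frame)
  qed
  ultimately have "?P E" by blast
  moreover have uniq: "T = T'" if "?P T" "?P T'" for T T'
    using that adjointable_mul_eqI[of T p q T'] r by metis
  ultimately have "?P (ext_op M p r S)"
    unfolding ext_op_def q by (intro theI[of ?P E]) auto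
  thus "ext_op M p r S \<in> adjointable (fib M r)"
    and "\<lbrakk>x \<in> fibre M p; y \<in> fibre M q\<rbrakk> \<Longrightarrow> ext_op M p r S (mul M p q x y) = mul M p q (S x) y"
    and "\<lbrakk>T \<in> adjointable (fib M r);
      \<And>x y. x \<in> fibre M p \<Longrightarrow> y \<in> fibre M q \<Longrightarrow> T (mul M p q x y) = mul M p q (S x) y\<rbrakk>
      \<Longrightarrow> ext_op M p r S = T"
    using uniq[of "ext_op M p r S" T] by auto
qed

text \<open>Tested against products, any adjoint of S \<otimes> 1 acts as S' \<otimes> 1, and this
  property characterises \<open>ext_op\<close> of \<open>S'\<close>.\<close>

lemma ext_op_adjoint:
  assumes S: "S \<in> adjointable (fib M p)" "S' \<in> adjointable (fib M p)" "is_adjoint (fib M p) S S'"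
    and r: "p + q = r"
  shows "is_adjoint (fib M r) (ext_op M p r S) (ext_op M p r S')"
proof -
  note E = ext_op_adjointable[OF S(1) r]
  obtain T where T: "T \<in> adjointable (fib M r)" "is_adjoint (fib M r) (ext_op M p r S) T"
    using E by (rule fr.adjointableE)
  have "T (mul M p q x y) = mul M p q (S' x) y" if "x \<in> fibre M p" "y \<in> fibre M q" for x y
  proof (rule mul_eqI)
    show "T (mul M p q x y) \<in> fibre M (p + q)"
      using fr.adjointable_closed[OF T(1)] that mul_fibre r by blast
    show "mul M p q (S' x) y \<in> fibre M (p + q)"
      using fr.adjointable_closed[OF S(2)] that mul_fibre by blast
    fix x' y' assume x': "x' \<in> fibre M p" "y' \<in> fibre M q"
    have "inn (fib M r) (mul M p q x' y') (T (mul M p q x y))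
      = inn (fib M r) (mul M p q (S x') y') (mul M p q x y)"
      using that x' mul_fibre ext_op_mul[OF S(1) r x'] r
      by (subst fr.is_adjointD[OF T(2), symmetric]) auto
    also have "\<dots> = inn (fib M r) (mul M p q x' y') (mul M p q (S' x) y)"
      using that x' fr.adjointable_closed[OF S(1)] fr.adjointable_closed[OF S(2)]
      by (simp add: inn_mul fr.is_adjointD[OF S(3)] flip: r)
    finally show "inn (fib M (p + q)) (mul M p q x' y') (T (mul M p q x y))
      = inn (fib M (p + q)) (mul M p q x' y') (mul M p q (S' x) y)" by (simp add: r)
  qed
  hence "ext_op M p r S' = T" by (intro ext_op_eqI[OF S(2) r T(1)])
  thus ?thesis using T by simp
qed

end

section \<open>The homomorphism on compact operators induced by a Toeplitz representation\<close>

locale toeplitz_representation = framed_product_system M J e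
  for M :: "('k::finite, 'a::cstar_algebra, 'm::complex_vector) prodsys"
    and J :: "('k \<Rightarrow> nat) \<Rightarrow> 'i set" and e +
  fixes \<rho> :: "('k \<Rightarrow> nat) \<Rightarrow> 'm \<Rightarrow> 'b::cstar_algebra"
  assumes toeplitz_rep: "toeplitz_rep M \<rho>"
begin

lemma star_hom: "star_hom (\<lambda>a. \<rho> 0 (emb M a))"
  and linear: "clinear_on (fibre M p) (\<rho> p)"
  and inner: "x \<in> fibre M p \<Longrightarrow> y \<in> fibre M p \<Longrightarrow> star (\<rho> p x) * \<rho> p y = \<rho> 0 (emb M (inn (fib M p) x y))"
  and mult: "x \<in> fibre M p \<Longrightarrow> y \<in> fibre M q \<Longrightarrow> \<rho> (p + q) (mul M p q x y) = \<rho> p x * \<rho> q y"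
  using toeplitz_rep by (auto simp: toeplitz_rep_def)

lemma ract: "x \<in> fibre M p \<Longrightarrow> \<rho> p (ract (fib M p) x a) = \<rho> p x * \<rho> 0 (emb M a)"
  using mult[OF _ emb_fibre, of x p a] by (simp add: mul_emb_right)

lemma lact: "x \<in> fibre M p \<Longrightarrow> \<rho> p (lact M p a x) = \<rho> 0 (emb M a) * \<rho> p x"
  using mult[OF emb_fibre, of x p a] by (simp add: mul_emb_left)

lemma sum: "(\<And>j. j \<in> K \<Longrightarrow> f j \<in> fibre M p) \<Longrightarrow> \<rho> p (\<Sum>j\<in>K. f j) = (\<Sum>j\<in>K. \<rho> p (f j))"
  by (rule clinear_on_sum[OF linear fr.subspace])

lemma frame:
  assumes "x \<in> fibre M p"
  shows "(\<Sum>j\<in>J p. \<rho> p (e p j) * \<rho> 0 (emb M (inn (fib M p) (e p j) x))) = \<rho> p x"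
proof -
  have "\<rho> p x = \<rho> p (\<Sum>j\<in>J p. ract (fib M p) (e p j) (inn (fib M p) (e p j) x))"
    using assms by (simp add: e_frame)
  thus ?thesis by (simp add: sum fr.ract_closed e_fibre ract)
qed

definition compact_rep :: "('k \<Rightarrow> nat) \<Rightarrow> ('m \<Rightarrow> 'm) \<Rightarrow> 'b"
  where "compact_rep p S = (\<Sum>j\<in>J p. \<rho> p (S (e p j)) * star (\<rho> p (e p j)))"

text \<open>The products \<open>star (\<rho> p (e p j)) * \<rho> p x\<close> are the images of the
  coefficients of \<open>x\<close>, so the sum is the frame expansion of \<open>S x\<close>.\<close>

lemma compact_rep_mult:
  assumes S: "S \<in> adjointable (fib M p)" and x: "x \<in> fibre M p"
  shows "compact_rep p S * \<rho> p x = \<rho> p (S x)"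
proof -
  have "compact_rep p S * \<rho> p x
      = (\<Sum>j\<in>J p. \<rho> p (ract (fib M p) (S (e p j)) (inn (fib M p) (e p j) x)))"
    unfolding compact_rep_def sum_distrib_right
    using S x by (intro sum.cong refl)
      (simp add: ract inner mult.assoc e_fibre fr.adjointable_closed)
  also have "\<dots> = \<rho> p (S x)"
    using S x by (subst sum[symmetric])
      (simp_all add: fr.ract_closed fr.adjointable_closed e_fibre fr.adjointable_frame)
  finally show ?thesis .
qed

lemma compact_rep_mult_compact:
  assumes S: "S \<in> adjointable (fib M p)" and T: "T \<in> adjointable (fib M p)"
  shows "compact_rep p (S \<circ> T) = compact_rep p S * compact_rep p T"
  unfolding compact_rep_def[of p T] compact_rep_def[of p "S \<circ> T"] sum_distrib_left
  by (intro sum.cong refl)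
    (simp add: compact_rep_mult[OF S] fr.adjointable_closed[OF T] e_fibre flip: mult.assoc)

text \<open>Taking adjoints moves \<open>S\<close> to the starred factor. Expanding that factor in
  the frame and summing over \<open>j\<close> first reassembles \<open>S' (e p l)\<close> in the
  unstarred one.\<close>

lemma compact_rep_star:
  assumes S: "S \<in> adjointable (fib M p)" "S' \<in> adjointable (fib M p)" "is_adjoint (fib M p) S S'"
  shows "star (compact_rep p S) = compact_rep p S'"
proof -
  have "star (compact_rep p S) = (\<Sum>j\<in>J p. \<rho> p (e p j) * star (\<rho> p (S (e p j))))"
    by (simp add: compact_rep_def star_sum star_mult star_star)
  also have "\<dots> = (\<Sum>j\<in>J p. \<Sum>l\<in>J p. \<rho> p (e p j) * \<rho> 0 (emb M (inn (fib M p) (S (e p j)) (e p l)))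
      * star (\<rho> p (e p l)))"
  proof (intro sum.cong refl)
    fix j assume j: "j \<in> J p"
    have Sj: "S (e p j) \<in> fibre M p" by (rule fr.adjointable_closed[OF S(1) e_fibre[OF j]])
    have "star (\<rho> p (S (e p j)))
      = (\<Sum>l\<in>J p. star (\<rho> 0 (emb M (inn (fib M p) (e p l) (S (e p j))))) * star (\<rho> p (e p l)))"
      using frame[OF Sj] by (metis (no_types, lifting) star_mult star_sum sum.cong)
    also have "\<dots> = (\<Sum>l\<in>J p. \<rho> 0 (emb M (inn (fib M p) (S (e p j)) (e p l))) * star (\<rho> p (e p l)))"
      using star_homD(3)[OF star_hom] fr.star_inn[OF e_fibre Sj]
      by (intro sum.cong refl) (metis (no_types, lifting))
    finally show "\<rho> p (e p j) * star (\<rho> p (S (e p j)))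
      = (\<Sum>l\<in>J p. \<rho> p (e p j) * \<rho> 0 (emb M (inn (fib M p) (S (e p j)) (e p l))) * star (\<rho> p (e p l)))"
      by (simp add: sum_distrib_left mult.assoc)
  qed
  also have "\<dots> = (\<Sum>l\<in>J p. (\<Sum>j\<in>J p. \<rho> p (e p j) * \<rho> 0 (emb M (inn (fib M p) (e p j) (S' (e p l)))))
      * star (\<rho> p (e p l)))"
    unfolding sum_distrib_right
    by (subst sum.swap) (intro sum.cong refl, simp add: fr.is_adjointD[OF S(3)] e_fibre)
  also have "\<dots> = compact_rep p S'"
    using S(2) by (simp add: frame fr.adjointable_closed e_fibre compact_rep_def)
  finally show ?thesis .
qed

lemma compact_rep_right:
  assumes S: "S \<in> adjointable (fib M p)" "S' \<in> adjointable (fib M p)" "is_adjoint (fib M p) S' S"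
  shows "compact_rep p S = (\<Sum>j\<in>J p. \<rho> p (e p j) * star (\<rho> p (S' (e p j))))"
  using compact_rep_star[OF S(2,1,3)] by (simp add: compact_rep_def star_sum star_mult star_star)

text \<open>With the right factor written with its operator in the starred position, the composite
  is a single sum over the frame; this is the shape needed for \<open>sum_level_sup\<close>.\<close>

lemma compact_rep_comp:
  assumes S: "S \<in> adjointable (fib M p)"
    and T: "T \<in> adjointable (fib M p)" "T' \<in> adjointable (fib M p)" "is_adjoint (fib M p) T' T"
  shows "compact_rep p (S \<circ> T) = (\<Sum>j\<in>J p. \<rho> p (S (e p j)) * star (\<rho> p (T' (e p j))))"
proof -
  have "compact_rep p (S \<circ> T) = compact_rep p S * compact_rep p T"
    using S T(1) by (rule compact_rep_mult_compact)
  also have "\<dots> = (\<Sum>j\<in>J p. \<rho> p (S (e p j)) * star (\<rho> p (T' (e p j))))"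
    unfolding compact_rep_right[OF T] sum_distrib_left
    by (intro sum.cong refl) (simp add: compact_rep_mult[OF S] e_fibre flip: mult.assoc)
  finally show ?thesis .
qed

lemma compact_rep_Theta:
  assumes "x \<in> fibre M p" "y \<in> fibre M p"
  shows "compact_rep p (Theta (fib M p) x y) = \<rho> p x * star (\<rho> p y)"
proof -
  have "\<rho> p (Theta (fib M p) x y (e p j)) = \<rho> p x * star (\<rho> 0 (emb M (inn (fib M p) (e p j) y)))"
    if "j \<in> J p" for j
    using assms e_fibre[OF that] star_homD(3)[OF star_hom, of "inn (fib M p) (e p j) y"]
      fr.star_inn[of "e p j" p y]
    by (simp add: Theta_def ract)
  hence "compact_rep p (Theta (fib M p) x y)
    = \<rho> p x * star (\<Sum>j\<in>J p. \<rho> p (e p j) * \<rho> 0 (emb M (inn (fib M p) (e p j) y)))"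
    by (simp add: compact_rep_def star_sum star_mult sum_distrib_left mult.assoc)
  thus ?thesis by (simp add: frame assms)
qed

text \<open>The definite description has the restricted \<open>compact_rep\<close> as a solution,
  and no other: every operator is a finite sum of Thetas, on which the values are
  prescribed.\<close>

lemma rep_compacts_eq:
  assumes "S \<in> adjointable (fib M p)"
  shows "rep_compacts M \<rho> p S = compact_rep p S"
proof -
  let ?X = "fib M p"
  let ?\<pi> = "restrict (compact_rep p) (compact_ops ?X)"
  have "compacts_hom ?X ?\<pi>"
    unfolding compacts_hom_def
  proof (intro conjI ballI impI)
    show "clinear_on (compact_ops ?X) ?\<pi>"
      unfolding clinear_on_def fr.compact_ops_eq
      by (auto simp: fr.adjointable_add fr.adjointable_scale compact_rep_def scaleC_fun_apply
          e_fibre fr.adjointable_closed clinear_onD[OF linear] distrib_right sum.distrib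
          mult_scaleC_left complex_vector.scale_sum_right)
  next
    fix S T assume "S \<in> compact_ops ?X" "T \<in> compact_ops ?X"
    hence S: "S \<in> adjointable ?X" and T: "T \<in> adjointable ?X" by (auto simp: fr.compact_ops_eq)
    thus "?\<pi> (S \<circ> T) = ?\<pi> S * ?\<pi> T"
      by (simp add: fr.compact_ops_eq fr.adjointable_comp compact_rep_mult_compact)
  next
    fix S S' assume "S \<in> compact_ops ?X" "S' \<in> compact_ops ?X" "is_adjoint ?X S S'"
    thus "?\<pi> S' = star (?\<pi> S)" by (simp add: fr.compact_ops_eq compact_rep_star)
  qed
  hence "?\<pi> \<in> extensional (compact_ops ?X) \<and> compacts_hom ?X ?\<pi> \<and>
    (\<forall>x\<in>fibre M p. \<forall>y\<in>fibre M p. ?\<pi> (Theta ?X x y) = \<rho> p x * star (\<rho> p y))"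
    by (simp add: fr.compact_ops_eq fr.Theta_adjointable compact_rep_Theta)
  moreover have "\<pi> = ?\<pi>"
    if "\<pi> \<in> extensional (compact_ops ?X) \<and> compacts_hom ?X \<pi> \<and>
      (\<forall>x\<in>fibre M p. \<forall>y\<in>fibre M p. \<pi> (Theta ?X x y) = \<rho> p x * star (\<rho> p y))" for \<pi>
  proof (rule extensionalityI)
    fix S assume S: "S \<in> compact_ops ?X"
    hence S': "S \<in> adjointable ?X" by (simp add: fr.compact_ops_eq)
    have "\<pi> S = \<pi> (\<Sum>j\<in>J p. Theta ?X (S (e p j)) (e p j))"
      using fr.adjointable_eq_sum_Theta[OF S'] by simp
    also have "\<dots> = (\<Sum>j\<in>J p. \<pi> (Theta ?X (S (e p j)) (e p j)))"
      using that fr.adjointable_closed[OF S'] unfolding compacts_hom_def fr.compact_ops_eq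
      by (intro clinear_on_sum[OF _ fr.subspace_adjointable]) (auto intro: fr.Theta_adjointable e_fibre)
    also have "\<dots> = compact_rep p S"
      using that fr.adjointable_closed[OF S'] by (simp add: e_fibre compact_rep_def)
    finally show "\<pi> S = ?\<pi> S" using S by simp
  qed (use that in auto)
  ultimately have "rep_compacts M \<rho> p = ?\<pi>"
    unfolding rep_compacts_def by (intro the_equality)
  thus ?thesis using assms by (simp add: fr.compact_ops_eq)
qed

end

section \<open>The product system of a self-similar action\<close>

lemma unitary_repD:
  assumes "unitary_rep G U"
  shows "g \<in> arrs G \<Longrightarrow> U g * star (U g) * U g = U g"
    and "orthogonal_projections (objs G) (\<lambda>v. U (ident G v))"
    and "g \<in> arrs G \<Longrightarrow> star (U g) = U (ginv G g)"
    and "g \<in> arrs G \<Longrightarrow> h \<in> arrs G \<Longrightarrow> U g * U h = (if dom G g = cod G h then U (gmul G g h) else 0)"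
  using assms by (auto simp: unitary_rep_def partial_isometry_def)

lemma unitary_rep_star_hom:
  assumes i: "unitary_rep G i" and \<pi>: "star_hom \<pi>"
  shows "unitary_rep G (\<lambda>g. \<pi> (i g))"
proof -
  have "\<pi> 0 = 0" using clinear_on_zero[OF star_homD(1)[OF \<pi>]] by simp
  thus ?thesis
    using i unfolding unitary_rep_def partial_isometry_def orthogonal_projections_def
      is_projection_def
    by (auto simp flip: star_homD(2,3)[OF \<pi>])
qed

context ss_action
begin

text \<open>Composition is a bijection from the composable pairs of degrees \<open>p\<close> and
  \<open>q\<close> onto the paths of degree \<open>p + q\<close>.\<close>

lemma sum_level_add:
  fixes F :: "'l \<Rightarrow> 'x::comm_monoid_add"
  shows "(\<Sum>\<alpha>\<in>level \<Lambda> p. \<Sum>\<mu>\<in>level \<Lambda> q. if src \<Lambda> \<alpha> = rng \<Lambda> \<mu> then F (cmp \<Lambda> \<alpha> \<mu>) else 0)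
    = (\<Sum>\<nu>\<in>level \<Lambda> (p + q). F \<nu>)"
proof -
  let ?S = "{z \<in> level \<Lambda> p \<times> level \<Lambda> q. src \<Lambda> (fst z) = rng \<Lambda> (snd z)}"
  have "bij_betw (\<lambda>z. cmp \<Lambda> (fst z) (snd z)) ?S (level \<Lambda> (p + q))"
    unfolding bij_betw_def
  proof
    show "inj_on (\<lambda>z. cmp \<Lambda> (fst z) (snd z)) ?S"
      by (rule inj_onI, clarsimp) (use factorisation_unique in blast)
    show "(\<lambda>z. cmp \<Lambda> (fst z) (snd z)) ` ?S = level \<Lambda> (p + q)"
    proof (intro equalityI subsetI)
      fix \<nu> assume "\<nu> \<in> level \<Lambda> (p + q)"
      then obtain \<mu> \<nu>' where "\<mu> \<in> level \<Lambda> p" "\<nu>' \<in> level \<Lambda> q" "src \<Lambda> \<mu> = rng \<Lambda> \<nu>'" "\<nu> = cmp \<Lambda> \<mu> \<nu>'"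
        by (rule factorisation_obtain)
      thus "\<nu> \<in> (\<lambda>z. cmp \<Lambda> (fst z) (snd z)) ` ?S" by (intro image_eqI[of _ _ "(\<mu>, \<nu>')"]) auto
    qed (auto intro: cmp_level)
  qed
  hence "(\<Sum>\<nu>\<in>level \<Lambda> (p + q). F \<nu>) = (\<Sum>z\<in>?S. F (cmp \<Lambda> (fst z) (snd z)))"
    by (rule sum.reindex_bij_betw[symmetric])
  also have "\<dots> = (\<Sum>z\<in>level \<Lambda> p \<times> level \<Lambda> q.
      if src \<Lambda> (fst z) = rng \<Lambda> (snd z) then F (cmp \<Lambda> (fst z) (snd z)) else 0)"
    by (rule sum.inter_filter) (simp add: finite_level)
  finally show ?thesis by (simp add: sum.cartesian_product case_prod_unfold)
qed

end

locale ss_system = ss_action \<Lambda> G \<Phi>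
  for \<Lambda> :: "('l, 'k::finite) graph" and G :: "('l, 'g) gpd" and \<Phi> :: "'g \<Rightarrow> 'l pisom" +
  fixes i :: "'g \<Rightarrow> 'a::cstar_algebra" and M :: "('k, 'a, 'a \<times> ('l \<Rightarrow> 'a)) prodsys"
  assumes rep: "unitary_rep G i"
    and gen: "cstar_generated (i ` arrs G) = UNIV"
    and sys: "ss_product_system \<Lambda> G \<Phi> i M"
begin

sublocale product_system M
  using sys by (simp add: ss_product_system_def)

section \<open>The coefficient algebra and its unit\<close>

abbreviation vert :: "'l \<Rightarrow> 'a"
  where "vert v \<equiv> i (ident G v)"

lemma vertex_objs: "v \<in> vertices \<Lambda> \<Longrightarrow> v \<in> objs G"
  by (simp add: action(1))

lemma vert_mult: "v \<in> vertices \<Lambda> \<Longrightarrow> w \<in> vertices \<Lambda> \<Longrightarrow> vert v * vert w = (if v = w then vert v else 0)"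
  using i_mult[OF finite_kgraph action(1) rep] by (simp add: action(1))

lemma star_vert: "v \<in> vertices \<Lambda> \<Longrightarrow> star (vert v) = vert v"
  using i_star[OF finite_kgraph action(1) rep] by (simp add: action(1))

lemma i_vert: "g \<in> arrs G \<Longrightarrow> v \<in> vertices \<Lambda> \<Longrightarrow> i g * vert v = (if dom G g = v then i g else 0)"
  using unitary_repD(4)[OF rep, of g "ident G v"]
  by (auto simp: vertex_objs ident_arrs cod_ident gmul_ident)

lemma vert_i: "g \<in> arrs G \<Longrightarrow> v \<in> vertices \<Lambda> \<Longrightarrow> vert v * i g = (if v = cod G g then i g else 0)"
  using unitary_repD(4)[OF rep, of "ident G v" g]
  by (auto simp: vertex_objs ident_arrs dom_ident ident_gmul)

text \<open>The identity of C^*(G), written as an explicit element because the class of algebras is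
  not unital.\<close>

definition unit :: 'a
  where "unit = (\<Sum>v\<in>vertices \<Lambda>. vert v)"

text \<open>In the products with \<open>i g\<close> only the summand at the codomain or the domain
  of \<open>g\<close> survives; generation extends this to all elements.\<close>

lemma unit_mult: "unit * a = a" "a * unit = a"
proof -
  have g: "unit * i g = i g \<and> i g * unit = i g" if "g \<in> arrs G" for g
    using that dom_objs[OF that] cod_objs[OF that] finite_level
    by (auto simp: unit_def sum_distrib_left sum_distrib_right i_vert vert_i action(1)
        vertices_level)
  from gen have "unit * a = a \<and> a * unit = a"
  proof (induction a rule: cstar_generated_induct)
    case closed
    show ?case by (intro closed_Collect_conj closed_Collect_eq continuous_intros)
  next
    case (gen a)
    then obtain g where "g \<in> arrs G" "a = i g" by auto
    thus ?case using g ginv_arrs by (simp add: unitary_repD(3)[OF rep])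
  next
    case (mult a b)
    thus ?case by (metis mult.assoc)
  qed (auto simp: distrib_left distrib_right mult_scaleC_left mult_scaleC_right)
  thus "unit * a = a" "a * unit = a" by auto
qed

section \<open>The orthonormal basis of the fibres\<close>

lemma emb_eq: "emb M a = (a, 0)"
  using sys by (simp add: ss_product_system_def)

lemma fib_eq: "fib M p = ss_fib \<Lambda> G i p"
  using sys by (simp add: ss_product_system_def)

text \<open>The case distinction follows the separate encoding of the fibre at 0; there the basis
  consists of the vertex projections.\<close>

definition bas :: "('k \<Rightarrow> nat) \<Rightarrow> 'l \<Rightarrow> 'a \<times> ('l \<Rightarrow> 'a)"
  where "bas p \<alpha> = (if p = 0 then emb M (vert \<alpha>) else dtens \<Lambda> G i \<alpha> (vert (src \<Lambda> \<alpha>)))"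

lemma tens_delta: "tens \<Lambda> G i (delta \<beta>) a \<alpha> = (if \<alpha> = \<beta> then vert (src \<Lambda> \<beta>) * a else 0)"
  by (simp add: tens_def delta_def scaleC_one)

lemma bas_fibre:
  assumes "\<alpha> \<in> level \<Lambda> p"
  shows "bas p \<alpha> \<in> fibre M p"
proof (cases "p = 0")
  case False
  have "src \<Lambda> \<alpha> \<in> vertices \<Lambda>" using assms level_mor src_vertex by blast
  thus ?thesis
    using False assms
    by (auto simp: fib_eq ss_fib_def bas_def dtens_def tens_mod_def tens_delta vert_mult
        tens_space_eq[OF finite_kgraph action(1) rep] simp flip: mult.assoc)
qed (simp add: fib_eq ss_fib_def bas_def emb_eq)

lemma ract_bas:
  assumes "\<alpha> \<in> level \<Lambda> p"
  shows "ract (fib M p) (bas p \<alpha>) a = (if p = 0 then emb M (vert \<alpha> * a) else dtens \<Lambda> G i \<alpha> a)"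
proof -
  have "src \<Lambda> \<alpha> \<in> vertices \<Lambda>" using assms level_mor src_vertex by blast
  hence "tens \<Lambda> G i (delta \<alpha>) (vert (src \<Lambda> \<alpha>)) \<beta> * a = tens \<Lambda> G i (delta \<alpha>) a \<beta>" for \<beta>
    by (simp add: tens_delta vert_mult)
  thus ?thesis
    by (simp add: fib_eq ss_fib_def bas_def emb_eq dtens_def tens_mod_def fun_eq_iff)
qed

text \<open>Pairing reads off a coordinate; for \<open>p \<noteq> 0\<close> the projection at the
  source has already been absorbed, by \<open>tens_space_eq\<close>.\<close>

lemma inn_bas:
  assumes "\<alpha> \<in> level \<Lambda> p" "x \<in> fibre M p"
  shows "inn (fib M p) (bas p \<alpha>) x = (if p = 0 then vert \<alpha> * fst x else snd x \<alpha>)"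
proof (cases "p = 0")
  case True
  thus ?thesis using assms
    by (cases x) (auto simp: fib_eq ss_fib_def bas_def emb_eq star_vert vertices_level)
next
  case False
  have v: "src \<Lambda> \<alpha> \<in> vertices \<Lambda>" using assms level_mor src_vertex by blast
  obtain \<xi> where x: "x = (0, \<xi>)" and \<xi>: "vert (src \<Lambda> \<alpha>) * \<xi> \<alpha> = \<xi> \<alpha>"
    using False assms by (auto simp: fib_eq ss_fib_def tens_mod_def
        tens_space_eq[OF finite_kgraph action(1) rep] split: if_splits)
  have "inn (fib M p) (bas p \<alpha>) x
      = (\<Sum>\<beta>\<in>level \<Lambda> p. star (tens \<Lambda> G i (delta \<alpha>) (vert (src \<Lambda> \<alpha>)) \<beta>) * \<xi> \<beta>)"
    using False by (simp add: x fib_eq ss_fib_def bas_def dtens_def tens_mod_def)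
  also have "\<dots> = (\<Sum>\<beta>\<in>level \<Lambda> p. if \<beta> = \<alpha> then \<xi> \<alpha> else 0)"
    by (intro sum.cong refl) (auto simp: tens_delta v vert_mult star_vert star_zero \<xi>)
  also have "\<dots> = \<xi> \<alpha>" using assms(1) finite_level by simp
  finally show ?thesis using False by (simp add: x)
qed

lemma bas_frame:
  assumes "x \<in> fibre M p"
  shows "(\<Sum>\<alpha>\<in>level \<Lambda> p. ract (fib M p) (bas p \<alpha>) (inn (fib M p) (bas p \<alpha>) x)) = x"
proof (cases "p = 0")
  case True
  have "(\<Sum>\<alpha>\<in>level \<Lambda> 0. ract (fib M 0) (bas 0 \<alpha>) (inn (fib M 0) (bas 0 \<alpha>) x))
      = (\<Sum>\<alpha>\<in>vertices \<Lambda>. (vert \<alpha> * fst x, 0))"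
    unfolding vertices_level
    using assms True by (intro sum.cong refl)
      (simp add: ract_bas inn_bas emb_eq vert_mult vertices_level flip: mult.assoc)
  \<comment> \<open>In degree 0 the frame identity says that the vertex projections sum to the
    unit.\<close>
  also have "\<dots> = (unit * fst x, 0)"
    by (simp add: prod_eq_iff fst_sum snd_sum unit_def sum_distrib_right)
  also have "\<dots> = x"
    using assms True by (auto simp: unit_mult fib_eq ss_fib_def)
  finally show ?thesis by (simp add: True)
next
  case False
  obtain \<xi> where x: "x = (0, \<xi>)"
    and \<xi>: "\<And>\<alpha>. if \<alpha> \<in> level \<Lambda> p then vert (src \<Lambda> \<alpha>) * \<xi> \<alpha> = \<xi> \<alpha> else \<xi> \<alpha> = 0"
    using False assms by (auto simp: fib_eq ss_fib_def tens_mod_def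
        tens_space_eq[OF finite_kgraph action(1) rep])
  have "(\<Sum>\<alpha>\<in>level \<Lambda> p. ract (fib M p) (bas p \<alpha>) (inn (fib M p) (bas p \<alpha>) x))
      = (\<Sum>\<alpha>\<in>level \<Lambda> p. (0, tens \<Lambda> G i (delta \<alpha>) (\<xi> \<alpha>)))"
    using assms False by (intro sum.cong refl) (simp add: ract_bas inn_bas x dtens_def)
  also have "\<dots> = (0, \<xi>)"
  proof (simp add: prod_eq_iff fst_sum snd_sum, rule ext)
    fix \<beta>
    have "(\<Sum>\<alpha>\<in>level \<Lambda> p. tens \<Lambda> G i (delta \<alpha>) (\<xi> \<alpha>)) \<beta>
      = (\<Sum>\<alpha>\<in>level \<Lambda> p. if \<alpha> = \<beta> then vert (src \<Lambda> \<beta>) * \<xi> \<beta> else 0)"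
      unfolding sum_apply by (intro sum.cong refl) (auto simp: tens_delta)
    thus "(\<Sum>\<alpha>\<in>level \<Lambda> p. tens \<Lambda> G i (delta \<alpha>) (\<xi> \<alpha>)) \<beta> = \<xi> \<beta>"
      using \<xi>[of \<beta>] finite_level by (auto split: if_splits)
  qed
  finally show ?thesis by (simp add: x)
qed

lemma inn_bas_bas:
  assumes "\<alpha> \<in> level \<Lambda> p" "\<mu> \<in> level \<Lambda> p"
  shows "inn (fib M p) (bas p \<alpha>) (bas p \<mu>) = (if \<alpha> = \<mu> then vert (src \<Lambda> \<alpha>) else 0)"
proof (cases "p = 0")
  case True
  hence "\<alpha> \<in> vertices \<Lambda>" "\<mu> \<in> vertices \<Lambda>" using assms by (auto simp: vertices_level)
  thus ?thesis
    unfolding inn_bas[OF assms(1) bas_fibre[OF assms(2)]]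
    using True by (simp add: bas_def emb_eq vert_mult vertexD)
next
  case False
  have "src \<Lambda> \<alpha> \<in> vertices \<Lambda>" using assms level_mor src_vertex by blast
  thus ?thesis
    unfolding inn_bas[OF assms(1) bas_fibre[OF assms(2)]]
    using False by (auto simp: bas_def dtens_def tens_delta vert_mult)
qed

lemma ract_bas_src:
  assumes "\<alpha> \<in> level \<Lambda> p"
  shows "ract (fib M p) (bas p \<alpha>) (vert (src \<Lambda> \<alpha>)) = bas p \<alpha>"
proof (cases "p = 0")
  case True
  hence "\<alpha> \<in> vertices \<Lambda>" using assms by (auto simp: vertices_level)
  thus ?thesis unfolding ract_bas[OF assms] using True by (simp add: bas_def vert_mult vertexD)
next
  case False
  thus ?thesis unfolding ract_bas[OF assms] by (simp add: bas_def)
qed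

text \<open>One formula for all degrees spares later proofs the case \<open>p = 0\<close>. There it
  expresses that \<open>g\<close> sends its domain to its codomain and restricts to itself.\<close>

lemma lact_bas:
  assumes g: "g \<in> arrs G" and \<alpha>: "\<alpha> \<in> level \<Lambda> p"
  shows "lact M p (i g) (bas p \<alpha>) = (if rng \<Lambda> \<alpha> = dom G g
    then ract (fib M p) (bas p (act \<Phi> g \<alpha>)) (i (restriction \<Lambda> G \<Phi> g \<alpha>)) else 0)"
proof (cases "p = 0")
  case True
  have v: "\<alpha> \<in> vertices \<Lambda>" using \<alpha> True by (simp add: vertices_level)
  have "lact M 0 (i g) (emb M (vert \<alpha>)) = emb M (if dom G g = \<alpha> then i g else 0)"
    by (simp add: emb_lact i_vert[OF g v])
  moreover have "ract (fib M 0) (bas 0 (act \<Phi> g \<alpha>)) (i (restriction \<Lambda> G \<Phi> g \<alpha>)) = emb M (i g)"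
    if "dom G g = \<alpha>"
  proof -
    have "cod G g \<in> vertices \<Lambda>" using cod_objs[OF g] by (simp add: action(1))
    thus ?thesis using that act_vertex[OF g]
      by (simp add: ract_bas restriction_vertex[OF v] vert_i[OF g] flip: vertices_level)
  qed
  moreover have "emb M 0 = 0" by (simp add: emb_eq zero_prod_def)
  ultimately show ?thesis using True v
    by (cases "dom G g = \<alpha>") (auto simp: bas_def vertexD)
next
  case False
  have "lact M p (i g) (bas p \<alpha>) = (if rng \<Lambda> \<alpha> = dom G g
      then dtens \<Lambda> G i (act \<Phi> g \<alpha>) (i (restriction \<Lambda> G \<Phi> g \<alpha>) * vert (src \<Lambda> \<alpha>)) else 0)"
    using sys False g \<alpha> by (simp add: ss_product_system_def bas_def)
  moreover have "i (restriction \<Lambda> G \<Phi> g \<alpha>) * vert (src \<Lambda> \<alpha>) = i (restriction \<Lambda> G \<Phi> g \<alpha>)"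
    "act \<Phi> g \<alpha> \<in> level \<Lambda> p" if "rng \<Lambda> \<alpha> = dom G g"
    using restriction_arr[OF g level_mor[OF \<alpha>] that] act_level(1)[OF g \<alpha> that]
      src_vertex[OF level_mor[OF \<alpha>]] by (simp_all add: i_vert)
  ultimately show ?thesis using False by (simp add: ract_bas)
qed

text \<open>For positive degrees this is the prescribed product with identities in both slots. If
  one degree is 0, the product is a left or right action by a vertex projection.\<close>

lemma mul_bas:
  assumes \<alpha>: "\<alpha> \<in> level \<Lambda> p" and \<mu>: "\<mu> \<in> level \<Lambda> q"
  shows "mul M p q (bas p \<alpha>) (bas q \<mu>) = (if src \<Lambda> \<alpha> = rng \<Lambda> \<mu> then bas (p + q) (cmp \<Lambda> \<alpha> \<mu>) else 0)"
proof -
  have v: "src \<Lambda> \<alpha> \<in> vertices \<Lambda>" "src \<Lambda> \<mu> \<in> vertices \<Lambda>" "rng \<Lambda> \<mu> \<in> vertices \<Lambda>"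
    using \<alpha> \<mu> level_mor src_vertex rng_vertex by blast+
  consider "p = 0" | "p \<noteq> 0" "q = 0" | "p \<noteq> 0" "q \<noteq> 0" by blast
  thus ?thesis
  proof cases
    case 1
    hence \<alpha>v: "\<alpha> \<in> vertices \<Lambda>" using \<alpha> by (simp add: vertices_level)
    have "mul M p q (bas p \<alpha>) (bas q \<mu>) = lact M q (vert \<alpha>) (bas q \<mu>)"
      by (simp add: 1 bas_def[of 0] mul_emb_left bas_fibre[OF \<mu>])
    also have "\<dots> = (if rng \<Lambda> \<mu> = \<alpha> then bas q \<mu> else 0)"
      using \<alpha>v by (simp add: lact_bas[OF _ \<mu>] ident_arrs vertex_objs dom_ident level_mor[OF \<mu>]
          act_ident restriction_ident ract_bas_src[OF \<mu>])
    finally show ?thesis using 1 \<alpha>v level_mor[OF \<mu>] by (auto simp: vertexD cmp_rng)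
  next
    case 2
    hence \<mu>v: "\<mu> \<in> vertices \<Lambda>" using \<mu> by (simp add: vertices_level)
    have "mul M p q (bas p \<alpha>) (bas q \<mu>) = ract (fib M p) (bas p \<alpha>) (vert \<mu>)"
      by (simp add: 2 bas_def[of 0] mul_emb_right bas_fibre[OF \<alpha>])
    also have "\<dots> = (if src \<Lambda> \<alpha> = \<mu> then bas p \<alpha> else 0)"
      unfolding ract_bas[OF \<alpha>] using 2 \<mu>v v
      by (auto simp: bas_def dtens_def tens_delta vert_mult zero_prod_def fun_eq_iff)
    finally show ?thesis using 2 \<mu>v level_mor[OF \<alpha>] by (auto simp: vertexD cmp_src)
  next
    case 3
    have "mul M p q (bas p \<alpha>) (bas q \<mu>) =
        (if rng \<Lambda> \<mu> = dom G (ident G (src \<Lambda> \<alpha>))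
         then dtens \<Lambda> G i (cmp \<Lambda> \<alpha> (act \<Phi> (ident G (src \<Lambda> \<alpha>)) \<mu>))
           (i (gmul G (restriction \<Lambda> G \<Phi> (ident G (src \<Lambda> \<alpha>)) \<mu>) (ident G (src \<Lambda> \<mu>))))
         else 0)"
      using sys 3 \<alpha> \<mu> v
      by (simp add: ss_product_system_def bas_def ident_arrs vertex_objs cod_ident)
    also have "\<dots> = (if src \<Lambda> \<alpha> = rng \<Lambda> \<mu> then dtens \<Lambda> G i (cmp \<Lambda> \<alpha> \<mu>) (vert (src \<Lambda> \<mu>)) else 0)"
      using v level_mor[OF \<mu>] gmul_ident[of "ident G (src \<Lambda> \<mu>)"]
      by (auto simp: dom_ident ident_arrs vertex_objs act_ident restriction_ident)
    finally show ?thesis using 3 level_mor[OF \<alpha>] level_mor[OF \<mu>] by (simp add: bas_def src_cmp)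
  qed
qed

text \<open>The nonzero products of basis vectors run exactly once through the basis at
  \<open>p + q\<close>.\<close>

lemma bas_mul_frame:
  assumes z: "z \<in> fibre M (p + q)"
  shows "(\<Sum>\<alpha>\<in>level \<Lambda> p. \<Sum>\<mu>\<in>level \<Lambda> q. ract (fib M (p + q)) (mul M p q (bas p \<alpha>) (bas q \<mu>))
    (inn (fib M (p + q)) (mul M p q (bas p \<alpha>) (bas q \<mu>)) z)) = z"
proof -
  let ?F = "\<lambda>\<nu>. ract (fib M (p + q)) (bas (p + q) \<nu>) (inn (fib M (p + q)) (bas (p + q) \<nu>) z)"
  interpret h: hilbert_module "fib M (p + q)" by (rule hilbert_module_fib)
  have "ract (fib M (p + q)) 0 a = 0" for a
    using clinear_on_zero[OF h.ract_linear_left] h.hcar_closed by blast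
  hence "(\<Sum>\<alpha>\<in>level \<Lambda> p. \<Sum>\<mu>\<in>level \<Lambda> q. ract (fib M (p + q)) (mul M p q (bas p \<alpha>) (bas q \<mu>))
      (inn (fib M (p + q)) (mul M p q (bas p \<alpha>) (bas q \<mu>)) z))
    = (\<Sum>\<alpha>\<in>level \<Lambda> p. \<Sum>\<mu>\<in>level \<Lambda> q. if src \<Lambda> \<alpha> = rng \<Lambda> \<mu> then ?F (cmp \<Lambda> \<alpha> \<mu>) else 0)"
    by (intro sum.cong refl) (simp add: mul_bas)
  also have "\<dots> = (\<Sum>\<nu>\<in>level \<Lambda> (p + q). ?F \<nu>)" by (rule sum_level_add)
  finally show ?thesis by (simp add: bas_frame z)
qed

sublocale framed_product_system M "level \<Lambda>" bas
  by unfold_locales (auto simp: bas_fibre bas_frame bas_mul_frame)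

lemma ract_unit:
  assumes "x \<in> fibre M p"
  shows "ract (fib M p) x unit = x"
proof (rule fr.inn_eqI)
  fix z assume "z \<in> fibre M p"
  thus "inn (fib M p) z (ract (fib M p) x unit) = inn (fib M p) z x"
    using assms by (simp add: fr.inn_ract unit_mult)
qed (use assms fr.ract_closed in auto)

text \<open>Only the vertex projection at \<open>rng \<Lambda> \<alpha>\<close> acts nontrivially.
  With \<open>lact_unit\<close> and \<open>ract_unit\<close> this makes the sum of the
  \<open>t v\<close> an identity.\<close>

lemma lact_unit_bas:
  assumes \<alpha>: "\<alpha> \<in> level \<Lambda> p"
  shows "lact M p unit (bas p \<alpha>) = bas p \<alpha>"
proof -
  have m: "\<alpha> \<in> mor \<Lambda>" "rng \<Lambda> \<alpha> \<in> vertices \<Lambda>" using \<alpha> level_mor rng_vertex by blast+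
  have "lact M p unit (bas p \<alpha>) = (\<Sum>v\<in>vertices \<Lambda>. lact M p (vert v) (bas p \<alpha>))"
    unfolding unit_def clinear_on_UNIV_sum[OF lact_linear] by (simp add: sum_apply)
  also have "\<dots> = (\<Sum>v\<in>vertices \<Lambda>. if rng \<Lambda> \<alpha> = v then bas p \<alpha> else 0)"
    by (intro sum.cong refl) (simp add: lact_bas[OF _ \<alpha>] ident_arrs vertex_objs dom_ident m
        act_ident restriction_ident ract_bas_src[OF \<alpha>])
  also have "\<dots> = bas p \<alpha>" using m finite_level by (simp add: vertices_level)
  finally show ?thesis .
qed

lemma lact_unit:
  assumes "x \<in> fibre M p"
  shows "lact M p unit x = x"
proof -
  have "lact M p unit x
      = lact M p unit (\<Sum>\<alpha>\<in>level \<Lambda> p. ract (fib M p) (bas p \<alpha>) (inn (fib M p) (bas p \<alpha>) x))"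
    by (simp add: bas_frame assms)
  also have "\<dots> = x"
    by (subst lact_sum)
      (simp_all add: fr.ract_closed bas_fibre lact_ract lact_unit_bas bas_frame assms)
  finally show ?thesis .
qed

lemma ss_u_eq: "ss_u M i \<rho> g = \<rho> 0 (emb M (i g))"
  by (simp add: ss_u_def)

lemma ss_t_eq: "\<alpha> \<in> level \<Lambda> p \<Longrightarrow> ss_t \<Lambda> G M i \<rho> \<alpha> = \<rho> p (bas p \<alpha>)"
  by (auto simp: ss_t_def bas_def level_deg)

end

section \<open>Nica covariance and the Toeplitz--Cuntz--Krieger relation\<close>

locale ss_toeplitz = ss_system \<Lambda> G \<Phi> i M + toeplitz_representation M "level \<Lambda>" bas \<rho>
  for \<Lambda> :: "('l, 'k::finite) graph" and G :: "('l, 'g) gpd" and \<Phi> :: "'g \<Rightarrow> 'l pisom"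
    and i :: "'g \<Rightarrow> 'a::cstar_algebra" and M :: "('k, 'a, 'a \<times> ('l \<Rightarrow> 'a)) prodsys"
    and \<rho> :: "('k \<Rightarrow> nat) \<Rightarrow> 'a \<times> ('l \<Rightarrow> 'a) \<Rightarrow> 'b::cstar_algebra"
begin

abbreviation u :: "'g \<Rightarrow> 'b"
  where "u \<equiv> ss_u M i \<rho>"

abbreviation t :: "'l \<Rightarrow> 'b"
  where "t \<equiv> ss_t \<Lambda> G M i \<rho>"

section \<open>Relations among the images of the basis vectors\<close>

lemma t_mult:
  assumes "\<alpha> \<in> mor \<Lambda>" "\<mu> \<in> mor \<Lambda>" "src \<Lambda> \<alpha> = rng \<Lambda> \<mu>"
  shows "t \<alpha> * t \<mu> = t (cmp \<Lambda> \<alpha> \<mu>)"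
proof -
  have l: "\<alpha> \<in> level \<Lambda> (deg \<Lambda> \<alpha>)" "\<mu> \<in> level \<Lambda> (deg \<Lambda> \<mu>)" using assms by (auto simp: level_def)
  show ?thesis
    using mult[OF bas_fibre[OF l(1)] bas_fibre[OF l(2)]] assms(3)
    by (simp add: mul_bas[OF l] ss_t_eq[OF l(1)] ss_t_eq[OF l(2)] ss_t_eq[OF cmp_level[OF l assms(3)]])
qed

lemma t_vertex: "v \<in> vertices \<Lambda> \<Longrightarrow> t v = u (ident G v)"
  using ss_t_eq[of v 0] by (simp add: vertices_level bas_def ss_u_eq)

lemma star_t_t:
  assumes "\<alpha> \<in> level \<Lambda> p" "\<mu> \<in> level \<Lambda> p"
  shows "star (t \<alpha>) * t \<mu> = (if \<alpha> = \<mu> then t (src \<Lambda> \<alpha>) else 0)"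
  using assms inner[OF bas_fibre bas_fibre, OF assms] clinear_on_zero[OF star_homD(1)[OF star_hom]]
    t_vertex[OF src_vertex[OF level_mor[OF assms(1)]]]
  by (auto simp: ss_t_eq inn_bas_bas ss_u_eq)

lemma t_src: "\<alpha> \<in> mor \<Lambda> \<Longrightarrow> t \<alpha> * t (src \<Lambda> \<alpha>) = t \<alpha>"
  by (simp add: t_mult src_mor rng_src cmp_src)

lemma t_rng: "\<alpha> \<in> mor \<Lambda> \<Longrightarrow> t (rng \<Lambda> \<alpha>) * t \<alpha> = t \<alpha>"
  by (simp add: t_mult rng_mor src_rng cmp_rng)

lemma rep_compacts_mult_sum:
  assumes S: "S \<in> adjointable (fib M p)"
    and T: "T \<in> adjointable (fib M q)" "T' \<in> adjointable (fib M q)" "is_adjoint (fib M q) T' T"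
  shows "rep_compacts M \<rho> p S * rep_compacts M \<rho> q T = (\<Sum>\<alpha>\<in>level \<Lambda> p. \<Sum>\<mu>\<in>level \<Lambda> q.
    \<rho> p (S (bas p \<alpha>)) * (star (t \<alpha>) * t \<mu>) * star (\<rho> q (T' (bas q \<mu>))))"
  unfolding rep_compacts_eq[OF S] rep_compacts_eq[OF T(1)] compact_rep_right[OF T]
    compact_rep_def[of p S] sum_product
  by (intro sum.cong refl) (simp add: ss_t_eq mult.assoc)

lemma rep_compacts_ext_op_sum:
  assumes S: "S \<in> adjointable (fib M p)"
    and T: "T \<in> adjointable (fib M q)" "T' \<in> adjointable (fib M q)" "is_adjoint (fib M q) T' T"
  shows "rep_compacts M \<rho> (sup p q) (ext_op M p (sup p q) S \<circ> ext_op M q (sup p q) T)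
    = (\<Sum>\<alpha>\<in>level \<Lambda> p. \<Sum>\<mu>\<in>level \<Lambda> q. \<rho> p (S (bas p \<alpha>)) *
        (\<Sum>(\<eta>, \<zeta>)\<in>min_ext \<Lambda> \<alpha> \<mu>. t \<eta> * star (t \<zeta>)) * star (\<rho> q (T' (bas q \<mu>))))"
proof -
  let ?r = "sup p q"
  have p: "p + (?r - p) = ?r" and q: "q + (?r - q) = ?r" by (auto simp: fun_eq_iff sup_nat_def)
  note adj = ext_op_adjointable[OF S p] ext_op_adjointable[OF T(1) q] ext_op_adjointable[OF T(2) q]
    ext_op_adjoint[OF T(2,1,3) q]
  have "rep_compacts M \<rho> ?r (ext_op M p ?r S \<circ> ext_op M q ?r T)
      = (\<Sum>\<nu>\<in>level \<Lambda> ?r. \<rho> ?r (ext_op M p ?r S (bas ?r \<nu>)) *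
          star (\<rho> ?r (ext_op M q ?r T' (bas ?r \<nu>))))"
    using adj by (simp add: rep_compacts_eq fr.adjointable_comp compact_rep_comp)
  also have "\<dots> = (\<Sum>\<alpha>\<in>level \<Lambda> p. \<Sum>\<mu>\<in>level \<Lambda> q. \<Sum>(\<eta>, \<zeta>)\<in>min_ext \<Lambda> \<alpha> \<mu>.
      \<rho> p (S (bas p \<alpha>)) * (t \<eta> * star (t \<zeta>)) * star (\<rho> q (T' (bas q \<mu>))))"
  \<comment> \<open>A path of degree \<open>?r\<close> is cut at degree \<open>p\<close> for S
    \<otimes> 1 and at degree \<open>q\<close> for T' \<otimes> 1; the remaining tails contribute
    \<open>t \<eta>\<close> and \<open>star (t \<zeta>)\<close>.\<close>
  proof (rule sum_level_sup)
    fix \<alpha> \<eta> \<mu> \<zeta>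
    assume a: "\<alpha> \<in> level \<Lambda> p" "\<eta> \<in> level \<Lambda> (?r - p)" "src \<Lambda> \<alpha> = rng \<Lambda> \<eta>"
      and m: "\<mu> \<in> level \<Lambda> q" "\<zeta> \<in> level \<Lambda> (?r - q)" "src \<Lambda> \<mu> = rng \<Lambda> \<zeta>"
      and eq: "cmp \<Lambda> \<alpha> \<eta> = cmp \<Lambda> \<mu> \<zeta>"
    have "bas ?r (cmp \<Lambda> \<alpha> \<eta>) = mul M p (?r - p) (bas p \<alpha>) (bas (?r - p) \<eta>)"
      using a mul_bas[OF a(1,2)] p by simp
    hence "ext_op M p ?r S (bas ?r (cmp \<Lambda> \<alpha> \<eta>)) = mul M p (?r - p) (S (bas p \<alpha>)) (bas (?r - p) \<eta>)"
      using ext_op_mul[OF S p bas_fibre[OF a(1)] bas_fibre[OF a(2)]] by simp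
    hence 1: "\<rho> ?r (ext_op M p ?r S (bas ?r (cmp \<Lambda> \<alpha> \<eta>))) = \<rho> p (S (bas p \<alpha>)) * t \<eta>"
      using mult[OF fr.adjointable_closed[OF S bas_fibre[OF a(1)]] bas_fibre[OF a(2)]] p
      by (simp add: ss_t_eq[OF a(2)])
    have "bas ?r (cmp \<Lambda> \<alpha> \<eta>) = mul M q (?r - q) (bas q \<mu>) (bas (?r - q) \<zeta>)"
      using m mul_bas[OF m(1,2)] q eq by simp
    hence "ext_op M q ?r T' (bas ?r (cmp \<Lambda> \<alpha> \<eta>)) = mul M q (?r - q) (T' (bas q \<mu>)) (bas (?r - q) \<zeta>)"
      using ext_op_mul[OF T(2) q bas_fibre[OF m(1)] bas_fibre[OF m(2)]] by simp
    hence 2: "\<rho> ?r (ext_op M q ?r T' (bas ?r (cmp \<Lambda> \<alpha> \<eta>))) = \<rho> q (T' (bas q \<mu>)) * t \<zeta>"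
      using mult[OF fr.adjointable_closed[OF T(2) bas_fibre[OF m(1)]] bas_fibre[OF m(2)]] q
      by (simp add: ss_t_eq[OF m(2)])
    show "\<rho> ?r (ext_op M p ?r S (bas ?r (cmp \<Lambda> \<alpha> \<eta>))) *
        star (\<rho> ?r (ext_op M q ?r T' (bas ?r (cmp \<Lambda> \<alpha> \<eta>))))
      = \<rho> p (S (bas p \<alpha>)) * (t \<eta> * star (t \<zeta>)) * star (\<rho> q (T' (bas q \<mu>)))"
      by (simp add: 1 2 star_mult mult.assoc)
  qed
  finally show ?thesis
    by (simp add: sum_distrib_left sum_distrib_right case_prod_unfold)
qed

lemma nica_covariantI:
  assumes "\<And>\<alpha> \<mu>. \<lbrakk>\<alpha> \<in> mor \<Lambda>; \<mu> \<in> mor \<Lambda>\<rbrakk>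
    \<Longrightarrow> star (t \<alpha>) * t \<mu> = (\<Sum>(\<eta>, \<zeta>)\<in>min_ext \<Lambda> \<alpha> \<mu>. t \<eta> * star (t \<zeta>))"
  shows "nica_covariant M \<rho>"
  unfolding nica_covariant_def fr.compact_ops_eq
proof (intro conjI allI ballI toeplitz_rep)
  fix p q S T assume S: "S \<in> adjointable (fib M p)" and T: "T \<in> adjointable (fib M q)"
  obtain T' where T': "T' \<in> adjointable (fib M q)" "is_adjoint (fib M q) T' T"
    using T by (rule fr.adjointableE)
  show "rep_compacts M \<rho> p S * rep_compacts M \<rho> q T
    = rep_compacts M \<rho> (sup p q) (ext_op M p (sup p q) S \<circ> ext_op M q (sup p q) T)"
    unfolding rep_compacts_mult_sum[OF S T T'] rep_compacts_ext_op_sum[OF S T T']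
    by (intro sum.cong refl) (simp add: assms level_mor)
qed

text \<open>Nica covariance for the rank-one projections onto \<open>bas p \<alpha>\<close> and \<open>bas q \<mu>\<close>, compressed by
  \<open>t \<alpha>\<close> and \<open>t \<mu>\<close>.\<close>

lemma nica_covariantD:
  assumes nica: "nica_covariant M \<rho>" and \<alpha>: "\<alpha> \<in> level \<Lambda> p" and \<mu>: "\<mu> \<in> level \<Lambda> q"
  shows "star (t \<alpha>) * t \<mu> = (\<Sum>(\<eta>, \<zeta>)\<in>min_ext \<Lambda> \<alpha> \<mu>. t \<eta> * star (t \<zeta>))"
proof -
  let ?Q = "\<lambda>p \<alpha>. Theta (fib M p) (bas p \<alpha>) (bas p \<alpha>)"
  let ?m = "\<Sum>(\<eta>, \<zeta>)\<in>min_ext \<Lambda> \<alpha> \<mu>. t \<eta> * star (t \<zeta>)"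
  have Q: "?Q p \<alpha> \<in> adjointable (fib M p)" "is_adjoint (fib M p) (?Q p \<alpha>) (?Q p \<alpha>)"
    if "\<alpha> \<in> level \<Lambda> p" for p \<alpha>
    using bas_fibre[OF that] by (simp_all add: fr.Theta_adjointable fr.Theta_adjoint)
  have \<rho>Q: "\<rho> p (?Q p \<alpha> (bas p \<beta>)) = (if \<beta> = \<alpha> then t \<alpha> else 0)"
    if "\<alpha> \<in> level \<Lambda> p" "\<beta> \<in> level \<Lambda> p" for p \<alpha> \<beta>
  proof -
    have "\<rho> 0 (emb M 0) = 0" using clinear_on_zero[OF star_homD(1)[OF star_hom]] by simp
    thus ?thesis
      using that ract[OF bas_fibre[OF that(1)], of 0]
      by (auto simp: Theta_def bas_fibre inn_bas_bas ract_bas_src ss_t_eq)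
  qed
  \<comment> \<open>Each rank-one projection annihilates all basis vectors but one. Leaving
    \<open>F\<close> arbitrary treats both sides of Nica covariance at once.\<close>
  have collapse: "(\<Sum>\<beta>\<in>level \<Lambda> p. \<Sum>\<gamma>\<in>level \<Lambda> q.
      \<rho> p (?Q p \<alpha> (bas p \<beta>)) * F \<beta> \<gamma> * star (\<rho> q (?Q q \<mu> (bas q \<gamma>)))) = t \<alpha> * F \<alpha> \<mu> * star (t \<mu>)"
    for F :: "'l \<Rightarrow> 'l \<Rightarrow> 'b"
  proof -
    have "(\<Sum>\<beta>\<in>level \<Lambda> p. \<Sum>\<gamma>\<in>level \<Lambda> q.
        \<rho> p (?Q p \<alpha> (bas p \<beta>)) * F \<beta> \<gamma> * star (\<rho> q (?Q q \<mu> (bas q \<gamma>))))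
      = (\<Sum>\<beta>\<in>level \<Lambda> p. if \<beta> = \<alpha>
          then (\<Sum>\<gamma>\<in>level \<Lambda> q. if \<gamma> = \<mu> then t \<alpha> * F \<alpha> \<mu> * star (t \<mu>) else 0) else 0)"
      by (intro sum.cong refl) (auto simp: \<rho>Q \<alpha> \<mu> star_zero intro!: sum.cong)
    thus ?thesis using \<alpha> \<mu> finite_level by simp
  qed
  have "rep_compacts M \<rho> p (?Q p \<alpha>) * rep_compacts M \<rho> q (?Q q \<mu>)
    = rep_compacts M \<rho> (sup p q) (ext_op M p (sup p q) (?Q p \<alpha>) \<circ> ext_op M q (sup p q) (?Q q \<mu>))"
    using nica Q(1) \<alpha> \<mu> by (simp add: nica_covariant_def fr.compact_ops_eq)
  hence mid: "t \<alpha> * (star (t \<alpha>) * t \<mu>) * star (t \<mu>) = t \<alpha> * ?m * star (t \<mu>)"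
    unfolding rep_compacts_mult_sum[OF Q(1)[OF \<alpha>] Q(1)[OF \<mu>] Q[OF \<mu>]]
      rep_compacts_ext_op_sum[OF Q(1)[OF \<alpha>] Q(1)[OF \<mu>] Q[OF \<mu>]] collapse .
  have eq: "(star (t \<alpha>) * t \<alpha>) * (star (t \<alpha>) * t \<mu>) * (star (t \<mu>) * t \<mu>)
      = (star (t \<alpha>) * t \<alpha>) * ?m * (star (t \<mu>) * t \<mu>)"
    using arg_cong[OF mid, of "\<lambda>x. star (t \<alpha>) * x * t \<mu>"] by (simp only: mult.assoc)
  have m: "\<alpha> \<in> mor \<Lambda>" "\<mu> \<in> mor \<Lambda>" using \<alpha> \<mu> level_mor by auto
  have sa: "star (t v) = t v" if "v \<in> vertices \<Lambda>" for v
    using that star_homD(3)[OF star_hom] star_vert by (metis t_vertex ss_u_eq)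
  have left: "t (rng \<Lambda> \<beta>) * (t \<beta> * x) = t \<beta> * x" if "\<beta> \<in> mor \<Lambda>" for \<beta> x
    by (simp add: t_rng that flip: mult.assoc)
  have src_star: "t (src \<Lambda> \<beta>) * star (t \<beta>) = star (t \<beta>)" if "\<beta> \<in> mor \<Lambda>" for \<beta>
    using t_src[OF that] sa[OF src_vertex[OF that]] by (metis star_mult)
  have rng_star: "star (t \<beta>) * t (rng \<Lambda> \<beta>) = star (t \<beta>)" if "\<beta> \<in> mor \<Lambda>" for \<beta>
    using t_rng[OF that] sa[OF rng_vertex[OF that]] by (metis star_mult)
  \<comment> \<open>The compression leaves the source projections of \<alpha> and \<mu> on the
    outside. Both sides absorb them; in the sum this holds because
    \<open>src \<Lambda> \<alpha> = rng \<Lambda> \<eta>\<close> and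
    \<open>src \<Lambda> \<mu> = rng \<Lambda> \<zeta>\<close>.\<close>
  have "t (src \<Lambda> \<alpha>) * (star (t \<alpha>) * t \<mu>) * t (src \<Lambda> \<mu>)
      = (t (src \<Lambda> \<alpha>) * star (t \<alpha>)) * (t \<mu> * t (src \<Lambda> \<mu>))" by (simp only: mult.assoc)
  hence "t (src \<Lambda> \<alpha>) * (star (t \<alpha>) * t \<mu>) * t (src \<Lambda> \<mu>) = star (t \<alpha>) * t \<mu>"
    by (simp add: src_star[OF m(1)] t_src[OF m(2)])
  moreover have "t (src \<Lambda> \<alpha>) * ?m * t (src \<Lambda> \<mu>) = ?m"
    unfolding sum_distrib_left sum_distrib_right
    by (intro sum.cong refl)
      (auto simp: min_ext_def mult.assoc rng_star left)
  ultimately show ?thesis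
    using eq by (simp add: star_t_t[OF \<alpha> \<alpha>] star_t_t[OF \<mu> \<mu>])
qed

text \<open>Generation enters through the identity: the sum of the \<open>t v\<close> fixes every
  \<open>\<rho> p x\<close> on both sides, and the elements fixed in this way form a
  C^*-subalgebra.\<close>

lemma toeplitz_familyI:
  assumes nica: "nica_covariant M \<rho>" and gen: "cstar_generated (\<Union>p. \<rho> p ` fibre M p) = UNIV"
  shows "toeplitz_family \<Lambda> G \<Phi> u t"
proof -
  have u: "unitary_rep G u"
    using unitary_rep_star_hom[OF rep star_hom] by (simp add: ss_u_def[abs_def])
  have "tck_family \<Lambda> t"
    unfolding tck_family_def
  proof (intro conjI ballI impI)
    fix \<alpha> assume \<alpha>: "\<alpha> \<in> mor \<Lambda>"
    hence "\<alpha> \<in> level \<Lambda> (deg \<Lambda> \<alpha>)" by (simp add: level_def)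
    thus "partial_isometry (t \<alpha>)"
      using \<alpha> by (simp add: partial_isometry_def mult.assoc star_t_t t_src)
  next
    show "orthogonal_projections (vertices \<Lambda>) t"
      using unitary_repD(2)[OF u] by (simp add: orthogonal_projections_def t_vertex action(1))
  next
    fix \<alpha> \<mu> assume "\<alpha> \<in> mor \<Lambda>" "\<mu> \<in> mor \<Lambda>"
    hence "\<alpha> \<in> level \<Lambda> (deg \<Lambda> \<alpha>)" "\<mu> \<in> level \<Lambda> (deg \<Lambda> \<mu>)" by (auto simp: level_def)
    thus "star (t \<alpha>) * t \<mu> = (\<Sum>(\<eta>, \<zeta>)\<in>min_ext \<Lambda> \<alpha> \<mu>. t \<eta> * star (t \<zeta>))"
      by (rule nica_covariantD[OF nica])
  qed (rule t_mult)
  moreover have "(\<Sum>v\<in>vertices \<Lambda>. t v) * b = b \<and> b * (\<Sum>v\<in>vertices \<Lambda>. t v) = b" for b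
  proof -
    define e where "e = \<rho> 0 (emb M unit)"
    have sum: "(\<Sum>v\<in>vertices \<Lambda>. t v) = e"
      unfolding e_def unit_def clinear_on_UNIV_sum[OF star_homD(1)[OF star_hom]]
      by (simp add: t_vertex ss_u_eq)
    have "star unit = unit" using unit_mult star_mult star_star by metis
    hence e: "star e = e" using star_homD(3)[OF star_hom, of unit] by (simp add: e_def)
    have "cstar_subalgebra {b. e * b = b \<and> b * e = b}"
      unfolding cstar_subalgebra_def complex_vector.subspace_def
    proof (intro conjI ballI allI)
      show "closed {b. e * b = b \<and> b * e = b}"
        by (intro closed_Collect_conj closed_Collect_eq continuous_intros)
      show "star b \<in> {b. e * b = b \<and> b * e = b}" if "b \<in> {b. e * b = b \<and> b * e = b}" for b
        using that e star_mult by (metis (mono_tags, lifting) mem_Collect_eq)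
    qed (auto simp: distrib_left distrib_right mult_scaleC_left mult_scaleC_right mult.assoc[symmetric],
        metis mult.assoc)
    moreover have "(\<Union>p. \<rho> p ` fibre M p) \<subseteq> {b. e * b = b \<and> b * e = b}"
    proof clarify
      fix p a \<xi> assume "(a, \<xi>) \<in> fibre M p"
      from lact[OF this, of unit] ract[OF this, of unit] lact_unit[OF this] ract_unit[OF this]
      show "e * \<rho> p (a, \<xi>) = \<rho> p (a, \<xi>) \<and> \<rho> p (a, \<xi>) * e = \<rho> p (a, \<xi>)" by (simp add: e_def)
    qed
    ultimately have "{b. e * b = b \<and> b * e = b} = UNIV" by (rule cstar_subset_eq_UNIV[OF gen])
    thus ?thesis unfolding sum by blast
  qed
  moreover have "u g * t \<alpha> =
      (if dom G g = rng \<Lambda> \<alpha> then t (act \<Phi> g \<alpha>) * u (restriction \<Lambda> G \<Phi> g \<alpha>) else 0)"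
    if g: "g \<in> arrs G" and "\<alpha> \<in> mor \<Lambda>" for g \<alpha>
  proof -
    define p where "p = deg \<Lambda> \<alpha>"
    have \<alpha>: "\<alpha> \<in> level \<Lambda> p" using that by (simp add: level_def p_def)
    have "\<rho> p 0 = 0" using clinear_on_zero[OF linear] fr.hcar_closed by blast
    hence "u g * t \<alpha> = (if dom G g = rng \<Lambda> \<alpha>
        then \<rho> p (ract (fib M p) (bas p (act \<Phi> g \<alpha>)) (i (restriction \<Lambda> G \<Phi> g \<alpha>))) else 0)"
      using lact[OF bas_fibre[OF \<alpha>], of "i g"] lact_bas[OF g \<alpha>] by (auto simp: ss_u_eq ss_t_eq[OF \<alpha>])
    thus ?thesis
      using act_level(1)[OF g \<alpha>] by (auto simp: ract bas_fibre ss_t_eq ss_u_eq)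
  qed
  ultimately show ?thesis using u by (simp add: toeplitz_family_def t_vertex)
qed

text \<open>Continuity of the degree 0 part puts the image of all of C^*(G) into any C^*-subalgebra
  containing the \<open>u g\<close>; the frame expansion then brings in the other fibres.\<close>

lemma generated_ut:
  assumes gen_\<rho>: "cstar_generated (\<Union>p. \<rho> p ` fibre M p) = UNIV"
  shows "cstar_generated (u ` arrs G \<union> t ` mor \<Lambda>) = UNIV"
proof -
  have "C = UNIV" if C: "cstar_subalgebra C" and ut: "u ` arrs G \<union> t ` mor \<Lambda> \<subseteq> C" for C
  proof -
    have C_mult: "a * b \<in> C" if "a \<in> C" "b \<in> C" for a b
      using C that by (auto simp: cstar_subalgebra_def)
    let ?\<pi> = "\<lambda>a. \<rho> 0 (emb M a)"
    note \<pi> = star_homD[OF star_hom]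
    have C_i: "?\<pi> (i g) \<in> C" if "g \<in> arrs G" for g
      using ut that by (simp add: image_subset_iff ss_u_eq)
    have A: "?\<pi> a \<in> C" for a
      using gen
    proof (induction a rule: cstar_generated_induct[where P = "\<lambda>a. ?\<pi> a \<in> C"])
      case (gen a)
      then obtain g where "g \<in> arrs G" "a = i g" by auto
      thus ?case
        by (simp add: C_i ginv_arrs unitary_repD(3)[OF rep])
    next
      case closed
      have "continuous_on UNIV ?\<pi>"
        by (rule linear_continuous_on[OF star_hom_bounded[OF star_hom]]) (rule unit_mult)+
      moreover have "closed C" using C by (simp add: cstar_subalgebra_def)
      ultimately show ?case using closed_vimage[of C ?\<pi>] by (simp add: vimage_def)
    next
      case zero
      show ?case using C clinear_on_zero[OF \<pi>(1)]
        by (simp add: cstar_subalgebra_def complex_vector.subspace_def)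
    next
      case (add a b)
      thus ?case using C clinear_onD(1)[OF \<pi>(1)]
        by (simp add: cstar_subalgebra_def complex_vector.subspace_def)
    next
      case (scale c a)
      thus ?case using cstar_subalgebra_scaleC[OF C] clinear_onD(2)[OF \<pi>(1)] by simp
    next
      case (mult a b)
      thus ?case by (simp add: \<pi>(2) C_mult)
    qed
    have "\<rho> p x \<in> C" if "x \<in> fibre M p" for p x
    proof -
      have "t \<alpha> \<in> C" if "\<alpha> \<in> level \<Lambda> p" for \<alpha> using ut level_mor[OF that] by blast
      hence "(\<Sum>\<alpha>\<in>level \<Lambda> p. \<rho> p (bas p \<alpha>) * ?\<pi> (inn (fib M p) (bas p \<alpha>) x)) \<in> C"
        by (intro cstar_subalgebra_sum[OF C] C_mult A) (simp flip: ss_t_eq)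
      thus ?thesis by (simp add: frame[OF that])
    qed
    thus ?thesis by (intro cstar_subset_eq_UNIV[OF gen_\<rho> C]) auto
  qed
  thus ?thesis by (auto simp: cstar_generated_def)
qed

end

section \<open>The representation given by a Toeplitz family\<close>

locale ss_family = ss_system \<Lambda> G \<Phi> i M
  for \<Lambda> :: "('l, 'k::finite) graph" and G :: "('l, 'g) gpd" and \<Phi> :: "'g \<Rightarrow> 'l pisom"
    and i :: "'g \<Rightarrow> 'a::cstar_algebra" and M :: "('k, 'a, 'a \<times> ('l \<Rightarrow> 'a)) prodsys" +
  fixes U :: "'g \<Rightarrow> 'b::cstar_algebra" and T :: "'l \<Rightarrow> 'b" and \<pi> :: "'a \<Rightarrow> 'b"
  assumes family: "toeplitz_family \<Lambda> G \<Phi> U T"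
    and hom: "star_hom \<pi>" and hom_i: "\<And>g. g \<in> arrs G \<Longrightarrow> \<pi> (i g) = U g"
begin

lemma tck:
  "\<alpha> \<in> mor \<Lambda> \<Longrightarrow> \<mu> \<in> mor \<Lambda> \<Longrightarrow> src \<Lambda> \<alpha> = rng \<Lambda> \<mu> \<Longrightarrow> T \<alpha> * T \<mu> = T (cmp \<Lambda> \<alpha> \<mu>)"
  "\<alpha> \<in> mor \<Lambda> \<Longrightarrow> \<mu> \<in> mor \<Lambda> \<Longrightarrow> star (T \<alpha>) * T \<mu> = (\<Sum>(\<eta>, \<zeta>)\<in>min_ext \<Lambda> \<alpha> \<mu>. T \<eta> * star (T \<zeta>))"
  "(\<Sum>v\<in>vertices \<Lambda>. T v) * b = b"
  "g \<in> arrs G \<Longrightarrow> \<alpha> \<in> mor \<Lambda> \<Longrightarrow>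
    U g * T \<alpha> = (if dom G g = rng \<Lambda> \<alpha> then T (act \<Phi> g \<alpha>) * U (restriction \<Lambda> G \<Phi> g \<alpha>) else 0)"
  "orthogonal_projections (vertices \<Lambda>) T"
  using family by (auto simp: toeplitz_family_def tck_family_def)

lemma hom_vert: "v \<in> vertices \<Lambda> \<Longrightarrow> \<pi> (vert v) = T v"
  using family by (simp add: toeplitz_family_def hom_i ident_arrs vertex_objs)

lemma T_vert_mult: "v \<in> vertices \<Lambda> \<Longrightarrow> w \<in> vertices \<Lambda> \<Longrightarrow> T v * T w = (if v = w then T v else 0)"
  using tck(5) by (auto simp: orthogonal_projections_def is_projection_def)

lemma T_src: "\<alpha> \<in> mor \<Lambda> \<Longrightarrow> T \<alpha> * T (src \<Lambda> \<alpha>) = T \<alpha>"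
  by (simp add: tck(1) src_mor rng_src cmp_src)

lemma T_rng: "\<alpha> \<in> mor \<Lambda> \<Longrightarrow> T (rng \<Lambda> \<alpha>) * T \<alpha> = T \<alpha>"
  by (simp add: tck(1) rng_mor src_rng cmp_rng)

text \<open>The definition of a Toeplitz--Cuntz--Krieger family prescribes composable products only.
  The others vanish because the source and range projections between the factors are
  orthogonal.\<close>

lemma T_mult:
  assumes "\<alpha> \<in> mor \<Lambda>" "\<mu> \<in> mor \<Lambda>"
  shows "T \<alpha> * T \<mu> = (if src \<Lambda> \<alpha> = rng \<Lambda> \<mu> then T (cmp \<Lambda> \<alpha> \<mu>) else 0)"
proof (cases "src \<Lambda> \<alpha> = rng \<Lambda> \<mu>")
  case False
  have "T \<alpha> * T \<mu> = (T \<alpha> * T (src \<Lambda> \<alpha>)) * (T (rng \<Lambda> \<mu>) * T \<mu>)"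
    by (simp add: T_src T_rng assms)
  also have "\<dots> = T \<alpha> * (T (src \<Lambda> \<alpha>) * T (rng \<Lambda> \<mu>)) * T \<mu>" by (simp only: mult.assoc)
  finally have "T \<alpha> * T \<mu> = T \<alpha> * (T (src \<Lambda> \<alpha>) * T (rng \<Lambda> \<mu>)) * T \<mu>" .
  thus ?thesis
    using assms False by (simp add: T_vert_mult src_vertex rng_vertex)
qed (simp add: tck(1) assms)

text \<open>For equal degrees the sum over minimal extensions has at most the term with the vertex
  \<open>src \<Lambda> \<alpha>\<close> in both places.\<close>

lemma star_T_T:
  assumes "\<alpha> \<in> level \<Lambda> p" "\<mu> \<in> level \<Lambda> p"
  shows "star (T \<alpha>) * T \<mu> = (if \<alpha> = \<mu> then T (src \<Lambda> \<alpha>) else 0)"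
proof -
  have v: "src \<Lambda> \<alpha> \<in> vertices \<Lambda>" using assms level_mor src_vertex by blast
  hence "star (T (src \<Lambda> \<alpha>)) = T (src \<Lambda> \<alpha>)"
    using tck(5) by (auto simp: orthogonal_projections_def is_projection_def)
  thus ?thesis
    using assms v by (auto simp: tck(2) level_mor min_ext_same_level T_vert_mult)
qed

definition \<rho> :: "('k \<Rightarrow> nat) \<Rightarrow> 'a \<times> ('l \<Rightarrow> 'a) \<Rightarrow> 'b"
  where "\<rho> p x = (\<Sum>\<alpha>\<in>level \<Lambda> p. T \<alpha> * \<pi> (inn (fib M p) (bas p \<alpha>) x))"

lemmas \<pi> = star_homD[OF hom]

lemma \<rho>_linear: "clinear_on (fibre M p) (\<rho> p)"
  unfolding clinear_on_def \<rho>_def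
  by (auto simp: fr.inn_add_right fr.inn_scale_right bas_fibre clinear_onD[OF \<pi>(1)]
      distrib_left sum.distrib mult_scaleC_right complex_vector.scale_sum_right)

lemma \<rho>_sum: "(\<And>j. j \<in> K \<Longrightarrow> f j \<in> fibre M p) \<Longrightarrow> \<rho> p (\<Sum>j\<in>K. f j) = (\<Sum>j\<in>K. \<rho> p (f j))"
  by (rule clinear_on_sum[OF \<rho>_linear fr.subspace])

lemma \<rho>_zero: "\<rho> p 0 = 0"
  using clinear_on_zero[OF \<rho>_linear] fr.hcar_closed by blast

text \<open>Orthonormality leaves one summand, whose source projection is absorbed by
  \<open>T \<alpha>\<close>.\<close>

lemma \<rho>_bas_ract:
  assumes "\<alpha> \<in> level \<Lambda> p"
  shows "\<rho> p (ract (fib M p) (bas p \<alpha>) a) = T \<alpha> * \<pi> a"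
proof -
  have m: "\<alpha> \<in> mor \<Lambda>" using assms level_mor by blast
  have "\<rho> p (ract (fib M p) (bas p \<alpha>) a)
      = (\<Sum>\<beta>\<in>level \<Lambda> p. if \<beta> = \<alpha> then T \<alpha> * \<pi> (vert (src \<Lambda> \<alpha>)) * \<pi> a else 0)"
    unfolding \<rho>_def
    by (intro sum.cong refl)
      (use assms clinear_on_zero[OF \<pi>(1)] in
        \<open>auto simp: fr.inn_ract bas_fibre inn_bas_bas \<pi>(2) mult.assoc\<close>)
  thus ?thesis using assms finite_level m by (simp add: hom_vert src_vertex T_src)
qed

lemma \<rho>_bas: "\<alpha> \<in> level \<Lambda> p \<Longrightarrow> \<rho> p (bas p \<alpha>) = T \<alpha>"
  using \<rho>_bas_ract[of \<alpha> p "vert (src \<Lambda> \<alpha>)"] level_mor[of \<alpha> p]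
  by (simp add: ract_bas_src hom_vert src_vertex T_src)

lemma \<rho>_ract:
  assumes "x \<in> fibre M p"
  shows "\<rho> p (ract (fib M p) x a) = \<rho> p x * \<pi> a"
  using assms by (simp add: \<rho>_def fr.inn_ract bas_fibre \<pi>(2) sum_distrib_right mult.assoc)

text \<open>Parseval's identity for the frame: orthogonality of the \<open>T \<alpha>\<close> kills
  the mixed terms, and the coefficients absorb the source projections.\<close>

lemma \<rho>_inner:
  assumes x: "x \<in> fibre M p" and y: "y \<in> fibre M p"
  shows "star (\<rho> p x) * \<rho> p y = \<pi> (inn (fib M p) x y)"
proof -
  let ?c = "\<lambda>x \<alpha>. inn (fib M p) (bas p \<alpha>) x"
  have "star (\<rho> p x) * \<rho> p y = (\<Sum>\<alpha>\<in>level \<Lambda> p. \<Sum>\<beta>\<in>level \<Lambda> p.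
      if \<beta> = \<alpha> then star (\<pi> (?c x \<alpha>)) * (T (src \<Lambda> \<alpha>) * \<pi> (?c y \<alpha>)) else 0)"
    unfolding \<rho>_def star_sum sum_product
  proof (intro sum.cong refl)
    fix \<alpha> \<beta> assume *: "\<alpha> \<in> level \<Lambda> p" "\<beta> \<in> level \<Lambda> p"
    have "star (T \<alpha> * \<pi> (?c x \<alpha>)) * (T \<beta> * \<pi> (?c y \<beta>))
      = star (\<pi> (?c x \<alpha>)) * ((star (T \<alpha>) * T \<beta>) * \<pi> (?c y \<beta>))"
      by (simp add: star_mult mult.assoc)
    thus "star (T \<alpha> * \<pi> (?c x \<alpha>)) * (T \<beta> * \<pi> (?c y \<beta>))
      = (if \<beta> = \<alpha> then star (\<pi> (?c x \<alpha>)) * (T (src \<Lambda> \<alpha>) * \<pi> (?c y \<alpha>)) else 0)"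
      by (simp add: star_T_T[OF *])
  qed
  also have "\<dots> = (\<Sum>\<alpha>\<in>level \<Lambda> p. \<pi> (star (?c x \<alpha>) * ?c y \<alpha>))"
  proof (intro sum.cong refl)
    fix \<alpha> assume \<alpha>: "\<alpha> \<in> level \<Lambda> p"
    have v: "src \<Lambda> \<alpha> \<in> vertices \<Lambda>" using \<alpha> level_mor src_vertex by blast
    have "vert (src \<Lambda> \<alpha>) * ?c y \<alpha> = ?c y \<alpha>"
      using fr.inn_ract_left[OF bas_fibre[OF \<alpha>] y, of "vert (src \<Lambda> \<alpha>)"]
      by (simp add: ract_bas_src[OF \<alpha>] star_vert[OF v])
    hence "T (src \<Lambda> \<alpha>) * \<pi> (?c y \<alpha>) = \<pi> (?c y \<alpha>)" by (metis \<pi>(2) hom_vert[OF v])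
    thus "(\<Sum>\<beta>\<in>level \<Lambda> p. if \<beta> = \<alpha> then star (\<pi> (?c x \<alpha>)) * (T (src \<Lambda> \<alpha>) * \<pi> (?c y \<alpha>)) else 0)
        = \<pi> (star (?c x \<alpha>) * ?c y \<alpha>)"
      using \<alpha> finite_level by (simp add: \<pi>)
  qed
  also have "\<dots> = \<pi> (\<Sum>\<alpha>\<in>level \<Lambda> p. star (?c x \<alpha>) * ?c y \<alpha>)"
    by (simp add: clinear_on_UNIV_sum[OF \<pi>(1)])
  also have "(\<Sum>\<alpha>\<in>level \<Lambda> p. star (?c x \<alpha>) * ?c y \<alpha>)
      = inn (fib M p) x (\<Sum>\<alpha>\<in>level \<Lambda> p. ract (fib M p) (bas p \<alpha>) (?c y \<alpha>))"
    using x by (simp add: fr.inn_sum_right fr.ract_closed bas_fibre fr.inn_ract fr.star_inn)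
  finally show ?thesis by (simp add: bas_frame y)
qed

text \<open>In degree 0 the summands are \<open>T v * \<pi> a\<close>, and the \<open>T v\<close>
  sum to the identity.\<close>

lemma \<rho>_0: "\<rho> 0 (emb M a) = \<pi> a"
proof -
  have "\<rho> 0 (emb M a) = (\<Sum>v\<in>vertices \<Lambda>. T v * \<pi> a)"
    unfolding \<rho>_def vertices_level[symmetric]
  proof (intro sum.cong refl)
    fix v assume v: "v \<in> vertices \<Lambda>"
    have "inn (fib M 0) (bas 0 v) (emb M a) = vert v * a"
      by (simp add: bas_def emb_inn star_vert v)
    thus "T v * \<pi> (inn (fib M 0) (bas 0 v) (emb M a)) = T v * \<pi> a"
      using T_vert_mult[OF v v] by (simp add: \<pi>(2) hom_vert[OF v] flip: mult.assoc)
  qed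
  thus ?thesis by (simp add: tck(3) flip: sum_distrib_right)
qed

text \<open>On basis vectors this is relation (3) of the family; the frame expansion and the right
  action carry it to the whole fibre.\<close>

lemma \<rho>_lact_i:
  assumes g: "g \<in> arrs G" and y: "y \<in> fibre M q"
  shows "\<pi> (i g) * \<rho> q y = \<rho> q (lact M q (i g) y)"
proof -
  let ?c = "\<lambda>\<mu>. inn (fib M q) (bas q \<mu>) y"
  have "lact M q (i g) y = lact M q (i g) (\<Sum>\<mu>\<in>level \<Lambda> q. ract (fib M q) (bas q \<mu>) (?c \<mu>))"
    by (simp add: bas_frame y)
  also have "\<dots> = (\<Sum>\<mu>\<in>level \<Lambda> q. ract (fib M q) (lact M q (i g) (bas q \<mu>)) (?c \<mu>))"
    by (subst lact_sum) (simp_all add: fr.ract_closed bas_fibre lact_ract)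
  finally have "\<rho> q (lact M q (i g) y)
      = (\<Sum>\<mu>\<in>level \<Lambda> q. \<rho> q (ract (fib M q) (lact M q (i g) (bas q \<mu>)) (?c \<mu>)))"
    by (simp add: \<rho>_sum fr.ract_closed lact_fibre bas_fibre)
  also have "\<dots> = (\<Sum>\<mu>\<in>level \<Lambda> q. \<pi> (i g) * (T \<mu> * \<pi> (?c \<mu>)))"
  proof (intro sum.cong refl)
    fix \<mu> assume \<mu>: "\<mu> \<in> level \<Lambda> q"
    have m: "\<mu> \<in> mor \<Lambda>" using \<mu> level_mor by blast
    have "\<rho> q (lact M q (i g) (bas q \<mu>)) = U g * T \<mu>"
      using act_level(1)[OF g \<mu>] restriction_arr(1)[OF g m]
      by (auto simp: lact_bas[OF g \<mu>] tck(4)[OF g m] \<rho>_bas_ract hom_i \<rho>_zero)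
    thus "\<rho> q (ract (fib M q) (lact M q (i g) (bas q \<mu>)) (?c \<mu>)) = \<pi> (i g) * (T \<mu> * \<pi> (?c \<mu>))"
      by (simp add: \<rho>_ract lact_fibre bas_fibre \<mu> hom_i g mult.assoc)
  qed
  finally show ?thesis by (simp add: \<rho>_def sum_distrib_left)
qed

lemma \<rho>_lact:
  assumes y: "y \<in> fibre M q"
  shows "\<pi> a * \<rho> q y = \<rho> q (lact M q a y)"
proof -
  have linear: "clinear_on UNIV (\<lambda>a. \<rho> q (lact M q a z))" if "z \<in> fibre M q" for z
    using that unfolding clinear_on_def
    by (simp add: clinear_onD[OF lact_linear] scaleC_fun_apply clinear_onD[OF \<rho>_linear] lact_fibre)
  \<comment> \<open>All \<open>z\<close> are treated together because the product step applies the
    hypothesis for \<open>a\<close> to the vector \<open>lact M q b z\<close>.\<close>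
  have "\<forall>z\<in>fibre M q. \<pi> a * \<rho> q z = \<rho> q (lact M q a z)"
    using gen
  proof (induction a rule: cstar_generated_induct)
    case (gen a)
    thus ?case using \<rho>_lact_i ginv_arrs by (auto simp: unitary_repD(3)[OF rep])
  next
    case closed
    \<comment> \<open>This map is not multiplicative, but by \<open>\<rho>_inner\<close> its square
      depends on \<open>star a * a\<close> alone, through \<open>b\<close> mapped to \<pi> of the
      inner product of \<open>z\<close> with \<open>lact M q b z\<close>.\<close>
    have "bounded_linear (\<lambda>a. \<rho> q (lact M q a z))" if z: "z \<in> fibre M q" for z
    proof (rule clinear_bounded_of_pairing[OF linear[OF z]])
      fix a
      have "star (\<rho> q (lact M q a z)) * \<rho> q (lact M q a z)
          = \<pi> (inn (fib M q) z (lact M q (star a) (lact M q a z)))"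
        using z by (simp add: \<rho>_inner lact_fibre fr.is_adjointD[OF lact_star])
      thus "star (\<rho> q (lact M q a z)) * \<rho> q (lact M q a z)
          = (\<lambda>b. \<pi> (inn (fib M q) z (lact M q b z))) (star a * a)"
        by (simp add: lact_mult z)
    qed (rule unit_mult)+
    hence "continuous_on UNIV (\<lambda>a. \<rho> q (lact M q a z))" if "z \<in> fibre M q" for z
      using that linear_continuous_on by blast
    moreover have "continuous_on UNIV \<pi>"
      by (rule linear_continuous_on[OF star_hom_bounded[OF hom]]) (rule unit_mult)+
    ultimately have "closed (\<Inter>z\<in>fibre M q. {a. \<pi> a * \<rho> q z = \<rho> q (lact M q a z)})"
      by (intro closed_INT ballI closed_Collect_eq continuous_intros) auto
    thus ?case by (simp add: Collect_ball_eq)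
  next
    case zero
    show ?case using clinear_on_zero[OF linear] clinear_on_zero[OF \<pi>(1)] by simp
  next
    case (add a b)
    thus ?case using clinear_onD(1)[OF linear] clinear_onD(1)[OF \<pi>(1)]
      by (simp add: distrib_right)
  next
    case (scale c a)
    thus ?case using clinear_onD(2)[OF linear] clinear_onD(2)[OF \<pi>(1)]
      by (simp add: mult_scaleC_left)
  next
    case (mult a b)
    thus ?case by (simp add: \<pi>(2) lact_mult lact_fibre mult.assoc)
  qed
  thus ?thesis using y by blast
qed

lemma \<rho>_bas_mult:
  assumes \<alpha>: "\<alpha> \<in> level \<Lambda> p" and y: "y \<in> fibre M q"
  shows "\<rho> (p + q) (mul M p q (bas p \<alpha>) y) = T \<alpha> * \<rho> q y"
proof -
  let ?c = "\<lambda>\<mu>. inn (fib M q) (bas q \<mu>) y"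
  have m: "\<alpha> \<in> mor \<Lambda>" using \<alpha> level_mor by blast
  have "mul M p q (bas p \<alpha>) y
      = mul M p q (bas p \<alpha>) (\<Sum>\<mu>\<in>level \<Lambda> q. ract (fib M q) (bas q \<mu>) (?c \<mu>))"
    by (simp add: bas_frame y)
  also have "\<dots> = (\<Sum>\<mu>\<in>level \<Lambda> q. ract (fib M (p + q)) (mul M p q (bas p \<alpha>) (bas q \<mu>)) (?c \<mu>))"
    by (subst mul_sum_right) (simp_all add: fr.ract_closed bas_fibre \<alpha> mul_ract_right)
  finally have "\<rho> (p + q) (mul M p q (bas p \<alpha>) y)
      = (\<Sum>\<mu>\<in>level \<Lambda> q. \<rho> (p + q) (mul M p q (bas p \<alpha>) (bas q \<mu>)) * \<pi> (?c \<mu>))"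
    by (simp add: \<rho>_sum fr.ract_closed mul_fibre bas_fibre \<alpha> \<rho>_ract)
  also have "\<dots> = (\<Sum>\<mu>\<in>level \<Lambda> q. T \<alpha> * (T \<mu> * \<pi> (?c \<mu>)))"
  proof (intro sum.cong refl)
    fix \<mu> assume \<mu>: "\<mu> \<in> level \<Lambda> q"
    have "\<rho> (p + q) (mul M p q (bas p \<alpha>) (bas q \<mu>)) = T \<alpha> * T \<mu>"
      using cmp_level[OF \<alpha> \<mu>] by (simp add: mul_bas[OF \<alpha> \<mu>] T_mult m level_mor[OF \<mu>] \<rho>_bas \<rho>_zero)
    thus "\<rho> (p + q) (mul M p q (bas p \<alpha>) (bas q \<mu>)) * \<pi> (?c \<mu>) = T \<alpha> * (T \<mu> * \<pi> (?c \<mu>))"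
      by (simp add: mult.assoc)
  qed
  finally show ?thesis by (simp add: \<rho>_def sum_distrib_left)
qed

text \<open>Balancing lets the coefficients of \<open>x\<close> act on \<open>y\<close> from the
  left, and \<open>\<rho>_lact\<close> is what takes them out of \<rho> again.\<close>

lemma \<rho>_mult:
  assumes x: "x \<in> fibre M p" and y: "y \<in> fibre M q"
  shows "\<rho> (p + q) (mul M p q x y) = \<rho> p x * \<rho> q y"
proof -
  let ?c = "\<lambda>\<alpha>. inn (fib M p) (bas p \<alpha>) x"
  have "mul M p q x y = mul M p q (\<Sum>\<alpha>\<in>level \<Lambda> p. ract (fib M p) (bas p \<alpha>) (?c \<alpha>)) y"
    by (simp add: bas_frame x)
  also have "\<dots> = (\<Sum>\<alpha>\<in>level \<Lambda> p. mul M p q (bas p \<alpha>) (lact M q (?c \<alpha>) y))"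
    by (subst mul_sum_left) (simp_all add: fr.ract_closed bas_fibre y mul_ract_left)
  finally have "\<rho> (p + q) (mul M p q x y) = (\<Sum>\<alpha>\<in>level \<Lambda> p. T \<alpha> * \<rho> q (lact M q (?c \<alpha>) y))"
    by (simp add: \<rho>_sum mul_fibre bas_fibre lact_fibre y \<rho>_bas_mult)
  thus ?thesis
    by (simp add: \<rho>_def[of p] sum_distrib_right mult.assoc \<rho>_lact[OF y])
qed

sublocale ss_toeplitz \<Lambda> G \<Phi> i M \<rho>
proof unfold_locales
  show "toeplitz_rep M \<rho>"
    unfolding toeplitz_rep_def
    using hom \<rho>_linear \<rho>_inner \<rho>_mult by (simp add: \<rho>_0)
qed

lemma t_eq: "\<alpha> \<in> mor \<Lambda> \<Longrightarrow> t \<alpha> = T \<alpha>"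
  by (simp add: ss_t_eq[OF levelI[OF _ refl]] \<rho>_bas[OF levelI[OF _ refl]])

lemma u_eq: "g \<in> arrs G \<Longrightarrow> u g = U g"
  by (simp add: ss_u_eq \<rho>_0 hom_i)

lemma nica: "nica_covariant M \<rho>"
proof (rule nica_covariantI)
  fix \<alpha> \<mu> assume m: "\<alpha> \<in> mor \<Lambda>" "\<mu> \<in> mor \<Lambda>"
  have "(\<Sum>(\<eta>, \<zeta>)\<in>min_ext \<Lambda> \<alpha> \<mu>. t \<eta> * star (t \<zeta>)) = (\<Sum>(\<eta>, \<zeta>)\<in>min_ext \<Lambda> \<alpha> \<mu>. T \<eta> * star (T \<zeta>))"
    by (intro sum.cong refl) (auto simp: min_ext_def t_eq)
  thus "star (t \<alpha>) * t \<mu> = (\<Sum>(\<eta>, \<zeta>)\<in>min_ext \<Lambda> \<alpha> \<mu>. t \<eta> * star (t \<zeta>))"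
    using m by (simp add: t_eq tck(2))
qed

end

theorem proposition6p2:
  fixes \<Lambda> :: "('l, 'k::finite) graph"
    and G :: "('l, 'g) gpd"
    and \<Phi> :: "'g \<Rightarrow> 'l pisom"
    and i :: "'g \<Rightarrow> 'a::cstar_algebra"
    and M :: "('k, 'a, 'a \<times> ('l \<Rightarrow> 'a)) prodsys"
    and \<psi> :: "('k \<Rightarrow> nat) \<Rightarrow> 'a \<times> ('l \<Rightarrow> 'a) \<Rightarrow> 'n::cstar_algebra"
  assumes "finite_kgraph \<Lambda>"
    and "self_similar_action \<Lambda> G \<Phi>"
    and "groupoid_cstar TYPE('b::cstar_algebra) G i"
    and "ss_product_system \<Lambda> G \<Phi> i M"
    and "nica_toeplitz_algebra TYPE('b) M \<psi>"
  shows "universal_toeplitz_family TYPE('b) \<Lambda> G \<Phi> (ss_u M i \<psi>) (ss_t \<Lambda> G M i \<psi>)"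
proof -
  interpret ss_system \<Lambda> G \<Phi> i M
    using assms(1-4) by unfold_locales (auto simp: groupoid_cstar_def)
  have \<psi>: "nica_covariant M \<psi>" "cstar_generated (\<Union>p. \<psi> p ` fibre M p) = UNIV"
    using assms(5) by (auto simp: nica_toeplitz_algebra_def)
  interpret \<psi>: ss_toeplitz \<Lambda> G \<Phi> i M \<psi>
    using \<psi>(1) by unfold_locales (simp add: nica_covariant_def)
  have "\<exists>\<rho>. star_hom \<rho> \<and> (\<forall>g\<in>arrs G. \<rho> (ss_u M i \<psi> g) = U g) \<and>
      (\<forall>\<alpha>\<in>mor \<Lambda>. \<rho> (ss_t \<Lambda> G M i \<psi> \<alpha>) = T \<alpha>)"
    if UT: "toeplitz_family \<Lambda> G \<Phi> U T" for U :: "'g \<Rightarrow> 'b" and T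
  proof -
    \<comment> \<open>Universality of C^*(G) supplies the degree 0 part of the representation built
      from the family.\<close>
    obtain \<pi> where "star_hom \<pi>" "\<And>g. g \<in> arrs G \<Longrightarrow> \<pi> (i g) = U g"
      using assms(3) UT by (auto simp: groupoid_cstar_def toeplitz_family_def)
    then interpret fam: ss_family \<Lambda> G \<Phi> i M U T \<pi>
      using UT by unfold_locales auto
    \<comment> \<open>As that representation is Nica covariant, universality of \<psi> factors it;
      evaluating on the \<open>emb M (i g)\<close> and on the basis gives the two required
      equations.\<close>
    obtain \<sigma> where \<sigma>: "star_hom \<sigma>" "\<And>p x. x \<in> fibre M p \<Longrightarrow> \<sigma> (\<psi> p x) = fam.\<rho> p x"
      using assms(5) fam.nica by (auto simp: nica_toeplitz_algebra_def)
    have "\<sigma> (ss_u M i \<psi> g) = U g" if "g \<in> arrs G" for g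
      using \<sigma>(2)[OF emb_fibre] fam.u_eq[OF that] by (simp add: ss_u_eq)
    moreover have "\<sigma> (ss_t \<Lambda> G M i \<psi> \<alpha>) = T \<alpha>" if "\<alpha> \<in> mor \<Lambda>" for \<alpha>
    proof -
      have "\<alpha> \<in> level \<Lambda> (deg \<Lambda> \<alpha>)" using that by (simp add: level_def)
      thus ?thesis using \<sigma>(2)[OF bas_fibre] fam.\<rho>_bas by (simp add: ss_t_eq)
    qed
    ultimately show ?thesis using \<sigma>(1) by blast
  qed
  thus ?thesis
    using \<psi>.toeplitz_familyI[OF \<psi>] \<psi>.generated_ut[OF \<psi>(2)]
    by (simp add: universal_toeplitz_family_def)
qed

end
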